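(* Let $n\ge1$ be fixed, let $\gamma_1,\dots,\gamma_{n-1}>-1$ and $\delta_1,\dots,\delta_{2n-1}>0$. For $s>0$ let $\gamma^{(s)}=(\gamma^{(s)}_k)_{1\le k\le 2n-1}$ and $\delta^{(s)}=(\delta_k^{(s)})_{1\le k\le 2n-1}$ be real parameters, all $>-1$, and denote by $f_{2n-1}^{(\gamma^{(s)},\delta^{(s)})}$ the density on the moment space $\mathcal{M}_{2n-1}([-s,s])$ given by $$f_{2n-1}^{(\gamma^{(s)},\delta^{(s)})}(\mathbf{m}_{2n-1})=c\prod_{k=1}^{2n-1}\Big(\frac{m_k-m_k^-}{m_k^+-m_k^-}\Big)^{\gamma_k^{(s)}}\Big(\frac{m_k^+-m_k}{m_k^+-m_k^-}\Big)^{\delta_k^{(s)}}\mathbf{1}_{\{m_k^-<m_k<m_k^+\}},$$ where $c$ is the normalizing constant (depending on $n,s$ and the parameters) and $m_k^\pm$ are the bounds for the interval $[-s,s]$. Suppose that, as $s\to\infty$, $$\gamma_{2k-1}^{(s)}=\delta_{2k-1}s^2+o(1),\qquad \delta_{2k-1}^{(s)}=\delta_{2k-1}s^2+o(1),\qquad k=1,\dots,n,$$ $$\gamma_{2k}^{(s)}=\gamma_k+o(1),\qquad \delta_{2k}^{(s)}=\delta_{2k}s^2+o(s^2),\qquad k=1,\dots,n-1.$$ Then, as $s\to\infty$, $f_{2n-1}^{(\gamma^{(s)},\delta^{(s)})}$ converges pointwise to the function $$h_{2n-1}^{(\gamma,\delta)}(\mathbf{m}_{2n-1})=\prod_{k=1}^n\sqrt{\frac{\delta_{2k-1}}{\pi}}\exp\big(-\delta_{2k-1}b_k^2(\mathbf{m}_{2n-1})\big)\times\prod_{k=1}^{n-1}\frac{\delta_{2k}^{\gamma_k+2n-2k}}{\Gamma(\gamma_k+2n-2k)}a_k^{\gamma_k}(\mathbf{m}_{2n-1})\exp\big(-\delta_{2k}a_k(\mathbf{m}_{2n-1})\big)\mathbf{1}_{\{a_k(\mathbf{m}_{2n-1})>0\}}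 .$$ Moreover, the function $h_{2n-1}^{(\gamma,\delta)}$ defines a (probability) density on the moment space $\mathcal{M}_{2n-1}(\mathbb{R})$.
   Context: For $T\subset\mathbb{R}$, $\mathcal{P}(T)$ is the set of probability measures on the Borel field of $T$ with all moments existing, $m_k(\mu)=\int_Tx^k\,\mu(dx)$, and $\mathcal{M}_N(T)=\{(m_1(\mu),\dots,m_N(\mu))^T:\mu\in\mathcal{P}(T)\}\subset\mathbb{R}^N$. Densities are with respect to Lebesgue measure and vanish outside the interior of the respective moment space. For $(m_1,\dots,m_{k-1})\in\mathcal{M}_{k-1}([-s,s])$, $m_k^-$ and $m_k^+$ are the minimum and maximum of $m_k(\mu)$ over all $\mu\in\mathcal{P}([-s,s])$ with $m_i(\mu)=m_i$, $i=1,\dots,k-1$. A point $(m_1,\dots,m_N)$ is in the interior of $\mathcal{M}_N([-s,s])$ iff $m_k^-<m_k<m_k^+$ for all $k=1,\dots,N$. For $\mathbf{m}_{2n-1}=(m_1,\dots,m_{2n-1})^T$ in the interior of $\mathcal{M}_{2n-1}(\mathbb{R})$, let $P_0=1,P_1,\dots,P_n$ be the monic orthogonal polynomials associated with $\mathbf{m}_{2n-1}$ (orthogonal with respect to every probability measure with first moments $m_1,\dots,m_{2n-1}$). They satisfy $P_1(x)=x-b_1$ and $$xP_k(x)=P_{k+1}(x)+b_{k+1}P_k(x)+a_kP_{k-1}(x),\qquad k=1,\dots,n-1,$$ with $b_k=b_k(\mathbf{m}_{2n-1})\in\mathbb{R}$ and $a_k=a_k(\mathbf{m}_{2n-1})>0$.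 The map $\mathbf{m}_{2n-1}\mapsto(b_1,a_1,\dots,a_{n-1},b_n)^T$ is a bijection from the interior of $\mathcal{M}_{2n-1}(\mathbb{R})$ onto $(\mathbb{R}\times\mathbb{R}^+)^{n-1}\times\mathbb{R}$. The indicators $\mathbf 1_{\{a_k>0\}}$ express that $\mathbf{m}_{2n-1}$ lies in this interior. *)

theory Defs
  imports
    "HOL-Probability.Probability"
    "HOL-Computational_Algebra.Polynomial"
    "HOL-Library.Landau_Symbols"
begin

text \<open>
  A vector of \<open>\<real>\<^sup>N\<close> is a function \<open>m :: nat \<Rightarrow> real\<close> that is extensional on \<open>{1..N}\<close>, so that
  component \<open>k\<close> of a moment vector is \<open>m k\<close>. The topology on \<open>\<real>\<^sup>N\<close> is the product topology and
  Lebesgue measure is the product measure of \<open>N\<close> copies of \<^term>\<open>lborel\<close>.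
\<close>

abbreviation lebesgue_space :: "nat \<Rightarrow> (nat \<Rightarrow> real) measure" where
  "lebesgue_space N \<equiv> Pi\<^sub>M {1..N} (\<lambda>_. lborel)"

definition moment_measures :: "real set \<Rightarrow> real measure set" where
  "moment_measures T =
     {\<mu>. prob_space \<mu> \<and> sets \<mu> = sets (restrict_space borel T) \<and> (\<forall>k::nat. integrable \<mu> (\<lambda>x. x ^ k))}"

definition mom :: "nat \<Rightarrow> real measure \<Rightarrow> real" where
  "mom k \<mu> = (\<integral>x. x ^ k \<partial>\<mu>)"

definition moment_space :: "nat \<Rightarrow> real set \<Rightarrow> (nat \<Rightarrow> real) set" where
  "moment_space N T = (\<lambda>\<mu>. \<lambda>k\<in>{1..N}. mom k \<mu>) ` moment_measures T"

definition moment_space_interior :: "nat \<Rightarrow> real set \<Rightarrow> (nat \<Rightarrow> real) set" where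
  "moment_space_interior N T = product_topology (\<lambda>_. euclideanreal) {1..N} interior_of moment_space N T"


text \<open>
  The bounds \<open>m\<^sub>k\<^sup>-\<close> and \<open>m\<^sub>k\<^sup>+\<close> for the interval \<open>[-s,s]\<close>; only the components \<open>m 1, \<dots>, m (k - 1)\<close>
  matter. The values are meaningful only if these components form a point of the moment space
  \<^term>\<open>moment_space (k - 1) {-s..s}\<close>.
\<close>

definition mom_lower :: "real \<Rightarrow> nat \<Rightarrow> (nat \<Rightarrow> real) \<Rightarrow> real" where
  "mom_lower s k m =
     (LEAST x. \<exists>\<mu>\<in>moment_measures {-s..s}. (\<forall>i\<in>{1..<k}. mom i \<mu> = m i) \<and> mom k \<mu> = x)"

definition mom_upper :: "real \<Rightarrow> nat \<Rightarrow> (nat \<Rightarrow> real) \<Rightarrow> real" where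
  "mom_upper s k m =
     (GREATEST x. \<exists>\<mu>\<in>moment_measures {-s..s}. (\<forall>i\<in>{1..<k}. mom i \<mu> = m i) \<and> mom k \<mu> = x)"


text \<open>
  The density without its normalizing constant. At a point outside the interior of the moment space
  there is a first \<open>k\<close> violating \<open>m\<^sub>k\<^sup>- < m\<^sub>k < m\<^sub>k\<^sup>+\<close>; for this \<open>k\<close> the earlier components lie in a
  moment space, so the bounds are meaningful, the \<open>k\<close>-th indicator vanishes and with it the whole
  product, whatever values the bounds of higher index have.
\<close>

definition unnorm_dens ::
    "nat \<Rightarrow> real \<Rightarrow> (nat \<Rightarrow> real) \<Rightarrow> (nat \<Rightarrow> real) \<Rightarrow> (nat \<Rightarrow> real) \<Rightarrow> real" where
  "unnorm_dens N s \<gamma> \<delta> m =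
     (\<Prod>k=1..N.
        ((m k - mom_lower s k m) / (mom_upper s k m - mom_lower s k m)) powr \<gamma> k
      * ((mom_upper s k m - m k) / (mom_upper s k m - mom_lower s k m)) powr \<delta> k
      * indicator {mom_lower s k m <..< mom_upper s k m} (m k))"

definition moment_dens ::
    "nat \<Rightarrow> real \<Rightarrow> (nat \<Rightarrow> real) \<Rightarrow> (nat \<Rightarrow> real) \<Rightarrow> (nat \<Rightarrow> real) \<Rightarrow> real" where
  "moment_dens N s \<gamma> \<delta> m =
     (1 / (\<integral>m'. unnorm_dens N s \<gamma> \<delta> m' \<partial>lebesgue_space N)) * unnorm_dens N s \<gamma> \<delta> m"


definition is_monic_orth_poly :: "nat \<Rightarrow> (nat \<Rightarrow> real) \<Rightarrow> nat \<Rightarrow> real poly \<Rightarrow> bool" where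
  "is_monic_orth_poly N m k p \<longleftrightarrow>
     degree p = k \<and> lead_coeff p = 1 \<and>
     (\<forall>\<mu>\<in>moment_measures UNIV. (\<forall>i\<in>{1..N}. mom i \<mu> = m i) \<longrightarrow>
        (\<forall>q. degree q < k \<longrightarrow> (\<integral>x. poly p x * poly q x \<partial>\<mu>) = 0))"

definition monic_orth_poly :: "nat \<Rightarrow> (nat \<Rightarrow> real) \<Rightarrow> nat \<Rightarrow> real poly" where
  "monic_orth_poly N m k = (THE p. is_monic_orth_poly N m k p)"

text \<open>
  The coefficients of \<open>x P\<^sub>k = P\<^sub>k\<^sub>+\<^sub>1 + b\<^sub>k\<^sub>+\<^sub>1 P\<^sub>k + a\<^sub>k P\<^sub>k\<^sub>-\<^sub>1\<close>, with \<open>P\<^sub>1 = x - b\<^sub>1\<close>. For \<open>N = 2n - 1\<close> and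
  \<open>m\<close> in the interior of the moment space of the real line, they are determined for
  \<open>a\<^sub>1, \<dots>, a\<^sub>n\<^sub>-\<^sub>1\<close> and \<open>b\<^sub>1, \<dots>, b\<^sub>n\<close>.
\<close>

definition rec_a :: "nat \<Rightarrow> (nat \<Rightarrow> real) \<Rightarrow> nat \<Rightarrow> real" where
  "rec_a N m k =
     (THE a. \<exists>b. [:0, 1:] * monic_orth_poly N m k =
        monic_orth_poly N m (k + 1) + smult b (monic_orth_poly N m k)
          + smult a (monic_orth_poly N m (k - 1)))"

definition rec_b :: "nat \<Rightarrow> (nat \<Rightarrow> real) \<Rightarrow> nat \<Rightarrow> real" where
  "rec_b N m k =
     (if k = 1 then THE b. monic_orth_poly N m 1 = [:- b, 1:]
      else THE b. \<exists>a. [:0, 1:] * monic_orth_poly N m (k - 1) =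
        monic_orth_poly N m k + smult b (monic_orth_poly N m (k - 1))
          + smult a (monic_orth_poly N m (k - 2)))"


text \<open>
  The coefficients \<open>a\<^sub>k\<close>, \<open>b\<^sub>k\<close> exist only on the interior of the moment space; the leading
  indicator implements the convention that densities vanish outside of it (there the values
  of \<^const>\<open>rec_a\<close> and \<^const>\<open>rec_b\<close> are unspecified).
\<close>

definition limit_dens ::
    "nat \<Rightarrow> (nat \<Rightarrow> real) \<Rightarrow> (nat \<Rightarrow> real) \<Rightarrow> (nat \<Rightarrow> real) \<Rightarrow> real" where
  "limit_dens n \<gamma> \<delta> m =
     indicator (moment_space_interior (2 * n - 1) UNIV) m
     * (\<Prod>k=1..n. sqrt (\<delta> (2 * k - 1) / pi) * exp (- \<delta> (2 * k - 1) * (rec_b (2 * n - 1) m k)\<^sup>2))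
     * (\<Prod>k=1..n-1.
          \<delta> (2 * k) powr (\<gamma> k + 2 * real n - 2 * real k) / Gamma (\<gamma> k + 2 * real n - 2 * real k)
        * rec_a (2 * n - 1) m k powr \<gamma> k
        * exp (- \<delta> (2 * k) * rec_a (2 * n - 1) m k)
        * indicator {0<..} (rec_a (2 * n - 1) m k))"


definition prob_density_on :: "nat \<Rightarrow> real set \<Rightarrow> ((nat \<Rightarrow> real) \<Rightarrow> real) \<Rightarrow> bool" where
  "prob_density_on N T h \<longleftrightarrow>
     h \<in> borel_measurable (lebesgue_space N) \<and>
     (\<forall>m\<in>space (lebesgue_space N). 0 \<le> h m) \<and>
     (\<forall>m\<in>space (lebesgue_space N) - moment_space_interior N T. h m = 0) \<and>
     (\<integral>\<^sup>+ m. ennreal (h m) \<partial>lebesgue_space N) = 1"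

end

theory Submission
  imports Defs "HOL-Computational_Algebra.Fundamental_Theorem_Algebra"
begin

text \<open>
  A moment vector is identified with the functional it induces on polynomials. For the weights
  \<open>1\<close>, \<open>s + x\<close>, \<open>s - x\<close>, \<open>s\<^sup>2 - x\<^sup>2\<close> let \<open>T\<close> be the monic orthogonal polynomials of the weighted
  functional. If \<open>v T\<^sup>2\<close> has degree \<open>k\<close>, its integral is nonnegative for every measure on \<open>[-s,s]\<close>
  and vanishes for the quadrature measure carried by the zeros of \<open>v T\<close>; as it equals
  \<open>m\<^sub>k\<close> minus a function of the lower moments for one choice of \<open>v\<close>, and the negative of such an
  expression for another, it yields \<open>m\<^sub>k - m\<^sub>k\<^sup>-\<close> and \<open>m\<^sub>k\<^sup>+ - m\<^sub>k\<close>. Comparing the four families gives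
  \<open>m\<^sub>k\<^sub>+\<^sub>1\<^sup>+ - m\<^sub>k\<^sub>+\<^sub>1\<^sup>- = 2 s p\<^sub>k (1 - p\<^sub>k) (m\<^sub>k\<^sup>+ - m\<^sub>k\<^sup>-)\<close> for the canonical moments \<open>p\<^sub>k\<close>, and relations that force
  \<open>s\<^sup>2 p\<^sub>2\<^sub>k \<longlonglongrightarrow> a\<^sub>k\<close> and \<open>s (2 p\<^sub>2\<^sub>k\<^sub>-\<^sub>1 - 1) \<longlonglongrightarrow> b\<^sub>k\<close>. Both \<open>m \<mapsto> (p\<^sub>1, p\<^sub>2, \<dots>)\<close> and
  \<open>m \<mapsto> (b\<^sub>1, a\<^sub>1, b\<^sub>2, \<dots>)\<close> are affine in \<open>m\<^sub>k\<close> given the lower moments, so the densities integrate one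
  coordinate at a time, to products of Beta integrals and of Gaussian and Gamma integrals. The
  pointwise limit is then that of each factor, by log-convexity of the Gamma function.
\<close>

section \<open>The moment functional and its orthogonal polynomials\<close>

text \<open>No Hankel determinants occur. Gram-Schmidt writes the relevant quantities as integrals
  of \<open>v T^2\<close> with \<open>T\<close> monic, and such an integral of total degree
  \<open>k\<close> is affine in \<open>m k\<close> with slope 1 or -1. This gives at once the ends
  of the range of \<open>m k\<close>, the independence of its width from \<open>m k\<close>, and the
  triangular Jacobians. A moment vector is \<open>undefined\<close> outside \<open>{1..N}\<close>,
  index 0 included, so \<open>riesz\<close> inserts the total mass 1 at index 0. All constructions
  are total in \<open>m\<close> (division by zero yields 0) and hence measurable everywhere, while
  identities are claimed only where the earlier norms are positive; off that region some coordinate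
  leaves its support and the integrand vanishes. The real line is linked to \<open>[-s,s]\<close> by
  the Gauss quadrature measure of the given moment vector: it has finitely many atoms, so they lie
  inside \<open>(-s,s)\<close> for all large \<open>s\<close>.\<close>

definition riesz :: "(nat \<Rightarrow> real) \<Rightarrow> real poly \<Rightarrow> real" where
  "riesz m p = (\<Sum>i\<le>degree p. coeff p i * (if i = 0 then 1 else m i))"

lemma riesz_altdef:
  assumes "degree p \<le> d"
  shows "riesz m p = (\<Sum>i\<le>d. coeff p i * (if i = 0 then 1 else m i))"
  unfolding riesz_def
  by (rule sum.mono_neutral_left) (use assms in \<open>auto simp: coeff_eq_0\<close>)

lemma riesz_add [simp]: "riesz m (p + q) = riesz m p + riesz m q"
proof -
  define d where "d = max (degree p) (degree q)"
  have "degree p \<le> d" "degree q \<le> d" "degree (p + q) \<le> d"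
    unfolding d_def by (auto intro: degree_add_le)
  then show ?thesis
    by (simp add: riesz_altdef[of _ d] sum.distrib algebra_simps)
qed

lemma riesz_smult [simp]: "riesz m (smult c p) = c * riesz m p"
  by (simp add: riesz_altdef[of "smult c p" "degree p"] riesz_def sum_distrib_left mult.assoc)

lemma riesz_0 [simp]: "riesz m 0 = 0"
  by (simp add: riesz_def)

lemma riesz_1 [simp]: "riesz m 1 = 1"
  by (simp add: riesz_def)

lemma riesz_minus [simp]: "riesz m (- p) = - riesz m p"
  using riesz_smult[of m "-1" p] by simp

lemma riesz_diff [simp]: "riesz m (p - q) = riesz m p - riesz m q"
  using riesz_add[of m p "-q"] by simp

lemma riesz_sum [simp]: "riesz m (sum f A) = (\<Sum>x\<in>A. riesz m (f x))"
  by (induction A rule: infinite_finite_induct) auto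

lemma riesz_cong:
  assumes "\<And>i. 1 \<le> i \<Longrightarrow> i \<le> degree p \<Longrightarrow> m i = m' i"
  shows "riesz m p = riesz m' p"
  unfolding riesz_def by (rule sum.cong) (use assms in auto)

lemma riesz_monom:
  assumes "i \<ge> 1"
  shows "riesz m (monom 1 i) = m i"
proof -
  have "riesz m (monom 1 i) = (\<Sum>j\<le>i. (if j = i then m i else 0))"
    unfolding riesz_def degree_monom_eq[OF one_neq_zero]
    by (rule sum.cong) (use assms in \<open>auto simp: coeff_monom\<close>)
  then show ?thesis by simp
qed

text \<open>Only the top coefficient meets \<open>m k\<close>. Every later statement that a gap or a
  coordinate is affine in \<open>m k\<close> comes from here.\<close>

lemma riesz_change_top:
  assumes "\<And>i. i \<in> {1..<k} \<Longrightarrow> m' i = m i" "degree p \<le> k" "k \<ge> 1"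
  shows "riesz m' p = riesz m p + coeff p k * (m' k - m k)"
proof -
  have *: "{..k} = insert k {..<k}" by auto
  have "(\<Sum>i<k. coeff p i * (if i = 0 then 1 else m' i))
      = (\<Sum>i<k. coeff p i * (if i = 0 then 1 else m i))"
    by (rule sum.cong) (use assms(1) in auto)
  then show ?thesis
    using assms(3) by (simp add: riesz_altdef[OF assms(2)] * algebra_simps)
qed

definition rinner :: "(nat \<Rightarrow> real) \<Rightarrow> real poly \<Rightarrow> real poly \<Rightarrow> real poly \<Rightarrow> real" where
  "rinner m v p q = riesz m (v * p * q)"

lemma rinner_linear [simp]:
  "rinner m v (p + p') q = rinner m v p q + rinner m v p' q"
  "rinner m v (p - p') q = rinner m v p q - rinner m v p' q"
  "rinner m v (smult c p) q = c * rinner m v p q"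
  "rinner m v 0 q = 0"
  "rinner m v p (q + q') = rinner m v p q + rinner m v p q'"
  "rinner m v p (q - q') = rinner m v p q - rinner m v p q'"
  "rinner m v p (smult c q) = c * rinner m v p q"
  "rinner m v p 0 = 0"
  by (simp_all add: rinner_def algebra_simps)

lemma rinner_sum [simp]: "rinner m v (sum f A) q = (\<Sum>x\<in>A. rinner m v (f x) q)"
  by (induction A rule: infinite_finite_induct) auto

lemma rinner_commute: "rinner m v p q = rinner m v q p"
  by (simp add: rinner_def mult_ac)

text \<open>Gram-Schmidt applied to the monomials for the form \<open>rinner m v\<close>, normalised
  to be monic. A vanishing norm turns its quotient into 0, so the polynomial is monic of degree
  \<open>e\<close> for every \<open>m\<close>; only orthogonality needs nonzero norms.\<close>

fun orth :: "(nat \<Rightarrow> real) \<Rightarrow> real poly \<Rightarrow> nat \<Rightarrow> real poly" where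
  "orth m v e = monom 1 e -
     (\<Sum>i<e. smult (rinner m v (monom 1 e) (orth m v i) / rinner m v (orth m v i) (orth m v i))
               (orth m v i))"

declare orth.simps [simp del]

definition orth_norm :: "(nat \<Rightarrow> real) \<Rightarrow> real poly \<Rightarrow> nat \<Rightarrow> real" where
  "orth_norm m v e = rinner m v (orth m v e) (orth m v e)"

lemma orth_0 [simp]: "orth m v 0 = 1"
  by (simp add: orth.simps[of m v 0])

lemma coeff_orth_ge: "i \<ge> e \<Longrightarrow> coeff (orth m v e) i = (if i = e then 1 else 0)"
proof (induction e arbitrary: i rule: less_induct)
  case (less e)
  have *: "(\<Sum>j<e. coeff (smult (c j) (orth m v j)) i) = 0" for c :: "nat \<Rightarrow> real"
    by (rule sum.neutral) (use less in auto)
  show ?case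
    unfolding orth.simps[of m v e] coeff_diff coeff_sum * by (auto simp: coeff_monom)
qed

lemma degree_orth [simp]: "degree (orth m v e) = e"
  by (rule antisym[OF degree_le le_degree]) (auto simp: coeff_orth_ge)

lemma coeff_orth_self [simp]: "coeff (orth m v e) e = 1"
  by (simp add: coeff_orth_ge)

lemma orth_nonzero [simp]: "orth m v e \<noteq> 0"
  by (metis coeff_orth_self coeff_0 zero_neq_one)

text \<open>Gram-Schmidt pairs \<open>monom 1 e\<close> only with polynomials of degree below
  \<open>e\<close>, so the largest moment entering has index \<open>2 * e + degree v - 1\<close>.
  The strict bound keeps \<open>orth m v e\<close> independent of \<open>m k\<close> when
  \<open>2 * e + degree v = k\<close>.\<close>

lemma orth_cong:
  assumes "\<And>i. 1 \<le> i \<Longrightarrow> i < 2 * e + degree v \<Longrightarrow> m i = m' i"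
  shows "orth m v e = orth m' v e"
  using assms
proof (induction e rule: less_induct)
  case (less e)
  have IH: "orth m v i = orth m' v i" if "i < e" for i
    by (rule less.IH[OF that]) (use that less.prems in auto)
  have 1: "rinner m v (monom 1 e) (orth m' v i) = rinner m' v (monom 1 e) (orth m' v i)"
    if "i < e" for i
    unfolding rinner_def
  proof (rule riesz_cong)
    fix j assume j: "1 \<le> j" "j \<le> degree (v * monom 1 e * orth m' v i)"
    have "degree (v * monom 1 e * orth m' v i) \<le> degree v + e + i"
      by (intro order.trans[OF degree_mult_le] add_mono) (auto simp: degree_monom_eq)
    then show "m j = m' j"
      using j that less.prems[of j] by linarith
  qed
  have 2: "rinner m v (orth m' v i) (orth m' v i) = rinner m' v (orth m' v i) (orth m' v i)"
    if "i < e" for i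
    unfolding rinner_def
  proof (rule riesz_cong)
    fix j assume j: "1 \<le> j" "j \<le> degree (v * orth m' v i * orth m' v i)"
    have "degree (v * orth m' v i * orth m' v i) \<le> degree v + i + i"
      by (intro order.trans[OF degree_mult_le] add_mono) auto
    then show "m j = m' j"
      using j that less.prems[of j] by linarith
  qed
  show ?case
    by (subst (1 2) orth.simps) (auto intro!: sum.cong simp: IH 1 2)
qed

lemma orth_perp_orth:
  assumes "\<And>i. i < e \<Longrightarrow> orth_norm m v i \<noteq> 0" "j < e"
  shows "rinner m v (orth m v e) (orth m v j) = 0"
  using assms
proof (induction e arbitrary: j rule: less_induct)
  case (less e)
  let ?c = "\<lambda>i. rinner m v (monom 1 e) (orth m v i) / rinner m v (orth m v i) (orth m v i)"
  have *: "rinner m v (orth m v i) (orth m v j) = 0" if "i < e" "i \<noteq> j" for i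
  proof (cases "i < j")
    case True
    then show ?thesis
      using less.IH[of j i] less.prems by (simp add: rinner_commute)
  next
    case False
    then show ?thesis
      using less.IH[of i j] less.prems that by simp
  qed
  have "(\<Sum>i<e. ?c i * rinner m v (orth m v i) (orth m v j))
      = (\<Sum>i\<in>{j}. ?c i * rinner m v (orth m v i) (orth m v j))"
    by (rule sum.mono_neutral_right) (use * less.prems in auto)
  also have "\<dots> = rinner m v (monom 1 e) (orth m v j)"
    using less.prems by (simp add: orth_norm_def)
  finally show ?case
    by (subst orth.simps) simp
qed

text \<open>The \<open>orth m v i\<close> form a triangular basis: subtracting
  \<open>coeff q e\<close> times the last one lowers the degree of \<open>q\<close>. Degree bounds
  are stated through vanishing coefficients so that \<open>q = 0\<close> and \<open>e = 0\<close>
  fit in uniformly.\<close>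

lemma rinner_zero_if_perp_orth:
  assumes "\<And>i. i < e \<Longrightarrow> rinner m v p (orth m v i) = 0" "\<And>i. i \<ge> e \<Longrightarrow> coeff q i = 0"
  shows "rinner m v p q = 0"
  using assms
proof (induction e arbitrary: q)
  case 0
  then have "q = 0" by (intro poly_eqI) auto
  then show ?case by simp
next
  case (Suc e)
  let ?r = "q - smult (coeff q e) (orth m v e)"
  have "rinner m v p ?r = 0"
    by (rule Suc.IH) (use Suc.prems in \<open>auto simp: coeff_orth_ge\<close>)
  then show ?case
    using Suc.prems(1)[of e] by simp
qed

lemma orth_perp:
  assumes "\<And>i. i < e \<Longrightarrow> orth_norm m v i \<noteq> 0" "\<And>i. i \<ge> e \<Longrightarrow> coeff q i = 0"
  shows "rinner m v (orth m v e) q = 0"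
  by (rule rinner_zero_if_perp_orth[of e]) (use assms orth_perp_orth in auto)

text \<open>Modulo lower degree, \<open>q\<close> is \<open>coeff q e\<close> times
  \<open>orth m v e\<close>, so the pairing is read off from one coefficient.\<close>

lemma rinner_orth:
  assumes "\<And>i. i < e \<Longrightarrow> orth_norm m v i \<noteq> 0" "\<And>i. i > e \<Longrightarrow> coeff q i = 0"
  shows "rinner m v (orth m v e) q = coeff q e * orth_norm m v e"
proof -
  have "rinner m v (orth m v e) (q - smult (coeff q e) (orth m v e)) = 0"
    by (rule orth_perp) (use assms in \<open>auto simp: coeff_orth_ge\<close>)
  then show ?thesis by (simp add: orth_norm_def)
qed

text \<open>Pythagoras: splitting off the component along \<open>orth m v e\<close> leaves an
  orthogonal remainder of lower degree, so finitely many positive norms make the form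
  definite.\<close>

lemma rinner_pos:
  assumes "\<And>i. i < e \<Longrightarrow> orth_norm m v i > 0" "\<And>i. i \<ge> e \<Longrightarrow> coeff q i = 0" "q \<noteq> 0"
  shows "rinner m v q q > 0"
  using assms
proof (induction e arbitrary: q)
  case 0
  then have "q = 0" by (intro poly_eqI) auto
  with 0 show ?case by simp
next
  case (Suc e)
  let ?c = "coeff q e" and ?T = "orth m v e"
  define r where "r = q - smult ?c ?T"
  have r: "coeff r i = 0" if "i \<ge> e" for i
    unfolding r_def using Suc.prems(2)[of i] that by (cases "i = e") (auto simp: coeff_orth_ge)
  have q: "q = r + smult ?c ?T" by (simp add: r_def)
  have nz: "orth_norm m v i \<noteq> 0" if "i < e" for i
    using Suc.prems(1)[of i] that by simp
  have "rinner m v ?T r = 0"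
    by (rule orth_perp[OF nz r])
  then have "rinner m v (r + smult ?c ?T) (r + smult ?c ?T) = rinner m v r r + ?c\<^sup>2 * orth_norm m v e"
    by (simp add: rinner_commute[of m v r "orth m v e"] orth_norm_def power2_eq_square)
  then have eq: "rinner m v q q = rinner m v r r + ?c\<^sup>2 * orth_norm m v e"
    by (simp flip: q)
  show ?case
  proof (cases "r = 0")
    case True
    then have "?c \<noteq> 0" using Suc.prems(3) by (auto simp: r_def)
    then show ?thesis using True Suc.prems(1)[of e] eq by simp
  next
    case False
    then have "rinner m v r r > 0"
      by (intro Suc.IH) (simp_all add: r Suc.prems(1))
    moreover have "?c\<^sup>2 * orth_norm m v e \<ge> 0" using Suc.prems(1)[of e] by simp
    ultimately show ?thesis using eq by linarith
  qed
qed

text \<open>The difference of two candidates has degree below \<open>e\<close> and is orthogonal to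
  itself, which definiteness allows only for zero. The lemma serves to verify guessed expressions of
  one orthogonal polynomial through others.\<close>

lemma orth_unique:
  assumes pos: "\<And>i. i < e \<Longrightarrow> orth_norm m v i > 0"
    and p: "coeff p e = 1" "\<And>i. i > e \<Longrightarrow> coeff p i = 0"
    and perp: "\<And>q. (\<And>i. i \<ge> e \<Longrightarrow> coeff q i = 0) \<Longrightarrow> rinner m v p q = 0"
  shows "p = orth m v e"
proof (rule ccontr)
  let ?d = "p - orth m v e"
  assume "p \<noteq> orth m v e"
  have d: "coeff ?d i = 0" if "i \<ge> e" for i
    using p that by (cases "i = e") (auto simp: coeff_orth_ge)
  have "rinner m v ?d ?d > 0"
    by (rule rinner_pos[of e]) (use pos d \<open>p \<noteq> orth m v e\<close> in auto)
  moreover have "rinner m v (orth m v e) ?d = 0"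
    by (rule orth_perp) (use d pos in \<open>simp_all add: less_imp_neq[symmetric]\<close>)
  ultimately show False using perp[OF d] by simp
qed

section \<open>Quadrature formulas\<close>

text \<open>Evaluation at \<open>z\<close> kills the real quadratic with roots \<open>z\<close> and
  its conjugate, so the remainder \<open>c + d z\<close> of \<open>p\<close> is zero; as
  \<open>z\<close> is not real, both real coefficients vanish.\<close>

lemma quadratic_dvd_if_complex_root:
  fixes p :: "real poly"
  assumes z: "poly (map_poly of_real p) (z :: complex) = 0" "Im z \<noteq> 0"
  shows "[:(Re z)\<^sup>2 + (Im z)\<^sup>2, - 2 * Re z, 1:] dvd p"
proof -
  define E where "E p = poly (map_poly complex_of_real p) z" for p
  have E_pCons: "E (pCons a p) = of_real a + z * E p" for a p
    by (cases "pCons a p = 0") (auto simp: E_def map_poly_pCons)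
  have E0: "E 0 = 0" by (simp add: E_def)
  have E_add: "E (p + q) = E p + E q" for p q
    by (intro arg_cong[of _ _ "\<lambda>p. poly p z"] poly_eqI | simp add: E_def coeff_map_poly flip: poly_add)+
  have E_smult: "E (smult c q) = of_real c * E q" for c q
    by (simp add: E_def map_poly_smult)
  have E_mult: "E (p * q) = E p * E q" for p q
    by (induction p) (auto simp: E0 E_pCons E_add E_smult algebra_simps)
  define Q where "Q = [:(Re z)\<^sup>2 + (Im z)\<^sup>2, - 2 * Re z, 1:]"
  have EQ: "E Q = 0"
    by (simp add: Q_def E_pCons E0 complex_eq_iff power2_eq_square algebra_simps)
  have degQ: "degree Q = 2" by (simp add: Q_def)
  have "degree (p mod Q) < 2"
    using degree_mod_less[of Q p] degQ by (cases "p mod Q = 0") fastforce+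
  then obtain c d where cd: "p mod Q = [:c, d:]"
    by (metis One_nat_def Suc_1 degree1_coeffs degree_eq_zeroE less_2_cases pCons_0_0)
  have "0 = E (Q * (p div Q) + p mod Q)"
    using z by (simp add: E_def)
  also have "\<dots> = of_real c + z * of_real d"
    by (simp only: E_add E_mult EQ cd) (simp add: E_pCons E0)
  finally have "d = 0" "c = 0"
    using z(2) by (auto simp: complex_eq_iff)
  then show ?thesis
    using cd Q_def by (simp add: dvd_eq_mod_eq_0)
qed

text \<open>The excluded divisor \<open>(x - u)^2 + w^2\<close> covers two cases:
  \<open>w \<noteq> 0\<close> rules out conjugate pairs, so all roots are real, and
  \<open>w = 0\<close> rules out double roots, so they are simple.\<close>

lemma card_roots_eq_degree:
  fixes p :: "real poly"
  assumes "p \<noteq> 0" "\<And>u w. \<not> [:u\<^sup>2 + w\<^sup>2, - 2 * u, 1:] dvd p"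
  shows "card {x. poly p x = 0} = degree p"
  using assms
proof (induction "degree p" arbitrary: p)
  case 0
  then obtain c where "p = [:c:]" "c \<noteq> 0" by (metis degree_eq_zeroE pCons_0_0)
  then show ?case by simp
next
  case (Suc d)
  let ?P = "map_poly complex_of_real p"
  have "\<not> constant (poly ?P)"
    using Suc.hyps(2) by (simp add: constant_degree degree_map_poly)
  then obtain z where z: "poly ?P z = 0"
    using fundamental_theorem_of_algebra by blast
  have "Im z = 0"
    using quadratic_dvd_if_complex_root[OF z] Suc.prems(2) by blast
  then obtain r where "z = of_real r" by (metis complex_is_Real_iff Reals_cases)
  then have "complex_of_real (poly p r) = 0"
    using z by (simp add: poly_altdef degree_map_poly coeff_map_poly)
  then have "poly p r = 0" by (simp only: of_real_eq_0_iff)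
  then obtain g where g: "p = [:- r, 1:] * g"
    by (auto simp: poly_eq_0_iff_dvd dvd_def)
  have "g \<noteq> 0" using g Suc.prems by auto
  then have deg: "degree p = Suc (degree g)"
    unfolding g by (subst degree_mult_eq) auto
  have "poly g r \<noteq> 0"
  proof
    assume "poly g r = 0"
    then obtain h where h: "g = [:- r, 1:] * h" unfolding poly_eq_0_iff_dvd dvd_def by blast
    have "p = [:r\<^sup>2 + 0\<^sup>2, - 2 * r, 1:] * h"
      unfolding g h by (intro poly_ext) (simp add: power2_eq_square algebra_simps)
    then show False using Suc.prems(2)[of r 0] by (metis dvd_triv_left)
  qed
  have "card {x. poly g x = 0} = degree g"
  proof (rule Suc.hyps(1)[OF _ \<open>g \<noteq> 0\<close>])
    show "d = degree g" using deg Suc.hyps(2) by simp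
    have "g dvd p" unfolding g by (rule dvd_triv_right)
    then show "\<not> [:u\<^sup>2 + w\<^sup>2, - 2 * u, 1:] dvd g" for u w
      using Suc.prems(2)[of u w] dvd_trans by blast
  qed
  moreover have "{x. poly p x = 0} = insert r {x. poly g x = 0}"
    unfolding g by auto
  ultimately show ?case
    using poly_roots_finite[OF \<open>g \<noteq> 0\<close>] \<open>poly g r \<noteq> 0\<close> deg by simp
qed

text \<open>If \<open>(x - u)\<^sup>2 + w\<^sup>2\<close> divided \<open>P = orth m v e\<close> with cofactor \<open>g\<close>, then \<open>P g\<close> would be a sum of
  two squares, while orthogonality makes its integral vanish.\<close>

lemma card_roots_orth:
  assumes pos: "\<And>i. i < e \<Longrightarrow> orth_norm m v i > 0"
  shows "card {x. poly (orth m v e) x = 0} = e"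
proof -
  let ?P = "orth m v e"
  have "\<not> [:u\<^sup>2 + w\<^sup>2, - 2 * u, 1:] dvd ?P" for u w
  proof
    assume "[:u\<^sup>2 + w\<^sup>2, - 2 * u, 1:] dvd ?P"
    then obtain g where g: "?P = [:u\<^sup>2 + w\<^sup>2, - 2 * u, 1:] * g" by (elim dvdE)
    have "g \<noteq> 0" using g by (metis mult_zero_right orth_nonzero)
    then have deg: "e = degree g + 2"
      using arg_cong[OF g, of degree] by (subst (asm) degree_mult_eq) auto
    have nz: "orth_norm m v i \<noteq> 0" if "i < e" for i using pos[OF that] by simp
    have "rinner m v ?P g = 0"
      by (rule orth_perp[OF nz]) (use deg in \<open>auto intro: coeff_eq_0\<close>)
    moreover have "rinner m v ?P g =
        rinner m v ([:- u, 1:] * g) ([:- u, 1:] * g) + w\<^sup>2 * rinner m v g g"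
    proof -
      have "v * ?P * g = v * ([:- u, 1:] * g) * ([:- u, 1:] * g) + smult (w\<^sup>2) (v * g * g)"
        unfolding g by (intro poly_ext) (simp add: power2_eq_square algebra_simps)
      then show ?thesis by (simp add: rinner_def)
    qed
    moreover have "rinner m v ([:- u, 1:] * g) ([:- u, 1:] * g) > 0"
    proof (rule rinner_pos[OF pos])
      have "degree ([:- u, 1:] * g) = degree g + 1"
        using \<open>g \<noteq> 0\<close> by (subst degree_mult_eq) auto
      then show "coeff ([:- u, 1:] * g) i = 0" if "i \<ge> e" for i
        using that deg by (intro coeff_eq_0) linarith
      show "[:- u, 1:] * g \<noteq> 0" using \<open>g \<noteq> 0\<close> by (metis mult_eq_0_iff pCons_eq_0_iff one_neq_zero)
    qed auto
    moreover have "rinner m v g g > 0"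
      by (rule rinner_pos[OF pos, of e]) (use deg \<open>g \<noteq> 0\<close> in \<open>auto simp: coeff_eq_0\<close>)
    ultimately show False
      by (smt (verit) mult_nonneg_nonneg zero_le_power2)
  qed
  then show ?thesis using card_roots_eq_degree[of ?P] by simp
qed

text \<open>Division by \<open>W\<close> and Lagrange interpolation of the remainder: the functional
  kills multiples of \<open>W\<close> up to degree \<open>K\<close>, which leaves a sum over the
  zeros. A weight is positive because a test polynomial vanishing at all other nodes sees this node
  alone.\<close>

lemma quadrature:
  fixes W :: "real poly"
  defines "X \<equiv> {x. poly W x = 0}"
  assumes card: "card X = degree W" and deg: "0 < degree W" "degree W \<le> K + 1"
    and perp: "\<And>g. g \<noteq> 0 \<Longrightarrow> degree g + degree W \<le> K \<Longrightarrow> riesz m (W * g) = 0"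
    and pos: "\<And>x. x \<in> X \<Longrightarrow>
      \<exists>f. degree f \<le> K \<and> poly f x > 0 \<and> (\<forall>y\<in>X - {x}. poly f y = 0) \<and> riesz m f > 0"
  obtains lam where "\<And>x. x \<in> X \<Longrightarrow> lam x > 0"
    "\<And>p. degree p \<le> K \<Longrightarrow> riesz m p = (\<Sum>x\<in>X. lam x * poly p x)"
proof -
  have "W \<noteq> 0" using deg by auto
  then have fin: "finite X" unfolding X_def by (rule poly_roots_finite)
  define V where "V x = W div [:- x, 1:]" for x
  have W: "W = [:- x, 1:] * V x" if "x \<in> X" for x
    using that unfolding V_def X_def mem_Collect_eq poly_eq_0_iff_dvd
    by (rule dvd_mult_div_cancel[symmetric])
  have Vnz: "V x \<noteq> 0" if "x \<in> X" for x
    using W[OF that] \<open>W \<noteq> 0\<close> by auto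
  have degV: "degree W = Suc (degree (V x))" if "x \<in> X" for x
    by (subst W[OF that], subst degree_mult_eq) (use Vnz[OF that] in auto)
  have Vy: "poly (V x) y = 0" if "x \<in> X" "y \<in> X" "y \<noteq> x" for x y
  proof -
    have "poly ([:- x, 1:] * V x) y = 0"
      using W[OF that(1)] that(2) by (metis X_def mem_Collect_eq)
    then show ?thesis using that(3) by simp
  qed
  have Vx: "poly (V x) x \<noteq> 0" if "x \<in> X" for x
  proof
    assume "poly (V x) x = 0"
    then have "X \<subseteq> {y. poly (V x) y = 0}" using Vy[OF that] by auto
    then have "card X \<le> card {y. poly (V x) y = 0}"
      by (intro card_mono poly_roots_finite Vnz that)
    also have "\<dots> \<le> degree (V x)" by (intro card_poly_roots_bound Vnz that)
    finally show False using card degV[OF that] by simp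
  qed
  define lam where "lam x = riesz m (V x) / poly (V x) x" for x
  have eq: "riesz m p = (\<Sum>x\<in>X. lam x * poly p x)" if "degree p \<le> K" for p
  proof -
    define r where "r = p mod W"
    have p: "p = W * (p div W) + r" by (simp add: r_def)
    have pr: "poly p x = poly r x" if "x \<in> X" for x
      by (subst p) (use that X_def in simp)
    have "riesz m (W * (p div W)) = 0"
    proof (cases "p div W = 0")
      case False
      have "degree (p div W) + degree W = degree (W * (p div W))"
        using False \<open>W \<noteq> 0\<close> by (simp add: degree_mult_eq)
      also have "W * (p div W) = p - r" by (simp add: r_def minus_mod_eq_mult_div)
      also have "degree (p - r) \<le> K"
        using that deg degree_mod_less[OF \<open>W \<noteq> 0\<close>, of p]
        by (intro degree_diff_le) (auto simp: r_def)
      finally have "degree (p div W) + degree W \<le> K" .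
      with False show ?thesis by (rule perp)
    qed auto
    \<comment> \<open>Lagrange interpolation: both sides have degree below \<open>card X\<close> and
      agree on \<open>X\<close>, as \<open>V x\<close> vanishes at every node except
      \<open>x\<close>.\<close>
    moreover have "r = (\<Sum>x\<in>X. smult (poly r x / poly (V x) x) (V x))"
    proof (rule poly_eqI_degree[of X])
      fix y assume y: "y \<in> X"
      have "(\<Sum>x\<in>X. poly r x / poly (V x) x * poly (V x) y)
          = (\<Sum>x\<in>{y}. poly r x / poly (V x) x * poly (V x) y)"
        by (rule sum.mono_neutral_right) (use y Vy fin in auto)
      then show "poly r y = poly (\<Sum>x\<in>X. smult (poly r x / poly (V x) x) (V x)) y"
        using Vx[OF y] by (simp add: poly_sum)
    next
      show "card X > degree r"
        unfolding card r_def using deg degree_mod_less[OF \<open>W \<noteq> 0\<close>, of p] by auto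
      have "degree (\<Sum>x\<in>X. smult (poly r x / poly (V x) x) (V x)) \<le> degree W - 1"
      proof (rule degree_sum_le[OF fin])
        fix x assume "x \<in> X"
        then show "degree (smult (poly r x / poly (V x) x) (V x)) \<le> degree W - 1"
          using degV[of x] by (simp add: degree_smult_le)
      qed
      then show "card X > degree (\<Sum>x\<in>X. smult (poly r x / poly (V x) x) (V x))"
        using deg card by linarith
    qed
    then have "riesz m r = riesz m (\<Sum>x\<in>X. smult (poly r x / poly (V x) x) (V x))" by simp
    then have "riesz m r = (\<Sum>x\<in>X. lam x * poly r x)" by (simp add: lam_def mult_ac)
    ultimately have "riesz m p = (\<Sum>x\<in>X. lam x * poly r x)"
      by (subst p) simp
    then show ?thesis using pr by simp
  qed
  moreover have "lam x > 0" if x: "x \<in> X" for x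
  proof -
    obtain f where f: "degree f \<le> K" "poly f x > 0" "\<forall>y\<in>X - {x}. poly f y = 0" "riesz m f > 0"
      using pos[OF x] by blast
    have "riesz m f = (\<Sum>y\<in>X. lam y * poly f y)" by (rule eq[OF f(1)])
    also have "\<dots> = (\<Sum>y\<in>{x}. lam y * poly f y)"
      by (rule sum.mono_neutral_right) (use x fin f in auto)
    finally show ?thesis using f by (simp add: zero_less_mult_iff)
  qed
  ultimately show ?thesis using that by blast
qed

section \<open>Discrete measures with prescribed atoms, and integrals of polynomials\<close>

lemma discrete_moment_measure:
  assumes X: "finite X" "X \<subseteq> T" and lam: "\<And>x. x \<in> X \<Longrightarrow> lam x > 0" "(\<Sum>x\<in>X. lam x) = (1 :: real)"
  obtains \<mu> where "\<mu> \<in> moment_measures T"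
    "\<And>p. (\<integral>x. poly p x \<partial>\<mu>) = (\<Sum>x\<in>X. lam x * poly p x)"
proof -
  define f where "f x = (if x \<in> X then lam x else 0)" for x
  have f0: "0 \<le> f x" for x using lam(1)[of x] by (auto simp: f_def)
  have "(\<integral>\<^sup>+x. ennreal (f x) \<partial>count_space UNIV) = (\<Sum>x\<in>X. ennreal (f x))"
    by (rule nn_integral_count_space') (use X in \<open>auto simp: f_def\<close>)
  also have "\<dots> = ennreal (\<Sum>x\<in>X. f x)"
    by (rule sum_ennreal) (use f0 in auto)
  also have "(\<Sum>x\<in>X. f x) = 1" using lam(2) by (simp add: f_def)
  finally have f1: "(\<integral>\<^sup>+x. ennreal (f x) \<partial>count_space UNIV) = 1" by simp
  define P where "P = embed_pmf f"
  have pmf: "pmf P x = f x" for x unfolding P_def by (rule pmf_embed_pmf[OF f0 f1])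
  have setP: "set_pmf P \<subseteq> X" by (auto simp: set_pmf_eq pmf f_def split: if_splits)
  obtain t where t: "t \<in> X" using lam(2) by fastforce
  \<comment> \<open>The target space carries the Borel sets of \<open>T\<close>, while the mass
    function lives on all reals. Points outside \<open>X\<close>, which have mass 0, are sent to an
    arbitrary atom \<open>t\<close> so that the push-forward map takes values in \<open>T\<close>
    everywhere.\<close>
  define g where "g x = (if x \<in> X then x else t)" for x
  have g: "g \<in> measurable (measure_pmf P) (restrict_space borel T)"
    by (rule measurable_restrict_space2) (use X t in \<open>auto simp: g_def\<close>)
  define \<mu> where "\<mu> = distr (measure_pmf P) (restrict_space borel T) g"
  have meas: "h \<in> borel_measurable (restrict_space borel T)" if "h \<in> borel_measurable borel" for h :: "real \<Rightarrow> real"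
    using that by (rule measurable_restrict_space1)
  have "finite (set_pmf P)" using finite_subset[OF setP X(1)] .
  then have int: "integrable \<mu> h" if "h \<in> borel_measurable borel" for h :: "real \<Rightarrow> real"
    unfolding \<mu>_def using integrable_distr_eq[OF g meas[OF that]]
    by (simp add: integrable_measure_pmf_finite)
  have "prob_space \<mu>"
    unfolding \<mu>_def by (rule prob_space.prob_space_distr[OF measure_pmf.prob_space_axioms g])
  then have "\<mu> \<in> moment_measures T"
    by (auto simp: moment_measures_def int) (auto simp: \<mu>_def)
  moreover have "(\<integral>x. poly p x \<partial>\<mu>) = (\<Sum>x\<in>X. lam x * poly p x)" for p
  proof -
    have "(\<integral>x. poly p x \<partial>\<mu>) = (\<integral>x. poly p (g x) \<partial>measure_pmf P)"
      unfolding \<mu>_def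
      by (rule integral_distr[OF g meas]) (intro borel_measurable_continuous_onI continuous_intros)
    also have "\<dots> = (\<Sum>x\<in>X. poly p (g x) * pmf P x)"
      by (rule integral_measure_pmf_real) (use X setP in auto)
    also have "\<dots> = (\<Sum>x\<in>X. lam x * poly p x)"
      by (rule sum.cong) (auto simp: pmf f_def g_def)
    finally show ?thesis .
  qed
  ultimately show ?thesis using that by blast
qed

lemma integral_poly_moment_measure:
  assumes "\<mu> \<in> moment_measures T"
  shows "(\<integral>x. poly p x \<partial>\<mu>) = riesz (\<lambda>i. mom i \<mu>) p"
proof -
  interpret prob_space \<mu> using assms by (simp add: moment_measures_def)
  have int: "integrable \<mu> (\<lambda>x. x ^ k)" for k using assms by (simp add: moment_measures_def)
  have "(\<integral>x. poly p x \<partial>\<mu>) = (\<Sum>i\<le>degree p. \<integral>x. coeff p i * x ^ i \<partial>\<mu>)"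
    unfolding poly_altdef by (rule Bochner_Integration.integral_sum) (use int in simp)
  also have "\<dots> = riesz (\<lambda>i. mom i \<mu>) p"
    unfolding riesz_def by (rule sum.cong) (auto simp: mom_def prob_space)
  finally show ?thesis .
qed

lemma space_moment_measure: "\<mu> \<in> moment_measures T \<Longrightarrow> space \<mu> = T"
  using sets_eq_imp_space_eq[of \<mu> "restrict_space borel T"]
  by (auto simp: moment_measures_def space_restrict_space)

lemma mom_eq_riesz: "\<mu> \<in> moment_measures T \<Longrightarrow> mom k \<mu> = (\<integral>x. poly (monom 1 k) x \<partial>\<mu>)"
  by (simp add: mom_def poly_monom)

section \<open>Bounds of the moment range\<close>

text \<open>The weights in Lukacs' representation of the polynomials that are nonnegative on
  \<open>[-s,s]\<close> by weighted squares.\<close>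

definition weights :: "real \<Rightarrow> real poly set" where
  "weights s = {1, [:s, 1:], [:s, -1:], [:s\<^sup>2, 0, -1:]}"

text \<open>Algebraic form of the statement that \<open>(m 1, ..., m K)\<close> lies in the interior
  of the moment space of \<open>[-s,s]\<close>: strict positivity on weighted squares of degree up
  to \<open>K\<close>.\<close>

definition wpos :: "(nat \<Rightarrow> real) \<Rightarrow> real \<Rightarrow> nat \<Rightarrow> bool" where
  "wpos m s K \<longleftrightarrow> (\<forall>v\<in>weights s. \<forall>q. q \<noteq> 0 \<longrightarrow> 2 * degree q + degree v \<le> K \<longrightarrow> rinner m v q q > 0)"

lemma wposD:
  "wpos m s K \<Longrightarrow> v \<in> weights s \<Longrightarrow> q \<noteq> 0 \<Longrightarrow> 2 * degree q + degree v \<le> K \<Longrightarrow> rinner m v q q > 0"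
  by (auto simp: wpos_def)

lemma wpos_orth_norm:
  "wpos m s K \<Longrightarrow> v \<in> weights s \<Longrightarrow> 2 * i + degree v \<le> K \<Longrightarrow> orth_norm m v i > 0"
  unfolding orth_norm_def by (rule wposD) auto

lemma wpos_iff_orth_norm:
  "wpos m s K \<longleftrightarrow> (\<forall>v\<in>weights s. \<forall>i. 2 * i + degree v \<le> K \<longrightarrow> orth_norm m v i > 0)"
proof
  assume *: "\<forall>v\<in>weights s. \<forall>i. 2 * i + degree v \<le> K \<longrightarrow> orth_norm m v i > 0"
  show "wpos m s K"
    unfolding wpos_def
  proof (intro ballI allI impI)
    fix v q :: "real poly" assume v: "v \<in> weights s" and q: "q \<noteq> 0" "2 * degree q + degree v \<le> K"
    show "rinner m v q q > 0"
      by (rule rinner_pos[of "Suc (degree q)"]) (use * v q in \<open>auto intro!: coeff_eq_0\<close>)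
  qed
qed (auto intro: wpos_orth_norm)

lemma wpos_mono: "wpos m s K \<Longrightarrow> K' \<le> K \<Longrightarrow> wpos m s K'"
  unfolding wpos_def by (meson le_trans)

text \<open>Multiplying a weight by \<open>s \<plusminus> x\<close> gives a weight again, up to a square.\<close>

lemma wpos_mult:
  assumes K: "wpos m s K" and v: "v \<in> weights s" and f: "f \<in> {[:s, 1:], [:s, -1:]}"
    and q: "q \<noteq> 0" "2 * degree q + degree v + 1 \<le> K"
  shows "riesz m (v * f * q * q) > 0"
proof -
  have "\<exists>w\<in>weights s. \<exists>c. c \<noteq> 0 \<and> v * f = w * c * c \<and> degree w + 2 * degree c = degree v + 1"
    (is "\<exists>w\<in>_. \<exists>c. ?P w c")
  proof -
    have s2: "[:s, 1:] * [:s, -1:] = [:s\<^sup>2, 0, -1:]"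
      by (rule poly_ext) (simp add: power2_eq_square algebra_simps)
    have in_w: "1 \<in> weights s" "[:s, 1:] \<in> weights s" "[:s, -1:] \<in> weights s" "[:s\<^sup>2, 0, -1:] \<in> weights s"
      by (auto simp: weights_def)
    consider "v = 1" | "v = f" "degree f = 1" | "v * f = [:s\<^sup>2, 0, -1:]" "degree v = 1"
      | "v = [:s\<^sup>2, 0, -1:]"
      using v f s2 by (auto simp: weights_def mult_ac)
    then show ?thesis
    proof cases
      case 1
      then have "f \<in> weights s \<and> ?P f 1" using f in_w by auto
      then show ?thesis by blast
    next
      case 2
      then have "?P 1 f" using f by auto
      then show ?thesis using in_w by blast
    next
      case 3
      then have "?P [:s\<^sup>2, 0, -1:] 1" by simp
      then show ?thesis using in_w by blast
    next
      case 4
      obtain f' where "f' \<in> weights s" "f' * f = [:s\<^sup>2, 0, -1:]" "degree f' = 1"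
        using f s2 in_w by (auto simp: mult_ac)
      then have "?P f' f" using 4 f by auto
      then show ?thesis using \<open>f' \<in> weights s\<close> by blast
    qed
  qed
  then obtain w c where wc: "w \<in> weights s" "c \<noteq> 0" "v * f = w * c * c"
      "degree w + 2 * degree c = degree v + 1" by blast
  have "rinner m w (c * q) (c * q) > 0"
    by (rule wposD[OF K wc(1)]) (use wc q in \<open>auto simp: degree_mult_eq\<close>)
  also have "rinner m w (c * q) (c * q) = riesz m (w * c * c * q * q)"
    unfolding rinner_def by (rule arg_cong[of _ _ "riesz m"]) (simp only: mult_ac)
  finally show ?thesis unfolding wc(3) .
qed

lemma weights_nonneg: "v \<in> weights s \<Longrightarrow> \<bar>x\<bar> \<le> s \<Longrightarrow> poly v x \<ge> 0"
proof -
  assume v: "v \<in> weights s" and x: "\<bar>x\<bar> \<le> s"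
  then have "x * x \<le> s * s"
    using abs_le_square_iff[of x s] by (simp add: power2_eq_square)
  then show ?thesis
    using v x by (auto simp: weights_def power2_eq_square)
qed

lemma weights_pos: "v \<in> weights s \<Longrightarrow> \<bar>x\<bar> < s \<Longrightarrow> poly v x > 0"
proof -
  assume v: "v \<in> weights s" and x: "\<bar>x\<bar> < s"
  then have "x * x < s * s"
    using abs_le_square_iff[of s x] by (simp add: power2_eq_square not_le[symmetric])
  then show ?thesis
    using v x by (auto simp: weights_def power2_eq_square)
qed

lemma weights_nonzero: "v \<in> weights s \<Longrightarrow> v \<noteq> 0"
  by (auto simp: weights_def)

lemma card_roots_weight: "v \<in> weights s \<Longrightarrow> s > 0 \<Longrightarrow> card {x. poly v x = 0} = degree v"
proof -
  assume v: "v \<in> weights s" "s > 0"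
  have "{x. poly [:s, 1:] x = 0} = {- s}" "{x. poly [:s, -1:] x = 0} = {s}" by auto
  moreover have "{x. poly [:s\<^sup>2, 0, -1:] x = 0} = {- s, s}"
    by (auto simp: power2_eq_square square_eq_iff)
  ultimately show ?thesis using v unfolding weights_def
    by (elim insertE) (simp_all add: card_insert_if)
qed

lemma roots_weight: "v \<in> weights s \<Longrightarrow> poly v x = 0 \<Longrightarrow> \<bar>x\<bar> = \<bar>s\<bar>"
  by (auto simp: weights_def power2_eq_square square_eq_iff)

text \<open>Dropping the linear factor of \<open>v\<close> that vanishes at \<open>r\<close> leaves
  a weight again: 1 if \<open>v\<close> is linear, and for \<open>s^2 - x^2\<close> the factor
  vanishing at the opposite endpoint, which is positive at \<open>r\<close>.\<close>

lemma weight_cofactor: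
  assumes "v \<in> weights s" "s > 0" "poly v r = 0"
  shows "\<exists>w\<in>weights s. degree w + 1 = degree v \<and> poly w r > 0 \<and> (\<forall>y. poly v y = 0 \<longrightarrow> y \<noteq> r \<longrightarrow> poly w y = 0)"
  using assms by (auto simp: weights_def power2_eq_square square_eq_iff)

text \<open>There are \<open>e\<close> distinct zeros, so each is simple and the cofactor
  \<open>g\<close> vanishes at the others but not at \<open>r\<close>. Having degree
  \<open>e - 1\<close>, it is orthogonal to \<open>orth m v e\<close>.\<close>

lemma orth_root_cofactor:
  assumes pos: "\<And>i. i < e \<Longrightarrow> orth_norm m v i > 0" and r: "poly (orth m v e) r = 0"
  obtains g where "orth m v e = [:- r, 1:] * g" "g \<noteq> 0" "e = degree g + 1" "poly g r \<noteq> 0"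
    "\<And>y. poly (orth m v e) y = 0 \<Longrightarrow> y \<noteq> r \<Longrightarrow> poly g y = 0"
    "rinner m v (orth m v e) g = 0"
proof -
  obtain g where g: "orth m v e = [:- r, 1:] * g"
    using r unfolding poly_eq_0_iff_dvd dvd_def by blast
  have "g \<noteq> 0" using g by (metis mult_zero_right orth_nonzero)
  then have deg: "e = degree g + 1"
    using arg_cong[OF g, of degree] by (subst (asm) degree_mult_eq) auto
  have "poly g r \<noteq> 0"
  proof
    assume "poly g r = 0"
    then have "{x. poly (orth m v e) x = 0} \<subseteq> {x. poly g x = 0}" unfolding g by auto
    then have "e \<le> card {x. poly g x = 0}"
      using card_roots_orth[OF pos] by (metis card_mono poly_roots_finite[OF \<open>g \<noteq> 0\<close>])
    then show False using card_poly_roots_bound[OF \<open>g \<noteq> 0\<close>] deg by simp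
  qed
  have nz: "orth_norm m v i \<noteq> 0" if "i < e" for i using pos[OF that] by simp
  have "rinner m v (orth m v e) g = 0"
    by (rule orth_perp[OF nz]) (use deg in \<open>auto intro: coeff_eq_0\<close>)
  moreover have "poly g y = 0" if "poly (orth m v e) y = 0" "y \<noteq> r" for y
    using that unfolding g by simp
  ultimately show ?thesis by (rule that[OF g \<open>g \<noteq> 0\<close> deg \<open>poly g r \<noteq> 0\<close>, rotated])
qed

text \<open>Write \<open>orth m v e = (x - r) g\<close> and
  \<open>s + x = (x - r) + (s + r)\<close>: orthogonality removes the first part, so the integral of
  \<open>(s + x) v g^2\<close> is \<open>s + r\<close> times that of \<open>v g^2\<close>, and both
  integrals are positive. Likewise for \<open>s - x\<close>. The integrand has degree exactly
  \<open>K\<close>.\<close>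

lemma orth_roots_bounded:
  assumes s: "s > 0" and v: "v \<in> weights s" and k: "degree v + 2 * e = Suc K" and wp: "wpos m s K"
    and r: "poly (orth m v e) r = 0"
  shows "\<bar>r\<bar> < s"
proof -
  have pos: "orth_norm m v i > 0" if "i < e" for i
    by (rule wpos_orth_norm[OF wp v]) (use that k in linarith)
  obtain g where g: "orth m v e = [:- r, 1:] * g" "g \<noteq> 0" "e = degree g + 1"
      "rinner m v (orth m v e) g = 0"
    using orth_root_cofactor[OF pos r] by metis
  have 1: "riesz m (v * f * g * g) > 0" if "f \<in> {[:s, 1:], [:s, -1:]}" for f
    by (rule wpos_mult[OF wp v that]) (use g k in auto)
  have 2: "rinner m v g g > 0"
    by (rule rinner_pos[OF pos]) (use g in \<open>auto intro: coeff_eq_0\<close>)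
  have "v * [:s, 1:] * g * g = v * orth m v e * g + smult (s + r) (v * g * g)"
    "v * [:s, -1:] * g * g = - (v * orth m v e * g) + smult (s - r) (v * g * g)"
    unfolding g(1) by (rule poly_ext, simp add: algebra_simps)+
  then have "riesz m (v * [:s, 1:] * g * g) = (s + r) * rinner m v g g"
    "riesz m (v * [:s, -1:] * g * g) = (s - r) * rinner m v g g"
    using g(4) by (simp_all add: rinner_def)
  then have "(s + r) * rinner m v g g > 0" "(s - r) * rinner m v g g > 0"
    using 1[of "[:s, 1:]"] 1[of "[:s, -1:]"] by simp_all
  then have "s + r > 0" "s - r > 0" using 2 zero_less_mult_pos2 by blast+
  then show ?thesis by linarith
qed

text \<open>The principal representations: the nodes are the zeros of \<open>v T\<close>, and the test polynomials
  \<open>v (T / (x - r))\<^sup>2\<close> and \<open>w T\<^sup>2\<close>, with \<open>w\<close> a cofactor of a zero of \<open>v\<close>, isolate a single node.\<close>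

lemma principal_representation:
  assumes s: "s > 0" and v: "v \<in> weights s" and k: "degree v + 2 * e = Suc K" and wp: "wpos m s K"
  obtains \<mu> where "\<mu> \<in> moment_measures {-s..s}" "\<And>p. degree p \<le> K \<Longrightarrow> (\<integral>x. poly p x \<partial>\<mu>) = riesz m p"
    "(\<integral>x. poly (v * orth m v e * orth m v e) x \<partial>\<mu>) = 0"
proof -
  let ?T = "orth m v e"
  define W where "W = v * ?T"
  define X where "X = {x. poly W x = 0}"
  have vnz: "v \<noteq> 0" by (rule weights_nonzero[OF v])
  have Wnz: "W \<noteq> 0" using vnz by (simp add: W_def)
  have degW: "degree W = degree v + e" using vnz by (simp add: W_def degree_mult_eq)
  have pos: "orth_norm m v i > 0" if "i < e" for i
    by (rule wpos_orth_norm[OF wp v]) (use that k in linarith)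
  have nz: "orth_norm m v i \<noteq> 0" if "i < e" for i using pos[OF that] by simp
  have bdd: "\<bar>r\<bar> < s" if "poly ?T r = 0" for r
    by (rule orth_roots_bounded[OF s v k wp that])
  have X_eq: "X = {x. poly v x = 0} \<union> {x. poly ?T x = 0}" by (auto simp: X_def W_def)
  have cardX: "card X = degree W"
  proof -
    have "{x. poly v x = 0} \<inter> {x. poly ?T x = 0} = {}"
      using bdd weights_pos[OF v] by fastforce
    then show ?thesis
      unfolding X_eq degW using card_roots_weight[OF v s] card_roots_orth[OF pos, of e]
      by (subst card_Un_disjoint) (simp_all add: poly_roots_finite vnz)
  qed
  have Xs: "X \<subseteq> {-s..s}"
    using bdd roots_weight[OF v] s unfolding X_eq by fastforce
  have test: "\<exists>f. degree f \<le> K \<and> poly f x > 0 \<and> (\<forall>y\<in>X - {x}. poly f y = 0) \<and> riesz m f > 0"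
    if "x \<in> X" for x
  proof (cases "poly ?T x = 0")
    case True
    then obtain g where g: "?T = [:- x, 1:] * g" "g \<noteq> 0" "e = degree g + 1" "poly g x \<noteq> 0"
        "\<And>y. poly ?T y = 0 \<Longrightarrow> y \<noteq> x \<Longrightarrow> poly g y = 0"
      using orth_root_cofactor[OF pos] by metis
    have "rinner m v g g > 0"
      by (rule rinner_pos[OF pos]) (use g(2,3) in \<open>auto intro: coeff_eq_0\<close>)
    moreover have "degree (v * g * g) \<le> K"
      using g(2,3) k vnz by (simp add: degree_mult_eq)
    moreover have "poly (v * g * g) x > 0"
      using weights_pos[OF v bdd[OF True]] g(4) by (simp add: mult.assoc flip: power2_eq_square)
    moreover have "\<forall>y\<in>X - {x}. poly (v * g * g) y = 0"
      using g(5) by (simp add: X_eq) blast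
    ultimately show ?thesis unfolding rinner_def by blast
  next
    case False
    then have "poly v x = 0" using that by (simp add: X_eq)
    then obtain w where w: "w \<in> weights s" "degree w + 1 = degree v" "poly w x > 0"
        "\<And>y. poly v y = 0 \<Longrightarrow> y \<noteq> x \<Longrightarrow> poly w y = 0"
      using weight_cofactor[OF v s] by blast
    have "rinner m w ?T ?T > 0"
      by (rule wposD[OF wp w(1)]) (use w k in auto)
    moreover have "degree (w * ?T * ?T) \<le> K"
      using w k weights_nonzero[OF w(1)] by (simp add: degree_mult_eq)
    moreover have "poly (w * ?T * ?T) x > 0"
      using w(3) False by (simp add: mult.assoc flip: power2_eq_square)
    moreover have "\<forall>y\<in>X - {x}. poly (w * ?T * ?T) y = 0"
      using w(4) by (simp add: X_eq) blast
    ultimately show ?thesis unfolding rinner_def by blast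
  qed
  have perp: "riesz m (W * g) = 0" if "g \<noteq> 0" "degree g + degree W \<le> K" for g
  proof -
    have "rinner m v ?T g = 0"
      by (rule orth_perp[OF nz]) (use that k degW in \<open>auto intro!: coeff_eq_0\<close>)
    then show ?thesis by (simp add: rinner_def W_def)
  qed
  have "0 < degree W" "degree W \<le> K + 1" using degW k by auto
  from quadrature[OF cardX[unfolded X_def] this perp test[unfolded X_def]]
  obtain lam where lam: "\<And>x. x \<in> X \<Longrightarrow> lam x > 0"
    "\<And>p. degree p \<le> K \<Longrightarrow> riesz m p = (\<Sum>x\<in>X. lam x * poly p x)"
    unfolding X_def by metis
  have "(\<Sum>x\<in>X. lam x) = 1" using lam(2)[of 1] by simp
  moreover have "finite X" unfolding X_def by (rule poly_roots_finite[OF Wnz])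
  ultimately obtain \<mu> where \<mu>: "\<mu> \<in> moment_measures {-s..s}"
    "\<And>p. (\<integral>x. poly p x \<partial>\<mu>) = (\<Sum>x\<in>X. lam x * poly p x)"
    using discrete_moment_measure[of X "{-s..s}" lam] Xs lam(1) by metis
  show ?thesis
  proof (rule that[OF \<mu>(1)])
    show "(\<integral>x. poly p x \<partial>\<mu>) = riesz m p" if "degree p \<le> K" for p
      using \<mu>(2) lam(2)[OF that] by simp
    show "(\<integral>x. poly (v * ?T * ?T) x \<partial>\<mu>) = 0"
      unfolding \<mu>(2) by (rule sum.neutral) (auto simp: X_def W_def)
  qed
qed

text \<open>For \<open>k \<ge> 1\<close> exactly two pairs of a weight \<open>v\<close> and an
  \<open>e\<close> satisfy \<open>degree v + 2 * e = k\<close>; the sign of the leading coefficient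
  of \<open>v\<close> decides to which endpoint the pair belongs. For even \<open>k\<close> the
  upper weight is quadratic and its polynomial has degree one less, whence
  \<open>(k - 1) div 2\<close> in \<open>ugap\<close> against \<open>k div 2\<close> in
  \<open>lgap\<close>.\<close>

definition lower_weight :: "real \<Rightarrow> nat \<Rightarrow> real poly" where
  "lower_weight s k = (if even k then 1 else [:s, 1:])"

definition upper_weight :: "real \<Rightarrow> nat \<Rightarrow> real poly" where
  "upper_weight s k = (if even k then [:s\<^sup>2, 0, -1:] else [:s, -1:])"

text \<open>Defined for every \<open>m\<close>; its reading as the distance from \<open>m k\<close>
  to the lower end of the range is established under \<open>wpos m s (k - 1)\<close>.\<close>

definition lgap :: "real \<Rightarrow> nat \<Rightarrow> (nat \<Rightarrow> real) \<Rightarrow> real" where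
  "lgap s k m = orth_norm m (lower_weight s k) (k div 2)"

definition ugap :: "real \<Rightarrow> nat \<Rightarrow> (nat \<Rightarrow> real) \<Rightarrow> real" where
  "ugap s k m = orth_norm m (upper_weight s k) ((k - 1) div 2)"

lemma lower_weight_props:
  "lower_weight s k \<in> weights s" "k \<ge> 1 \<Longrightarrow> degree (lower_weight s k) + 2 * (k div 2) = k"
  "lead_coeff (lower_weight s k) = 1"
  by (auto simp: lower_weight_def weights_def elim: oddE)

lemma upper_weight_props:
  "upper_weight s k \<in> weights s" "k \<ge> 1 \<Longrightarrow> degree (upper_weight s k) + 2 * ((k - 1) div 2) = k"
  "lead_coeff (upper_weight s k) = -1"
  by (auto simp: upper_weight_def weights_def elim!: oddE evenE)

lemma weight_cases:
  assumes "v \<in> weights s" "2 * i + degree v = k" "k \<ge> 1"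
  shows "v = lower_weight s k \<and> i = k div 2 \<or> v = upper_weight s k \<and> i = (k - 1) div 2"
  using assms by (auto simp: weights_def lower_weight_def upper_weight_def)

text \<open>Raising the degree bound from \<open>k - 1\<close> to \<open>k\<close> adds only the two
  norms of total degree exactly \<open>k\<close>, which are the two gaps.\<close>

lemma wpos_step:
  assumes "k \<ge> 1"
  shows "wpos m s k \<longleftrightarrow> wpos m s (k - 1) \<and> lgap s k m > 0 \<and> ugap s k m > 0"
proof
  assume *: "wpos m s k"
  show "wpos m s (k - 1) \<and> lgap s k m > 0 \<and> ugap s k m > 0"
    unfolding lgap_def ugap_def
    using wpos_mono[OF *, of "k - 1"] assms lower_weight_props[where s = s and k = k]
      upper_weight_props[where s = s and k = k]
    by (auto intro!: wpos_orth_norm[OF *])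
next
  assume *: "wpos m s (k - 1) \<and> lgap s k m > 0 \<and> ugap s k m > 0"
  show "wpos m s k"
    unfolding wpos_iff_orth_norm
  proof (intro ballI allI impI)
    fix v i assume v: "v \<in> weights s" "2 * i + degree v \<le> k"
    show "orth_norm m v i > 0"
    proof (cases "2 * i + degree v = k")
      case True
      then show ?thesis
        using weight_cases[OF v(1) True assms] * by (auto simp: lgap_def ugap_def)
    next
      case False
      then have "2 * i + degree v \<le> k - 1" using v by linarith
      then show ?thesis using * wpos_orth_norm[OF _ v(1)] by blast
    qed
  qed
qed

lemma wpos_0: "wpos m s 0"
  unfolding wpos_iff_orth_norm by (auto simp: weights_def orth_norm_def rinner_def)

text \<open>\<open>v T^2\<close> has degree exactly \<open>k\<close>, and its lower coefficients
  meet moments on which \<open>\<mu>\<close> and \<open>m\<close> agree.\<close>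

lemma integral_weighted_orth_square:
  assumes v: "v \<in> weights s" "degree v + 2 * e = k" "k \<ge> 1" and \<mu>: "\<mu> \<in> moment_measures T"
    and mom: "\<And>i. i \<in> {1..<k} \<Longrightarrow> mom i \<mu> = m i"
  shows "(\<integral>x. poly (v * orth m v e * orth m v e) x \<partial>\<mu>) = orth_norm m v e + lead_coeff v * (mom k \<mu> - m k)"
proof -
  let ?f = "v * orth m v e * orth m v e"
  have deg: "degree ?f = k"
    using weights_nonzero[OF v(1)] v(2) by (simp add: degree_mult_eq)
  have "lead_coeff ?f = lead_coeff v" by (simp add: lead_coeff_mult)
  then have "coeff ?f k = lead_coeff v" by (simp only: deg)
  then show ?thesis
    using integral_poly_moment_measure[OF \<mu>] riesz_change_top[of k "\<lambda>i. mom i \<mu>" m ?f] mom deg v(3)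
    by (simp add: orth_norm_def rinner_def del: poly_mult)
qed

context
  fixes m :: "nat \<Rightarrow> real" and s :: real and k :: nat
  assumes s: "s > 0" and k: "k \<ge> 1" and wp: "wpos m s (k - 1)"
begin

lemma weighted_bound:
  assumes v: "v \<in> weights s" "degree v + 2 * e = k" and \<mu>: "\<mu> \<in> moment_measures {-s..s}"
    and mom: "\<And>i. i \<in> {1..<k} \<Longrightarrow> mom i \<mu> = m i"
  shows "orth_norm m v e + lead_coeff v * (mom k \<mu> - m k) \<ge> 0"
proof -
  have "(\<integral>x. poly (v * orth m v e * orth m v e) x \<partial>\<mu>) \<ge> 0"
  proof (rule Bochner_Integration.integral_nonneg)
    fix x assume "x \<in> space \<mu>"
    then have "poly v x \<ge> 0"
      using space_moment_measure[OF \<mu>] by (intro weights_nonneg[OF v(1)]) auto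
    then show "0 \<le> poly (v * orth m v e * orth m v e) x"
      by (simp add: mult.assoc)
  qed
  then show ?thesis using integral_weighted_orth_square[OF v k \<mu> mom] by simp
qed

lemma weighted_bound_attained:
  assumes v: "v \<in> weights s" "degree v + 2 * e = k"
  shows "\<exists>\<mu>\<in>moment_measures {-s..s}. (\<forall>i\<in>{1..<k}. mom i \<mu> = m i) \<and>
    orth_norm m v e + lead_coeff v * (mom k \<mu> - m k) = 0"
proof -
  \<comment> \<open>The representation matches only the moments below \<open>k\<close>; its
    \<open>k\<close>-th moment is pinned afterwards, by the vanishing integral of
    \<open>v T^2\<close>.\<close>
  have "degree v + 2 * e = Suc (k - 1)" using v k by simp
  from principal_representation[OF s v(1) this wp]
  obtain \<mu> where \<mu>: "\<mu> \<in> moment_measures {-s..s}"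
    "\<And>p. degree p \<le> k - 1 \<Longrightarrow> (\<integral>x. poly p x \<partial>\<mu>) = riesz m p"
    "(\<integral>x. poly (v * orth m v e * orth m v e) x \<partial>\<mu>) = 0" by blast
  have mom: "mom i \<mu> = m i" if "i \<in> {1..<k}" for i
  proof -
    have "mom i \<mu> = riesz m (monom 1 i)"
      unfolding mom_eq_riesz[OF \<mu>(1)] by (rule \<mu>(2)) (use that in \<open>auto simp: degree_monom_eq\<close>)
    also have "\<dots> = m i" by (rule riesz_monom) (use that in auto)
    finally show ?thesis .
  qed
  then show ?thesis
    using integral_weighted_orth_square[OF v k \<mu>(1) mom] \<mu>(1,3) by force
qed

text \<open>Although \<open>m k\<close> occurs on the right, it cancels: \<open>lgap\<close> grows
  with \<open>m k\<close> at slope one. So the formula is compatible with a minimum that sees only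
  the moments below \<open>k\<close>.\<close>

lemma mom_lower_eq: "mom_lower s k m = m k - lgap s k m"
  unfolding mom_lower_def
proof (rule Least_equality)
  note v = lower_weight_props(1)[of s k] lower_weight_props(2)[OF k, of s]
  show "\<exists>\<mu>\<in>moment_measures {-s..s}. (\<forall>i\<in>{1..<k}. mom i \<mu> = m i) \<and> mom k \<mu> = m k - lgap s k m"
    using weighted_bound_attained[OF v] unfolding lower_weight_props(3) lgap_def by force
  fix y assume "\<exists>\<mu>\<in>moment_measures {-s..s}. (\<forall>i\<in>{1..<k}. mom i \<mu> = m i) \<and> mom k \<mu> = y"
  then show "m k - lgap s k m \<le> y"
    using weighted_bound[OF v] unfolding lower_weight_props(3) lgap_def by force
qed

lemma mom_upper_eq: "mom_upper s k m = m k + ugap s k m"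
  unfolding mom_upper_def
proof (rule Greatest_equality)
  note v = upper_weight_props(1)[of s k] upper_weight_props(2)[OF k, of s]
  show "\<exists>\<mu>\<in>moment_measures {-s..s}. (\<forall>i\<in>{1..<k}. mom i \<mu> = m i) \<and> mom k \<mu> = m k + ugap s k m"
    using weighted_bound_attained[OF v] unfolding upper_weight_props(3) ugap_def by force
  fix y assume "\<exists>\<mu>\<in>moment_measures {-s..s}. (\<forall>i\<in>{1..<k}. mom i \<mu> = m i) \<and> mom k \<mu> = y"
  then show "m k + ugap s k m \<ge> y"
    using weighted_bound[OF v] unfolding upper_weight_props(3) ugap_def by force
qed

end

text \<open>The case of weight 1 without an interval: the squares \<open>g^2\<close> of degree
  \<open>2 * n - 2\<close> serve as test polynomials, so the \<open>n\<close> norms of index below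
  \<open>n\<close> suffice. The finite support is used later to place all nodes inside
  \<open>[-s,s]\<close>.\<close>

lemma gauss_quadrature:
  assumes n: "n \<ge> 1" and pos: "\<And>i. i < n \<Longrightarrow> orth_norm m 1 i > 0"
  obtains X lam where "finite X" "card X = n" "\<And>x. x \<in> X \<Longrightarrow> lam x > (0 :: real)" "(\<Sum>x\<in>X. lam x) = 1"
    "\<And>p. degree p \<le> 2 * n - 1 \<Longrightarrow> riesz m p = (\<Sum>x\<in>X. lam x * poly p x)"
proof -
  let ?T = "orth m 1 n"
  define X where "X = {x. poly ?T x = 0}"
  have nz: "orth_norm m 1 i \<noteq> 0" if "i < n" for i using pos[OF that] by simp
  have cardX: "card X = degree ?T" unfolding X_def by (simp add: card_roots_orth[OF pos])
  have test: "\<exists>f. degree f \<le> 2 * n - 1 \<and> poly f x > 0 \<and> (\<forall>y\<in>X - {x}. poly f y = 0) \<and> riesz m f > 0"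
    if "x \<in> X" for x
  proof -
    have "poly ?T x = 0" using that by (simp add: X_def)
    then obtain g where g: "?T = [:- x, 1:] * g" "g \<noteq> 0" "n = degree g + 1" "poly g x \<noteq> 0"
        "\<And>y. poly ?T y = 0 \<Longrightarrow> y \<noteq> x \<Longrightarrow> poly g y = 0"
      using orth_root_cofactor[OF pos] by metis
    have "rinner m 1 g g > 0"
      by (rule rinner_pos[OF pos]) (use g(2,3) in \<open>auto intro: coeff_eq_0\<close>)
    moreover have "degree (g * g) \<le> 2 * n - 1"
      using g(2,3) by (simp add: degree_mult_eq)
    moreover have "poly (g * g) x > 0"
      using g(4) by (simp flip: power2_eq_square)
    moreover have "\<forall>y\<in>X - {x}. poly (g * g) y = 0"
      using g(5) by (simp add: X_def)
    ultimately show ?thesis unfolding rinner_def mult_1_left by blast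
  qed
  have perp: "riesz m (?T * g) = 0" if "g \<noteq> 0" "degree g + degree ?T \<le> 2 * n - 1" for g
  proof -
    have "rinner m 1 ?T g = 0"
      by (rule orth_perp[OF nz]) (use that n in \<open>auto intro!: coeff_eq_0\<close>)
    then show ?thesis by (simp add: rinner_def)
  qed
  have "0 < degree ?T" "degree ?T \<le> (2 * n - 1) + 1" using n by auto
  from quadrature[OF cardX[unfolded X_def] this perp test[unfolded X_def]]
  obtain lam where lam: "\<And>x. x \<in> X \<Longrightarrow> lam x > 0"
    "\<And>p. degree p \<le> 2 * n - 1 \<Longrightarrow> riesz m p = (\<Sum>x\<in>X. lam x * poly p x)"
    unfolding X_def by metis
  have "(\<Sum>x\<in>X. lam x) = 1" using lam(2)[of 1] by simp
  moreover have "finite X" unfolding X_def by (rule poly_roots_finite) simp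
  ultimately show ?thesis using that[of X lam] lam cardX by simp
qed

section \<open>Recursions for the moment ranges and the Jacobi parameters\<close>

text \<open>\<open>u\<close> is the convex weight that balances \<open>A\<close> against
  \<open>B\<close>. For the two gaps at \<open>k\<close> it equals \<open>1 - p_k\<close> with
  \<open>p_k\<close> the canonical moment.\<close>

lemma balance:
  fixes A B :: real
  assumes "A > 0" "B > 0" "u = B / (A + B)"
  shows "u * A = (1 - u) * B" "2 * s * u * A = 2 * s * A * B / (A + B)"
proof -
  have "A + B \<noteq> 0" using assms by simp
  then show "u * A = (1 - u) * B" "2 * s * u * A = 2 * s * A * B / (A + B)"
    unfolding assms(3) by (simp_all add: field_simps)
qed

text \<open>The polynomials of the weights \<open>s + x\<close>, \<open>s - x\<close> are
  combinations of the polynomial \<open>P\<close> of weight 1 and of \<open>x - s\<close>,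
  \<open>x + s\<close> times the polynomial \<open>S\<close> of weight \<open>s^2 - x^2\<close>,
  with coefficients \<open>u\<close> and \<open>1 - u\<close>. Adding them, each multiplied by its
  weight, cancels \<open>S\<close> and leaves \<open>2 s u P\<close>.\<close>

lemma gap_recursion_even:
  assumes wp: "wpos m s (2 * Suc d)"
  defines "A \<equiv> lgap s (2 * Suc d) m" and "B \<equiv> ugap s (2 * Suc d) m"
  shows "lgap s (2 * Suc d + 1) m + ugap s (2 * Suc d + 1) m = 2 * s * A * B / (A + B)"
proof -
  let ?e = "Suc d" and ?V = "[:s\<^sup>2, 0, -1:]"
  let ?P = "orth m 1 ?e" and ?S = "orth m ?V d"
  define u where "u = B / (A + B)"
  have A: "A = orth_norm m 1 ?e" by (simp add: A_def lgap_def lower_weight_def)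
  have B: "B = orth_norm m ?V d" by (simp add: B_def ugap_def upper_weight_def)
  have w: "1 \<in> weights s" "[:s, 1:] \<in> weights s" "[:s, -1:] \<in> weights s" "?V \<in> weights s"
    by (auto simp: weights_def)
  have pos: "orth_norm m 1 i > 0" "i < ?e \<Longrightarrow> orth_norm m [:s, 1:] i > 0" "i < ?e \<Longrightarrow> orth_norm m [:s, -1:] i > 0"
    "i < ?e \<Longrightarrow> orth_norm m ?V i > 0" if "i < Suc ?e" for i
    using that by (auto intro!: wpos_orth_norm[OF wp] w)
  have "A > 0" "B > 0" using pos[of ?e] pos[of d] by (simp_all add: A B)
  note bal = balance[OF this u_def]
  have P: "rinner m 1 ?P q = coeff q ?e * A" if "\<And>i. i > ?e \<Longrightarrow> coeff q i = 0" for q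
    unfolding A by (rule rinner_orth) (use pos(1) that in \<open>auto dest!: pos(1)[OF less_SucI]\<close>)
  have S: "rinner m ?V ?S q = coeff q d * B" if "\<And>i. i > d \<Longrightarrow> coeff q i = 0" for q
    unfolding B
  proof (rule rinner_orth[OF _ that])
    show "orth_norm m ?V i \<noteq> 0" if "i < d" for i using pos(4)[of i] that by simp
  qed
  \<comment> \<open>For \<open>c = 1\<close> or \<open>c = -1\<close> the factor is
    \<open>x - c s\<close>, chosen since \<open>(s + c x) (x - c s) = - c (s^2 - x^2)\<close>.
    Pairing with \<open>q\<close> then leaves \<open>u A - (1 - u) B\<close> times a coefficient,
    and \<open>u\<close> makes this zero.\<close>
  have comb: "smult u ?P + smult (1 - u) ([:- c * s, c * c:] * ?S) = orth m [:s, c:] ?e"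
    if c: "c = 1 \<or> c = -1" for c
  proof (rule orth_unique)
    show "orth_norm m [:s, c:] i > 0" if "i < ?e" for i
      using c pos[of i] that by auto
    show "coeff (smult u ?P + smult (1 - u) ([:- c * s, c * c:] * ?S)) ?e = 1"
      using c by (auto simp: coeff_orth_ge)
    show "coeff (smult u ?P + smult (1 - u) ([:- c * s, c * c:] * ?S)) i = 0" if "i > ?e" for i
      using that by (cases i) (auto simp: coeff_orth_ge)
    fix q :: "real poly" assume q: "\<And>i. i \<ge> ?e \<Longrightarrow> coeff q i = 0"
    have q': "coeff ([:s, c:] * q) i = 0" if "i > ?e" for i
      using that q by (cases i) auto
    have "[:s, c:] * (smult u ?P + smult (1 - u) ([:- c * s, c * c:] * ?S)) * q
        = smult u (1 * ?P * ([:s, c:] * q)) - smult (c * (1 - u)) (?V * ?S * q)"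
      using c by (intro poly_ext) (auto simp: power2_eq_square algebra_simps)
    then have "rinner m [:s, c:] (smult u ?P + smult (1 - u) ([:- c * s, c * c:] * ?S)) q
        = u * rinner m 1 ?P ([:s, c:] * q) - c * (1 - u) * rinner m ?V ?S q"
      by (simp only: rinner_def riesz_diff riesz_smult)
    also have "\<dots> = u * (c * coeff q d * A) - c * (1 - u) * (coeff q d * B)"
    proof -
      have "coeff ([:s, c:] * q) ?e = c * coeff q d" using q by simp
      then show ?thesis using q by (simp only: P[OF q'] S Suc_le_eq)
    qed
    also have "\<dots> = c * coeff q d * (u * A - (1 - u) * B)"
      by (simp add: algebra_simps)
    finally show "rinner m [:s, c:] (smult u ?P + smult (1 - u) ([:- c * s, c * c:] * ?S)) q = 0"
      using bal(1) by simp
  qed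
  have norm: "orth_norm m [:s, c:] ?e = riesz m ([:s, c:] * orth m [:s, c:] ?e * ?P)"
    if c: "c = 1 \<or> c = -1" for c
  proof -
    have "rinner m [:s, c:] (orth m [:s, c:] ?e) ?P = coeff ?P ?e * orth_norm m [:s, c:] ?e"
    proof (rule rinner_orth)
      show "orth_norm m [:s, c:] i \<noteq> 0" if "i < ?e" for i
        using c pos[of i] that by auto
    qed (simp add: coeff_orth_ge)
    then show ?thesis by (simp add: rinner_def)
  qed
  have "[:s, 1:] * orth m [:s, 1:] ?e * ?P + [:s, -1:] * orth m [:s, -1:] ?e * ?P = smult (2 * s * u) (1 * ?P * ?P)"
    unfolding comb[of 1, simplified, symmetric] comb[of "-1", simplified, symmetric]
    by (rule poly_ext) (simp add: algebra_simps)
  then have "orth_norm m [:s, 1:] ?e + orth_norm m [:s, -1:] ?e = 2 * s * u * A"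
    unfolding norm[of 1, simplified] norm[of "-1", simplified] riesz_add[symmetric]
    by (simp add: A orth_norm_def rinner_def)
  then show ?thesis
    using bal(2) by (simp add: lgap_def ugap_def lower_weight_def upper_weight_def)
qed

text \<open>The roles are exchanged: with \<open>Q\<close>, \<open>R\<close> the polynomials of
  \<open>s + x\<close>, \<open>s - x\<close>, that of weight 1 is
  \<open>P = u (s + x) Q + (1 - u) (x - s) R\<close> and that of \<open>s^2 - x^2\<close> is
  \<open>S = u Q + (1 - u) R\<close>. Then \<open>P + (s - x) S = 2 s u Q\<close>, and
  multiplication by \<open>(s + x) Q\<close> yields the sum of the two next norms.\<close>

lemma gap_recursion_odd:
  assumes wp: "wpos m s (2 * e + 1)"
  defines "A \<equiv> lgap s (2 * e + 1) m" and "B \<equiv> ugap s (2 * e + 1) m"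
  shows "lgap s (2 * e + 2) m + ugap s (2 * e + 2) m = 2 * s * A * B / (A + B)"
proof -
  let ?V = "[:s\<^sup>2, 0, -1:]" and ?l = "[:s, 1:]" and ?r = "[:s, -1:]"
  let ?Q = "orth m ?l e" and ?R = "orth m ?r e"
  define u where "u = B / (A + B)"
  have A: "A = orth_norm m ?l e" by (simp add: A_def lgap_def lower_weight_def)
  have B: "B = orth_norm m ?r e" by (simp add: B_def ugap_def upper_weight_def)
  have w: "1 \<in> weights s" "?l \<in> weights s" "?r \<in> weights s" "?V \<in> weights s"
    by (auto simp: weights_def)
  have pos: "orth_norm m 1 i > 0" "orth_norm m ?l i > 0" "orth_norm m ?r i > 0"
    "i < e \<Longrightarrow> orth_norm m ?V i > 0" if "i < Suc e" for i
    using that by (auto intro!: wpos_orth_norm[OF wp] w)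
  have "A > 0" "B > 0" using pos[of e] by (simp_all add: A B)
  note bal = balance[OF this u_def]
  have Q: "rinner m ?l ?Q q = coeff q e * A" if "\<And>i. i > e \<Longrightarrow> coeff q i = 0" for q
    unfolding A
  proof (rule rinner_orth[OF _ that])
    show "orth_norm m ?l i \<noteq> 0" if "i < e" for i using pos(2)[of i] that by simp
  qed
  have R: "rinner m ?r ?R q = coeff q e * B" if "\<And>i. i > e \<Longrightarrow> coeff q i = 0" for q
    unfolding B
  proof (rule rinner_orth[OF _ that])
    show "orth_norm m ?r i \<noteq> 0" if "i < e" for i using pos(3)[of i] that by simp
  qed
  have P: "smult u (?l * ?Q) + smult (1 - u) ([:- s, 1:] * ?R) = orth m 1 (Suc e)"
  proof (rule orth_unique)
    show "orth_norm m 1 i > 0" if "i < Suc e" for i by (rule pos(1)[OF that])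
    show "coeff (smult u (?l * ?Q) + smult (1 - u) ([:- s, 1:] * ?R)) (Suc e) = 1"
      by (simp add: coeff_orth_ge)
    show "coeff (smult u (?l * ?Q) + smult (1 - u) ([:- s, 1:] * ?R)) i = 0" if "i > Suc e" for i
      using that by (cases i) (auto simp: coeff_orth_ge)
    fix q :: "real poly" assume q: "\<And>i. i \<ge> Suc e \<Longrightarrow> coeff q i = 0"
    have "1 * (smult u (?l * ?Q) + smult (1 - u) ([:- s, 1:] * ?R)) * q
        = smult u (?l * ?Q * q) - smult (1 - u) (?r * ?R * q)"
      by (rule poly_ext) (simp add: algebra_simps)
    then have "rinner m 1 (smult u (?l * ?Q) + smult (1 - u) ([:- s, 1:] * ?R)) q
        = u * rinner m ?l ?Q q - (1 - u) * rinner m ?r ?R q"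
      by (simp only: rinner_def riesz_diff riesz_smult)
    also have "\<dots> = coeff q e * (u * A - (1 - u) * B)"
      using q by (simp add: Q R algebra_simps)
    finally show "rinner m 1 (smult u (?l * ?Q) + smult (1 - u) ([:- s, 1:] * ?R)) q = 0"
      using bal(1) by simp
  qed
  have S: "smult u ?Q + smult (1 - u) ?R = orth m ?V e"
  proof (rule orth_unique)
    show "orth_norm m ?V i > 0" if "i < e" for i using pos(4) that by simp
    show "coeff (smult u ?Q + smult (1 - u) ?R) e = 1" by simp
    show "coeff (smult u ?Q + smult (1 - u) ?R) i = 0" if "i > e" for i
      using that by (simp add: coeff_orth_ge)
    fix q :: "real poly" assume q: "\<And>i. i \<ge> e \<Longrightarrow> coeff q i = 0"
    have q': "coeff ([:s, c:] * q) i = 0" if "i > e" for i c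
      using that q by (cases i) auto
    have "?V * (smult u ?Q + smult (1 - u) ?R) * q
        = smult u (?l * ?Q * (?r * q)) + smult (1 - u) (?r * ?R * (?l * q))"
      by (rule poly_ext) (simp add: power2_eq_square algebra_simps)
    then have "rinner m ?V (smult u ?Q + smult (1 - u) ?R) q
        = u * rinner m ?l ?Q (?r * q) + (1 - u) * rinner m ?r ?R (?l * q)"
      by (simp only: rinner_def riesz_add riesz_smult)
    also have "\<dots> = u * (coeff (?r * q) e * A) + (1 - u) * (coeff (?l * q) e * B)"
      by (simp only: Q[OF q'] R[OF q'])
    also have "\<dots> = 0"
    proof (cases e)
      case (Suc d)
      then have "coeff (?r * q) e = - coeff q d" "coeff (?l * q) e = coeff q d"
        using q by simp_all
      then show ?thesis using bal(1) by simp
    next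
      case 0
      then have "q = 0" using q by (intro poly_eqI) simp
      then show ?thesis by simp
    qed
    finally show "rinner m ?V (smult u ?Q + smult (1 - u) ?R) q = 0" .
  qed
  let ?P = "orth m 1 (Suc e)" and ?S = "orth m ?V e"
  have "rinner m 1 ?P (?l * ?Q) = coeff (?l * ?Q) (Suc e) * orth_norm m 1 (Suc e)"
  proof (rule rinner_orth)
    show "orth_norm m 1 i \<noteq> 0" if "i < Suc e" for i using pos(1)[OF that] by simp
    show "coeff (?l * ?Q) i = 0" if "i > Suc e" for i
      using that by (cases i) (auto simp: coeff_orth_ge)
  qed
  then have 1: "orth_norm m 1 (Suc e) = riesz m (?P * (?l * ?Q))"
    by (simp add: rinner_def coeff_orth_ge)
  have "rinner m ?V ?S ?Q = coeff ?Q e * orth_norm m ?V e"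
  proof (rule rinner_orth)
    show "orth_norm m ?V i \<noteq> 0" if "i < e" for i using pos(4)[of i] that by simp
  qed (simp add: coeff_orth_ge)
  then have 2: "orth_norm m ?V e = riesz m (?V * ?S * ?Q)"
    by (simp add: rinner_def)
  have "?P * (?l * ?Q) + ?V * ?S * ?Q = smult (2 * s * u) (?l * ?Q * ?Q)"
    unfolding P[symmetric] S[symmetric]
    by (rule poly_ext) (simp add: power2_eq_square algebra_simps)
  then have "orth_norm m 1 (Suc e) + orth_norm m ?V e = 2 * s * u * A"
    unfolding 1 2 riesz_add[symmetric] by (simp add: A orth_norm_def rinner_def)
  then show ?thesis
    using bal(2) by (simp add: lgap_def ugap_def lower_weight_def upper_weight_def)
qed

lemma gap_recursion:
  assumes "wpos m s k" "k \<ge> 1"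
  shows "lgap s (Suc k) m + ugap s (Suc k) m =
    2 * s * lgap s k m * ugap s k m / (lgap s k m + ugap s k m)"
proof (cases "even k")
  case True
  then obtain d where "k = 2 * Suc d" using assms(2) by (metis evenE mult_0_right not_one_le_zero old.nat.exhaust)
  then show ?thesis using gap_recursion_even[of m s d] assms by simp
next
  case False
  then obtain e where "k = 2 * e + 1" by (elim oddE)
  then show ?thesis using gap_recursion_odd[of m s e] assms by simp
qed

lemma gap_sum_1: "lgap s 1 m + ugap s 1 m = 2 * s"
proof -
  have "lgap s 1 m + ugap s 1 m = riesz m ([:s, 1:] + [:s, -1:])"
    unfolding riesz_add by (simp add: lgap_def ugap_def lower_weight_def upper_weight_def orth_norm_def rinner_def)
  also have "[:s, 1:] + [:s, -1:] = smult (2 * s) 1" by (rule poly_ext) simp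
  also have "riesz m (smult (2 * s) 1) = 2 * s" by (simp only: riesz_smult riesz_1 mult_1_right)
  finally show ?thesis .
qed

section \<open>Recurrence coefficients in terms of norms and gaps\<close>

definition jacobi_b :: "(nat \<Rightarrow> real) \<Rightarrow> nat \<Rightarrow> real" where
  "jacobi_b m k = rinner m [:0, 1:] (orth m 1 (k - 1)) (orth m 1 (k - 1)) / orth_norm m 1 (k - 1)"

definition jacobi_a :: "(nat \<Rightarrow> real) \<Rightarrow> nat \<Rightarrow> real" where
  "jacobi_a m k = orth_norm m 1 k / orth_norm m 1 (k - 1)"

text \<open>In the polynomials of weight \<open>s + x\<close>, \<open>P_e\<close> has only two
  terms, \<open>P_e = Q_e + \<beta> Q_(e-1)\<close>, whose squared norms add. The integral of
  \<open>(s + x) P_e^2\<close> is also \<open>b_(e+1) + s\<close> times the norm of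
  \<open>P_e\<close>.\<close>

lemma jacobi_b_gaps:
  assumes wp: "wpos m s (2 * Suc d)"
  shows "(jacobi_b m (Suc (Suc d)) + s) * lgap s (2 * Suc d) m
    = lgap s (2 * Suc d + 1) m + (lgap s (2 * Suc d) m)\<^sup>2 / lgap s (2 * d + 1) m"
proof -
  let ?e = "Suc d" and ?l = "[:s, 1:]"
  let ?P = "orth m 1 ?e" and ?Q = "orth m ?l ?e" and ?Q' = "orth m ?l d"
  let ?A = "orth_norm m 1 ?e" and ?A' = "orth_norm m ?l d"
  have w: "1 \<in> weights s" "?l \<in> weights s" by (auto simp: weights_def)
  have pos: "orth_norm m 1 i > 0" "i < ?e \<Longrightarrow> orth_norm m ?l i > 0" if "i < Suc ?e" for i
    using that by (auto intro!: wpos_orth_norm[OF wp] w)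
  have pos': "orth_norm m ?l i > 0" if "i < ?e" for i using pos(2)[of i] that by simp
  have nz: "orth_norm m ?l i \<noteq> 0" if "i < ?e" for i using pos'[OF that] by simp
  have nz': "orth_norm m ?l i \<noteq> 0" if "i < d" for i using nz[of i] that by simp
  have A': "?A' > 0" using pos'[of d] by simp
  \<comment> \<open>Against \<open>q\<close> of degree at most \<open>d\<close>, \<open>?P\<close>
    and \<open>?Q'\<close> pair to \<open>coeff q d\<close> times \<open>?A\<close> and
    \<open>?A'\<close>; \<open>\<beta>\<close> is the ratio that cancels them.\<close>
  define \<beta> where "\<beta> = ?A / ?A'"
  have Q: "?P - smult \<beta> ?Q' = ?Q"
  proof (rule orth_unique[OF pos'])
    show "coeff (?P - smult \<beta> ?Q') ?e = 1" by (simp add: coeff_orth_ge)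
    show "coeff (?P - smult \<beta> ?Q') i = 0" if "i > ?e" for i
      using that by (simp add: coeff_orth_ge)
    fix q :: "real poly" assume q: "\<And>i. i \<ge> ?e \<Longrightarrow> coeff q i = 0"
    have "rinner m 1 ?P (?l * q) = coeff (?l * q) ?e * ?A"
    proof (rule rinner_orth)
      show "orth_norm m 1 i \<noteq> 0" if "i < ?e" for i using pos(1)[of i] that by simp
      show "coeff (?l * q) i = 0" if "i > ?e" for i
        using that q by (cases i) auto
    qed
    moreover have "1 * ?P * (?l * q) = ?l * ?P * q" by (simp only: mult_ac mult_1_left)
    moreover have "coeff (?l * q) ?e = coeff q d" using q by simp
    ultimately have 1: "rinner m ?l ?P q = coeff q d * ?A"
      by (simp only: rinner_def)
    have 2: "rinner m ?l ?Q' q = coeff q d * ?A'"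
      by (rule rinner_orth[OF nz']) (use q in auto)
    show "rinner m ?l (?P - smult \<beta> ?Q') q = 0"
      using A' by (simp add: 1 2 \<beta>_def)
  qed auto
  have QQ': "rinner m ?l ?Q ?Q' = 0"
    by (rule orth_perp[OF nz]) (auto simp: coeff_orth_ge)
  have P: "?P = ?Q + smult \<beta> ?Q'" unfolding Q[symmetric] by simp
  have "rinner m ?l ?P ?P = orth_norm m ?l ?e + \<beta>\<^sup>2 * ?A'"
    unfolding P using QQ' rinner_commute[of m ?l ?Q' ?Q]
    by (simp add: orth_norm_def power2_eq_square)
  also have "\<beta>\<^sup>2 * ?A' = ?A\<^sup>2 / ?A'" using A' by (simp add: \<beta>_def power2_eq_square)
  finally have *: "rinner m ?l ?P ?P = orth_norm m ?l ?e + ?A\<^sup>2 / ?A'" .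
  have "?l * ?P * ?P = [:0, 1:] * ?P * ?P + smult s (1 * ?P * ?P)"
    by (rule poly_ext) (simp add: algebra_simps)
  then have "rinner m ?l ?P ?P = rinner m [:0, 1:] ?P ?P + s * ?A"
    by (simp only: orth_norm_def rinner_def riesz_add riesz_smult)
  moreover have "jacobi_b m (Suc ?e) * ?A = rinner m [:0, 1:] ?P ?P"
    using pos(1)[of ?e] by (simp add: jacobi_b_def)
  ultimately show ?thesis
    using * by (simp add: lgap_def lower_weight_def algebra_simps)
qed

lemma jacobi_b_1: "jacobi_b m 1 + s = lgap s 1 m"
proof -
  have "[:s, 1:] = [:0, 1:] + smult s 1" by (rule poly_ext) simp
  then have "riesz m [:s, 1:] = riesz m [:0, 1:] + s * riesz m 1" by (metis riesz_add riesz_smult)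
  then show ?thesis
    by (simp add: jacobi_b_def orth_norm_def rinner_def lgap_def lower_weight_def)
qed

section \<open>Triangular changes of variables\<close>

lemma nn_integral_affine_div:
  fixes \<phi> :: "real \<Rightarrow> ennreal"
  assumes [measurable]: "\<phi> \<in> borel_measurable borel" and W: "W > 0"
  shows "(\<integral>\<^sup>+y. \<phi> ((y - L) / W) \<partial>lborel) = ennreal W * (\<integral>\<^sup>+y. \<phi> y \<partial>lborel)"
proof -
  have "(\<integral>\<^sup>+y. \<phi> y \<partial>lborel) = \<bar>1 / W\<bar> * (\<integral>\<^sup>+y. \<phi> (- L / W + (1 / W) * y) \<partial>lborel)"
    by (rule nn_integral_real_affine) (use W in auto)
  moreover have "- L / W + (1 / W) * y = (y - L) / W" for y
    using W by (simp add: field_simps)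
  moreover have "ennreal W * (ennreal (1 / W) * I) = I" for I
    using W by (simp add: mult.assoc[symmetric] flip: ennreal_mult)
  ultimately show ?thesis using W by simp
qed

text \<open>A change of variables \<open>m \<mapsto> (c\<^sub>1, \<dots>, c\<^sub>N)\<close> whose \<open>k\<close>-th component is affine in \<open>m k\<close> with slope
  \<open>1 / W\<^sub>k\<close>, where \<open>W\<^sub>k\<close> is a product of functions of the preceding components.\<close>

locale triangular =
  fixes L W :: "nat \<Rightarrow> (nat \<Rightarrow> real) \<Rightarrow> real" and w :: real
    and r :: "nat \<Rightarrow> real \<Rightarrow> real" and S :: "nat \<Rightarrow> real set"
  assumes L_cong: "\<And>k m m'. k \<ge> 1 \<Longrightarrow> (\<And>i. i \<in> {1..<k} \<Longrightarrow> m i = m' i) \<Longrightarrow> L k m = L k m'"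
    and W_cong: "\<And>k m m'. k \<ge> 1 \<Longrightarrow> (\<And>i. i \<in> {1..<k} \<Longrightarrow> m i = m' i) \<Longrightarrow> W k m = W k m'"
    and L_measurable [measurable]: "\<And>N k. L k \<in> borel_measurable (lebesgue_space N)"
    and W_measurable [measurable]: "\<And>N k. W k \<in> borel_measurable (lebesgue_space N)"
    and W_1: "\<And>m. W 1 m = w" and w_pos: "w > 0"
    and W_Suc: "\<And>k m. k \<ge> 1 \<Longrightarrow> (\<And>j. j \<in> {1..k} \<Longrightarrow> (m j - L j m) / W j m \<in> S j) \<Longrightarrow>
       W (Suc k) m = r k ((m k - L k m) / W k m) * W k m"
    and r_pos: "\<And>k t. t \<in> S k \<Longrightarrow> r k t > 0"
    and r_measurable [measurable]: "\<And>k. r k \<in> borel_measurable borel"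
begin

definition coord :: "nat \<Rightarrow> (nat \<Rightarrow> real) \<Rightarrow> real" where
  "coord k m = (m k - L k m) / W k m"

lemma coord_cong:
  assumes "k \<ge> 1" "\<And>i. i \<in> {1..k} \<Longrightarrow> m i = m' i"
  shows "coord k m = coord k m'"
proof -
  have "L k m = L k m'" by (rule L_cong) (use assms in auto)
  moreover have "W k m = W k m'" by (rule W_cong) (use assms in auto)
  ultimately show ?thesis using assms by (simp add: coord_def)
qed

lemma coord_measurable [measurable]:
  assumes "k \<in> {1..N}"
  shows "coord k \<in> borel_measurable (lebesgue_space N)"
proof -
  have [measurable]: "(\<lambda>m. m k) \<in> borel_measurable (lebesgue_space N)"
    using measurable_component_singleton[OF assms, of "\<lambda>_. lborel"] by simp
  show ?thesis unfolding coord_def by measurable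
qed

lemma W_eq_prod:
  assumes "\<And>j. j \<in> {1..k} \<Longrightarrow> coord j m \<in> S j"
  shows "W (Suc k) m = w * (\<Prod>j\<in>{1..k}. r j (coord j m))"
  using assms
proof (induction k)
  case 0
  then show ?case using W_1[of m] by simp
next
  case (Suc k)
  have "W (Suc (Suc k)) m = r (Suc k) (coord (Suc k) m) * W (Suc k) m"
    unfolding coord_def by (rule W_Suc) (use Suc.prems in \<open>auto simp: coord_def\<close>)
  then show ?case using Suc by simp
qed

text \<open>The last variable is integrated out by an affine substitution. Its Jacobian
  \<open>W (Suc N)\<close> is \<open>w\<close> times the product of the \<open>r j\<close> at the
  earlier coordinates, so it splits among the remaining factors: coordinate \<open>k\<close>
  collects \<open>r k\<close> once from each of the \<open>N - k\<close> later variables.\<close>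

theorem nn_integral_prod:
  assumes "\<And>k. \<phi> k \<in> borel_measurable borel" "\<And>k t. k \<ge> 1 \<Longrightarrow> t \<notin> S k \<Longrightarrow> \<phi> k t = (0 :: ennreal)"
  shows "(\<integral>\<^sup>+m. (\<Prod>k\<in>{1..N}. \<phi> k (coord k m)) \<partial>lebesgue_space N)
    = (\<Prod>k\<in>{1..N}. ennreal w * (\<integral>\<^sup>+t. \<phi> k t * ennreal (r k t) ^ (N - k) \<partial>lborel))"
  using assms
proof (induction N arbitrary: \<phi>)
  case 0
  interpret product_sigma_finite "\<lambda>_ :: nat. lborel :: real measure" ..
  show ?case by (simp add: space_PiM_empty)
next
  case (Suc N)
  interpret product_sigma_finite "\<lambda>_ :: nat. lborel :: real measure" ..
  note [measurable] = Suc.prems(1)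
  define J where "J = (\<integral>\<^sup>+t. \<phi> (Suc N) t \<partial>lborel)"
  define \<phi>' where "\<phi>' k t = \<phi> k t * ennreal (r k t)" for k t
  have ins: "{1..Suc N} = insert (Suc N) {1..N}" by auto
  have meas: "(\<lambda>m. \<Prod>k\<in>{1..Suc N}. \<phi> k (coord k m)) \<in> borel_measurable (lebesgue_space (Suc N))"
    by (intro borel_measurable_prod_ennreal measurable_compose[OF coord_measurable Suc.prems(1)])
  have inner: "(\<integral>\<^sup>+y. (\<Prod>k\<in>{1..Suc N}. \<phi> k (coord k (x(Suc N := y)))) \<partial>lborel)
      = ennreal w * J * (\<Prod>k\<in>{1..N}. \<phi>' k (coord k x))" for x
  proof -
    have "coord k (x(Suc N := y)) = coord k x" if "k \<in> {1..N}" for k y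
      by (rule coord_cong) (use that in auto)
    moreover have "coord (Suc N) (x(Suc N := y)) = (y - L (Suc N) x) / W (Suc N) x" for y
      unfolding coord_def using L_cong[of "Suc N" "x(Suc N := y)" x] W_cong[of "Suc N" "x(Suc N := y)" x]
      by simp
    ultimately have "(\<integral>\<^sup>+y. (\<Prod>k\<in>{1..Suc N}. \<phi> k (coord k (x(Suc N := y)))) \<partial>lborel)
        = (\<integral>\<^sup>+y. (\<Prod>k\<in>{1..N}. \<phi> k (coord k x)) * \<phi> (Suc N) ((y - L (Suc N) x) / W (Suc N) x) \<partial>lborel)"
      unfolding ins by (simp add: mult.commute)
    also have "\<dots> = (\<Prod>k\<in>{1..N}. \<phi> k (coord k x)) *
        (\<integral>\<^sup>+y. \<phi> (Suc N) ((y - L (Suc N) x) / W (Suc N) x) \<partial>lborel)"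
      by (rule nn_integral_cmult) measurable
    also have "\<dots> = ennreal w * J * (\<Prod>k\<in>{1..N}. \<phi>' k (coord k x))"
    proof (cases "\<forall>k\<in>{1..N}. coord k x \<in> S k")
      case True
      then have W: "W (Suc N) x = w * (\<Prod>j\<in>{1..N}. r j (coord j x))"
        by (intro W_eq_prod) auto
      have r: "r j (coord j x) > 0" if "j \<in> {1..N}" for j
        using True that r_pos by blast
      then have prod_pos: "(\<Prod>j\<in>{1..N}. r j (coord j x)) > 0" by (rule prod_pos)
      then have "W (Suc N) x > 0" using W w_pos by simp
      then have "(\<integral>\<^sup>+y. \<phi> (Suc N) ((y - L (Suc N) x) / W (Suc N) x) \<partial>lborel) = ennreal (W (Suc N) x) * J"
        unfolding J_def by (intro nn_integral_affine_div) measurable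
      also have "ennreal (W (Suc N) x) = ennreal w * (\<Prod>j\<in>{1..N}. ennreal (r j (coord j x)))"
        unfolding W using w_pos prod_pos r by (subst prod_ennreal) (auto simp: ennreal_mult less_imp_le)
      finally show ?thesis by (simp add: \<phi>'_def prod.distrib mult_ac)
    next
      \<comment> \<open>The product formula for \<open>W\<close> needs the earlier coordinates in
        their supports; if one lies outside, its factor \<open>\<phi> k\<close> is zero and both
        sides vanish.\<close>
      case False
      then obtain k where k: "k \<in> {1..N}" "coord k x \<notin> S k" by blast
      then have "\<phi> k (coord k x) = 0" by (intro Suc.prems) auto
      then have "(\<Prod>k\<in>{1..N}. \<phi> k (coord k x)) = 0" "(\<Prod>k\<in>{1..N}. \<phi>' k (coord k x)) = 0"
        unfolding prod_zero_iff[OF finite_atLeastAtMost] using k(1) by (auto simp: \<phi>'_def)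
      then show ?thesis by (simp only: mult_zero_left mult_zero_right)
    qed
    finally show ?thesis .
  qed
  have "(\<integral>\<^sup>+m. (\<Prod>k\<in>{1..Suc N}. \<phi> k (coord k m)) \<partial>lebesgue_space (Suc N))
      = (\<integral>\<^sup>+x. (\<integral>\<^sup>+y. (\<Prod>k\<in>{1..Suc N}. \<phi> k (coord k (x(Suc N := y)))) \<partial>lborel) \<partial>lebesgue_space N)"
    unfolding ins
  proof (rule product_nn_integral_insert)
    show "(\<lambda>m. \<Prod>k\<in>insert (Suc N) {1..N}. \<phi> k (coord k m))
        \<in> borel_measurable (Pi\<^sub>M (insert (Suc N) {1..N}) (\<lambda>_. lborel))"
      using meas unfolding ins .
  qed auto
  also have "\<dots> = (\<integral>\<^sup>+x. ennreal w * J * (\<Prod>k\<in>{1..N}. \<phi>' k (coord k x)) \<partial>lebesgue_space N)"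
    unfolding inner ..
  also have "\<dots> = ennreal w * J * (\<integral>\<^sup>+x. (\<Prod>k\<in>{1..N}. \<phi>' k (coord k x)) \<partial>lebesgue_space N)"
  proof (rule nn_integral_cmult, intro borel_measurable_prod_ennreal)
    fix k assume "k \<in> {1..N}"
    moreover have "\<phi>' k \<in> borel_measurable borel" unfolding \<phi>'_def by measurable
    ultimately show "(\<lambda>x. \<phi>' k (coord k x)) \<in> borel_measurable (lebesgue_space N)"
      by (rule measurable_compose[OF coord_measurable])
  qed
  also have "(\<integral>\<^sup>+x. (\<Prod>k\<in>{1..N}. \<phi>' k (coord k x)) \<partial>lebesgue_space N)
      = (\<Prod>k\<in>{1..N}. ennreal w * (\<integral>\<^sup>+t. \<phi>' k t * ennreal (r k t) ^ (N - k) \<partial>lborel))"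
    by (rule Suc.IH) (use Suc.prems in \<open>auto simp: \<phi>'_def\<close>)
  also have "\<dots> = (\<Prod>k\<in>{1..N}. ennreal w * (\<integral>\<^sup>+t. \<phi> k t * ennreal (r k t) ^ (Suc N - k) \<partial>lborel))"
    by (rule prod.cong) (auto simp: \<phi>'_def Suc_diff_le mult_ac)
  finally show ?case
    unfolding ins by (simp add: J_def)
qed

end

section \<open>Asymptotics of Gamma and Beta functions\<close>

text \<open>Log-convexity on \<open>y - 1 < y \<le> y + c\<close> gives the lower bound, on
  \<open>y \<le> y + c < y + c + 1\<close> the upper one; the unit steps are evaluated by
  \<open>Gamma (x + 1) = x * Gamma x\<close>.\<close>

lemma Gamma_ratio_bounds:
  fixes y c :: real
  assumes y: "y > 1" and c: "c \<ge> 0"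
  shows "(y - 1) powr c \<le> Gamma (y + c) / Gamma y" "Gamma (y + c) / Gamma y \<le> (y + c) powr c"
proof -
  define f :: "real \<Rightarrow> real" where "f = ln \<circ> Gamma"
  have conv: "convex_on {0<..} f" unfolding f_def by (rule log_convex_Gamma_real)
  have rec: "f (x + 1) = f x + ln x" if "x > 0" for x
  proof -
    have "Gamma (x + 1) = x * Gamma x" by (rule Gamma_plus1) (use that in \<open>auto elim: nonpos_Ints_cases'\<close>)
    moreover have "Gamma x > 0" using that by (rule Gamma_real_pos)
    ultimately show ?thesis using ln_mult_pos[OF that, of "Gamma x"] by (simp only: f_def o_def)
  qed
  \<comment> \<open>With this \<open>p\<close>, \<open>y = (1 - p) (y - 1) + p (y + c)\<close> and
    \<open>y + c = (1 - c p) y + c p (y + c + 1)\<close>.\<close>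
  define p where "p = 1 / (1 + c)"
  have p: "p * (1 + c) = 1" "0 \<le> p" "p \<le> 1" using c by (simp_all add: p_def)
  have "c * p = 1 - p" using p(1) by (simp add: algebra_simps)
  then have cp: "0 \<le> c * p" "c * p \<le> 1" using p by simp_all
  have 1: "f (y + c) \<ge> f y + c * ln (y - 1)"
  proof -
    have "(1 - p) * (y - 1) + p * (y + c) = y - 1 + p * (1 + c)"
      by (simp add: algebra_simps)
    then have "(1 - p) * (y - 1) + p * (y + c) = y" using p(1) by simp
    moreover have "f ((1 - p) *\<^sub>R (y - 1) + p *\<^sub>R (y + c)) \<le> (1 - p) * f (y - 1) + p * f (y + c)"
      by (rule convex_onD[OF conv]) (use y c p in auto)
    ultimately have "f y \<le> (1 - p) * f (y - 1) + p * f (y + c)" by simp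
    then have "(1 + c) * f y \<le> (1 + c) * ((1 - p) * f (y - 1) + p * f (y + c))"
      using c by (intro mult_left_mono) auto
    also have "\<dots> = (1 + c) * f (y - 1) + (p * (1 + c)) * (f (y + c) - f (y - 1))"
      by (simp add: algebra_simps)
    finally show ?thesis unfolding p(1) using rec[of "y - 1"] y by (simp add: algebra_simps)
  qed
  have 2: "f (y + c) \<le> f y + c * ln (y + c)"
  proof -
    have "(1 - c * p) * y + (c * p) * (y + c + 1) = y + c * (p * (1 + c))"
      by (simp add: algebra_simps)
    then have "(1 - c * p) * y + (c * p) * (y + c + 1) = y + c" using p(1) by simp
    moreover have "f ((1 - c * p) *\<^sub>R y + (c * p) *\<^sub>R (y + c + 1)) \<le> (1 - c * p) * f y + (c * p) * f (y + c + 1)"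
      by (rule convex_onD[OF conv]) (use y c cp in auto)
    ultimately have "f (y + c) \<le> (1 - c * p) * f y + (c * p) * f (y + c + 1)" by simp
    then have "(1 + c) * f (y + c) \<le> (1 + c) * ((1 - c * p) * f y + (c * p) * f (y + c + 1))"
      using c by (intro mult_left_mono) auto
    also have "\<dots> = (1 + c) * f y + c * (p * (1 + c)) * (f (y + c + 1) - f y)"
      by (simp add: algebra_simps)
    finally show ?thesis unfolding p(1) using rec[of "y + c"] y c by (simp add: algebra_simps)
  qed
  have f: "exp (f (y + c) - f y) = Gamma (y + c) / Gamma y"
    using y c by (simp add: f_def exp_diff Gamma_real_pos)
  show "(y - 1) powr c \<le> Gamma (y + c) / Gamma y"
    using 1 y unfolding f[symmetric] by (simp add: powr_def)
  show "Gamma (y + c) / Gamma y \<le> (y + c) powr c"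
    using 2 y c unfolding f[symmetric] by (simp add: powr_def)
qed

text \<open>The increment \<open>c\<close> varies along the filter because the density parameters
  depend on \<open>s\<close>; the explicit bounds, divided by \<open>Y powr c\<close>, still squeeze
  the ratio.\<close>

lemma Gamma_ratio_tendsto:
  fixes Y c :: "'a \<Rightarrow> real"
  assumes Y: "filterlim Y at_top F" and c: "(c \<longlongrightarrow> c0) F" "eventually (\<lambda>x. c x \<ge> 0) F"
  shows "((\<lambda>x. Gamma (Y x + c x) / Gamma (Y x) / Y x powr c x) \<longlongrightarrow> 1) F"
proof (rule tendsto_sandwich)
  have ev: "eventually (\<lambda>x. Y x > 1) F"
    using Y by (auto simp: filterlim_at_top_dense)
  have inv: "((\<lambda>x. inverse (Y x)) \<longlongrightarrow> 0) F"
    by (rule tendsto_inverse_0_at_top[OF Y])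
  have "((\<lambda>x. (1 - inverse (Y x)) powr c x) \<longlongrightarrow> (1 - 0) powr c0) F"
    by (intro tendsto_intros inv c) auto
  then show "((\<lambda>x. (1 - inverse (Y x)) powr c x) \<longlongrightarrow> 1) F" by simp
  have "((\<lambda>x. (1 + c x * inverse (Y x)) powr c x) \<longlongrightarrow> (1 + c0 * 0) powr c0) F"
    by (intro tendsto_intros inv c) auto
  then show "((\<lambda>x. (1 + c x * inverse (Y x)) powr c x) \<longlongrightarrow> 1) F" by simp
  show "eventually (\<lambda>x. (1 - inverse (Y x)) powr c x \<le> Gamma (Y x + c x) / Gamma (Y x) / Y x powr c x) F"
    using ev c(2)
  proof eventually_elim
    case (elim x)
    have "(1 - inverse (Y x)) powr c x = (Y x - 1) powr c x / Y x powr c x"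
      using elim by (subst powr_divide[symmetric]) (auto simp: field_simps)
    then show ?case
      using divide_right_mono[OF Gamma_ratio_bounds(1)[of "Y x" "c x"], of "Y x powr c x"] elim by simp
  qed
  show "eventually (\<lambda>x. Gamma (Y x + c x) / Gamma (Y x) / Y x powr c x \<le> (1 + c x * inverse (Y x)) powr c x) F"
    using ev c(2)
  proof eventually_elim
    case (elim x)
    have "(1 + c x * inverse (Y x)) powr c x = (Y x + c x) powr c x / Y x powr c x"
      using elim by (subst powr_divide[symmetric]) (auto simp: field_simps)
    then show ?case
      using divide_right_mono[OF Gamma_ratio_bounds(2)[of "Y x" "c x"], of "Y x powr c x"] elim by simp
  qed
qed

text \<open>Squeezed between \<open>- k t / (1 - t)\<close> and \<open>- k t\<close>, both from
  \<open>ln x \<le> x - 1\<close>. It turns \<open>(1 - t) powr k\<close> with convergent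
  \<open>k t\<close> into an exponential.\<close>

lemma mult_ln_one_minus_tendsto:
  fixes t k :: "'a \<Rightarrow> real"
  assumes t: "(t \<longlongrightarrow> 0) F" and kt: "((\<lambda>x. k x * t x) \<longlongrightarrow> A) F" and k: "eventually (\<lambda>x. k x \<ge> 0) F"
  shows "((\<lambda>x. k x * ln (1 - t x)) \<longlongrightarrow> - A) F"
proof (rule tendsto_sandwich)
  have ev: "eventually (\<lambda>x. t x < 1) F"
    using order_tendstoD(2)[OF t, of 1] by simp
  have "((\<lambda>x. - (k x * t x) / (1 - t x)) \<longlongrightarrow> - A / (1 - 0)) F"
    by (intro tendsto_intros t kt) auto
  then show "((\<lambda>x. - (k x * t x) / (1 - t x)) \<longlongrightarrow> - A) F" by simp
  show "((\<lambda>x. - (k x * t x)) \<longlongrightarrow> - A) F" by (intro tendsto_intros kt)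
  show "eventually (\<lambda>x. - (k x * t x) / (1 - t x) \<le> k x * ln (1 - t x)) F"
    using ev k
  proof eventually_elim
    case (elim x)
    have "ln (1 / (1 - t x)) \<le> 1 / (1 - t x) - 1"
      by (rule ln_le_minus_one) (use elim in auto)
    then have "- t x / (1 - t x) \<le> ln (1 - t x)"
      using elim by (simp add: ln_div field_simps)
    then show ?case using mult_left_mono[of _ _ "k x"] elim by fastforce
  qed
  show "eventually (\<lambda>x. k x * ln (1 - t x) \<le> - (k x * t x)) F"
    using ev k
  proof eventually_elim
    case (elim x)
    have "ln (1 - t x) \<le> - t x" using ln_le_minus_one[of "1 - t x"] elim by simp
    then show ?case using mult_left_mono[of _ _ "k x"] elim by fastforce
  qed
qed

text \<open>A Beta variable near 0, magnified by \<open>s^2\<close>, becomes a Gamma variable. The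
  quotient of Gamma functions is of order \<open>Y powr c\<close> with \<open>Y\<close> close to
  \<open>\<delta> s^2\<close>; of the resulting power of \<open>s^2\<close>, the part with exponent
  \<open>g s\<close> rescales \<open>x s\<close> and the part with exponent \<open>D\<close> is
  divided out.\<close>

lemma Beta_density_even_tendsto:
  fixes x g d :: "real \<Rightarrow> real" and a D \<gamma> \<delta> :: real
  assumes x: "eventually (\<lambda>s. 0 < x s \<and> x s < 1) at_top" "((\<lambda>s. s\<^sup>2 * x s) \<longlongrightarrow> a) at_top"
    and g: "(g \<longlongrightarrow> \<gamma>) at_top" and d: "((\<lambda>s. d s / s\<^sup>2) \<longlongrightarrow> \<delta>) at_top"
    and pos: "a > 0" "\<delta> > 0" "\<gamma> + D > 0"
  shows "((\<lambda>s. x s powr g s * (1 - x s) powr d s / Beta (g s + D) (d s + D) / (s\<^sup>2) powr D)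
    \<longlongrightarrow> \<delta> powr (\<gamma> + D) / Gamma (\<gamma> + D) * a powr \<gamma> * exp (- \<delta> * a)) at_top"
proof -
  define Y c where "Y s = d s + D" and "c s = g s + D" for s
  have s2: "filterlim (\<lambda>s::real. s\<^sup>2) at_top at_top"
    by (intro filterlim_pow_at_top filterlim_ident) auto
  have is2: "((\<lambda>s::real. inverse (s\<^sup>2)) \<longlongrightarrow> 0) at_top"
    by (rule tendsto_inverse_0_at_top[OF s2])
  have evs: "eventually (\<lambda>s::real. s > 0) at_top" by (rule eventually_gt_at_top)
  have d_top: "filterlim d at_top at_top"
  proof -
    have "filterlim (\<lambda>s. d s / s\<^sup>2 * s\<^sup>2) at_top at_top"
      by (rule filterlim_tendsto_pos_mult_at_top[OF d pos(2) s2])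
    moreover have "eventually (\<lambda>s. d s / s\<^sup>2 * s\<^sup>2 = d s) at_top"
      using evs by eventually_elim simp
    ultimately show ?thesis using filterlim_cong[OF refl refl, of "\<lambda>s. d s / s\<^sup>2 * s\<^sup>2" d at_top at_top] by simp
  qed
  have Y: "filterlim Y at_top at_top"
    unfolding Y_def using filterlim_tendsto_add_at_top[OF tendsto_const d_top, of D] by (simp add: add.commute)
  have c: "(c \<longlongrightarrow> \<gamma> + D) at_top" unfolding c_def by (intro tendsto_intros g)
  have evc: "eventually (\<lambda>s. c s > 0) at_top" using order_tendstoD(1)[OF c pos(3)] .
  have Ys: "((\<lambda>s. Y s / s\<^sup>2) \<longlongrightarrow> \<delta>) at_top"
  proof -
    have "((\<lambda>s. d s / s\<^sup>2 + D * inverse (s\<^sup>2)) \<longlongrightarrow> \<delta> + D * 0) at_top"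
      by (intro tendsto_intros d is2)
    then show ?thesis by (simp add: Y_def divide_inverse distrib_right)
  qed
  have x0: "(x \<longlongrightarrow> 0) at_top"
  proof -
    have "((\<lambda>s. (s\<^sup>2 * x s) * inverse (s\<^sup>2)) \<longlongrightarrow> a * 0) at_top"
      by (intro tendsto_intros x is2)
    then have "((\<lambda>s. (s\<^sup>2 * x s) * inverse (s\<^sup>2)) \<longlongrightarrow> 0) at_top" by simp
    moreover have "eventually (\<lambda>s. (s\<^sup>2 * x s) * inverse (s\<^sup>2) = x s) at_top"
      using evs by eventually_elim (simp add: field_simps)
    ultimately show ?thesis by (rule Lim_transform_eventually)
  qed
  have "((\<lambda>s. d s / s\<^sup>2 * (s\<^sup>2 * x s)) \<longlongrightarrow> \<delta> * a) at_top"
    by (intro tendsto_mult x d)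
  moreover have "eventually (\<lambda>s. d s / s\<^sup>2 * (s\<^sup>2 * x s) = d s * x s) at_top"
    using evs by eventually_elim simp
  ultimately have dx: "((\<lambda>s. d s * x s) \<longlongrightarrow> \<delta> * a) at_top"
    by (rule Lim_transform_eventually)
  have "eventually (\<lambda>s. d s \<ge> 0) at_top"
    using d_top by (auto simp: filterlim_at_top)
  then have "((\<lambda>s. exp (d s * ln (1 - x s))) \<longlongrightarrow> exp (- (\<delta> * a))) at_top"
    by (intro tendsto_exp mult_ln_one_minus_tendsto x0 dx)
  moreover have "((\<lambda>s. Gamma (Y s + c s) / Gamma (Y s) / Y s powr c s) \<longlongrightarrow> 1) at_top"
    by (rule Gamma_ratio_tendsto[OF Y c]) (use evc in \<open>auto elim: eventually_mono\<close>)
  moreover have "((\<lambda>s. (Y s / s\<^sup>2) powr c s / Gamma (c s)) \<longlongrightarrow> \<delta> powr (\<gamma> + D) / Gamma (\<gamma> + D)) at_top"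
    using pos by (intro tendsto_intros Ys c) (auto elim: nonpos_Ints_cases' simp: Gamma_eq_zero_iff)
  moreover have "((\<lambda>s. (s\<^sup>2 * x s) powr g s) \<longlongrightarrow> a powr \<gamma>) at_top"
    using pos by (intro tendsto_intros x g) auto
  ultimately have "((\<lambda>s. (Y s / s\<^sup>2) powr c s / Gamma (c s) * (s\<^sup>2 * x s) powr g s * exp (d s * ln (1 - x s))
      * (Gamma (Y s + c s) / Gamma (Y s) / Y s powr c s))
     \<longlongrightarrow> \<delta> powr (\<gamma> + D) / Gamma (\<gamma> + D) * a powr \<gamma> * exp (- (\<delta> * a)) * 1) at_top"
    by (intro tendsto_mult)
  moreover have "eventually (\<lambda>s. (Y s / s\<^sup>2) powr c s / Gamma (c s) * (s\<^sup>2 * x s) powr g s * exp (d s * ln (1 - x s))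
      * (Gamma (Y s + c s) / Gamma (Y s) / Y s powr c s)
     = x s powr g s * (1 - x s) powr d s / Beta (g s + D) (d s + D) / (s\<^sup>2) powr D) at_top"
    using evs x(1) evc filterlim_at_top_dense[THEN iffD1, OF Y, rule_format, of 0]
  proof eventually_elim
    case (elim s)
    have "(1 - x s) powr d s = exp (d s * ln (1 - x s))" using elim by (simp add: powr_def)
    moreover have "Beta (g s + D) (d s + D) = Gamma (c s) * Gamma (Y s) / Gamma (Y s + c s)"
      by (simp add: Beta_def c_def Y_def add_ac)
    moreover have "(Y s / s\<^sup>2) powr c s = Y s powr c s / (s\<^sup>2) powr c s"
      using elim by (simp add: powr_divide)
    moreover have "(s\<^sup>2 * x s) powr g s = (s\<^sup>2) powr g s * x s powr g s"
      using elim by (simp add: powr_mult)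
    moreover have "(s\<^sup>2) powr c s = (s\<^sup>2) powr g s * (s\<^sup>2) powr D"
      by (simp add: c_def powr_add)
    moreover have "(s\<^sup>2) powr g s \<noteq> 0" "(s\<^sup>2) powr D \<noteq> 0" "Y s powr c s \<noteq> 0" "Gamma (c s) \<noteq> 0" "Gamma (Y s) \<noteq> 0"
      using elim by (auto simp: Gamma_eq_zero_iff elim: nonpos_Ints_cases')
    ultimately show ?case by (simp add: field_simps)
  qed
  ultimately show ?thesis
    by (simp only: mult_1_right mult_minus_left) (rule Lim_transform_eventually)
qed

text \<open>Evaluates \<open>Gamma (2 z)\<close> in a nearly symmetric Beta function; it is the
  source of \<open>sqrt pi\<close> and of the power of 2 in the Gaussian limit.\<close>

lemma Gamma_duplication_real:
  fixes z :: real
  assumes "z > 0"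
  shows "Gamma (2 * z) = Gamma z * Gamma (z + 1/2) * 2 powr (2 * z - 1) / sqrt pi"
proof -
  have "complex_of_real (Gamma z * Gamma (z + 1/2)) = Gamma (of_real z) * Gamma (of_real z + 1/2)"
    using Gamma_complex_of_real[of z] Gamma_complex_of_real[of "z + 1/2"] by simp
  also have "\<dots> = exp ((1 - 2 * of_real z) * of_real (ln 2)) * of_real (sqrt pi) * Gamma (2 * of_real z)"
  proof (rule Gamma_legendre_duplication)
    show "complex_of_real z \<notin> \<int>\<^sub>\<le>\<^sub>0" using assms by (auto elim!: nonpos_Ints_cases' simp: complex_eq_iff)
    show "complex_of_real z + 1/2 \<notin> \<int>\<^sub>\<le>\<^sub>0" using assms by (auto elim!: nonpos_Ints_cases' simp: complex_eq_iff)
  qed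
  also have "\<dots> = complex_of_real (exp ((1 - 2 * z) * ln 2) * sqrt pi * Gamma (2 * z))"
    using Gamma_complex_of_real[of "2 * z"] by (simp flip: exp_of_real)
  finally have "Gamma z * Gamma (z + 1/2) = exp ((1 - 2 * z) * ln 2) * sqrt pi * Gamma (2 * z)"
    by (simp only: of_real_eq_iff)
  moreover have "2 powr (2 * z - 1) = inverse (exp ((1 - 2 * z) * ln 2))"
    by (simp add: powr_def algebra_simps flip: exp_minus)
  ultimately show ?thesis by (simp add: field_simps)
qed

text \<open>A nearly symmetric Beta variable around 1/2, magnified by \<open>2 s\<close>, becomes
  Gaussian: with \<open>y = 2 x - 1\<close>, and up to a power of 2 and to exponents tending to 0,
  the powers combine to \<open>(1 - y^2) powr (\<delta> s^2)\<close>, while \<open>s y\<close> tends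
  to \<open>b\<close>.\<close>

lemma Beta_density_odd_tendsto:
  fixes x g h :: "real \<Rightarrow> real" and b D \<delta> :: real
  assumes x: "eventually (\<lambda>s. 0 < x s \<and> x s < 1) at_top" "((\<lambda>s. s * (2 * x s - 1)) \<longlongrightarrow> b) at_top"
    and g: "((\<lambda>s. g s - \<delta> * s\<^sup>2) \<longlongrightarrow> 0) at_top" and h: "((\<lambda>s. h s - \<delta> * s\<^sup>2) \<longlongrightarrow> 0) at_top"
    and \<delta>: "\<delta> > 0"
  shows "((\<lambda>s. x s powr g s * (1 - x s) powr h s / Beta (g s + D + 1) (h s + D + 1) / (2 powr (2 * D + 1) * s))
    \<longlongrightarrow> sqrt (\<delta> / pi) * exp (- \<delta> * b\<^sup>2)) at_top"
proof -
  define X Y where "X s = g s + D + 1" and "Y s = h s + D + 1" for s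
  \<comment> \<open>The Beta parameters differ by \<open>o(1)\<close>. With their mean
    \<open>z\<close> and half their distance \<open>\<eta>\<close>, the product
    \<open>Gamma (z - \<eta>) * Gamma (z + \<eta>)\<close> can be compared with the square of
    \<open>Gamma z\<close>; the absolute value makes \<open>\<eta>\<close> an admissible increment
    in \<open>Gamma_ratio_tendsto\<close>.\<close>
  define z \<eta> where "z s = (X s + Y s) / 2" and "\<eta> s = \<bar>X s - Y s\<bar> / 2" for s
  define y where "y s = 2 * x s - 1" for s
  have s2: "filterlim (\<lambda>s::real. s\<^sup>2) at_top at_top"
    by (intro filterlim_pow_at_top filterlim_ident) auto
  have is2: "((\<lambda>s::real. inverse (s\<^sup>2)) \<longlongrightarrow> 0) at_top"
    by (rule tendsto_inverse_0_at_top[OF s2])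
  have is1: "((\<lambda>s::real. inverse s) \<longlongrightarrow> 0) at_top"
    by (rule tendsto_inverse_0_at_top[OF filterlim_ident])
  have evs: "eventually (\<lambda>s::real. s > 0) at_top" by (rule eventually_gt_at_top)
  have ds_top: "filterlim (\<lambda>s. \<delta> * s\<^sup>2) at_top at_top"
    by (rule filterlim_tendsto_pos_mult_at_top[OF tendsto_const \<delta> s2])
  have eta0: "(\<eta> \<longlongrightarrow> 0) at_top"
  proof -
    have "((\<lambda>s. \<bar>(g s - \<delta> * s\<^sup>2) - (h s - \<delta> * s\<^sup>2)\<bar> / 2) \<longlongrightarrow> \<bar>0 - 0\<bar> / 2) at_top"
      by (intro tendsto_intros g h) auto
    then show ?thesis by (simp add: \<eta>_def[abs_def] X_def Y_def)
  qed
  define e where "e s = ((g s - \<delta> * s\<^sup>2) + (h s - \<delta> * s\<^sup>2)) / 2 + D + 1" for s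
  have e: "(e \<longlongrightarrow> (0 + 0) / 2 + D + 1) at_top"
    unfolding e_def by (intro tendsto_intros g h) auto
  have z_eq: "z s = e s + \<delta> * s\<^sup>2" for s
    by (simp add: z_def e_def X_def Y_def field_simps)
  have z_top: "filterlim z at_top at_top"
    unfolding z_eq[abs_def] by (rule filterlim_tendsto_add_at_top[OF e ds_top])
  have lo_top: "filterlim (\<lambda>s. z s - \<eta> s) at_top at_top"
    using filterlim_tendsto_add_at_top[OF tendsto_minus[OF eta0] z_top] by simp
  have zs: "((\<lambda>s. z s / s\<^sup>2) \<longlongrightarrow> \<delta>) at_top"
  proof -
    have "((\<lambda>s. e s * inverse (s\<^sup>2) + \<delta>) \<longlongrightarrow> ((0 + 0) / 2 + D + 1) * 0 + \<delta>) at_top"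
      by (intro tendsto_intros e is2)
    then have "((\<lambda>s. e s * inverse (s\<^sup>2) + \<delta>) \<longlongrightarrow> \<delta>) at_top" by simp
    moreover have "eventually (\<lambda>s. e s * inverse (s\<^sup>2) + \<delta> = z s / s\<^sup>2) at_top"
      using evs by eventually_elim (simp add: z_eq field_simps)
    ultimately show ?thesis by (rule Lim_transform_eventually)
  qed
  have y0: "(y \<longlongrightarrow> 0) at_top"
  proof -
    have "((\<lambda>s. (s * y s) * inverse s) \<longlongrightarrow> b * 0) at_top"
      unfolding y_def by (intro tendsto_intros x is1)
    then have "((\<lambda>s. (s * y s) * inverse s) \<longlongrightarrow> 0) at_top" by simp
    moreover have "eventually (\<lambda>s. (s * y s) * inverse s = y s) at_top"
      using evs by eventually_elim (simp add: field_simps)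
    ultimately show ?thesis by (rule Lim_transform_eventually)
  qed
  have y2: "((\<lambda>s. (y s)\<^sup>2) \<longlongrightarrow> 0) at_top"
    using tendsto_power[OF y0, of 2] by simp
  have "((\<lambda>s. (s * y s)\<^sup>2) \<longlongrightarrow> b\<^sup>2) at_top"
    unfolding y_def by (intro tendsto_intros x)
  then have sy2: "((\<lambda>s. s\<^sup>2 * (y s)\<^sup>2) \<longlongrightarrow> b\<^sup>2) at_top" by (simp add: power_mult_distrib)
  have "((\<lambda>s. s\<^sup>2 * ln (1 - (y s)\<^sup>2)) \<longlongrightarrow> - b\<^sup>2) at_top"
    by (rule mult_ln_one_minus_tendsto[OF y2 sy2]) simp
  then have "((\<lambda>s. exp ((g s - \<delta> * s\<^sup>2) * ln (1 + y s) + (h s - \<delta> * s\<^sup>2) * ln (1 - y s)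
      + \<delta> * (s\<^sup>2 * ln (1 - (y s)\<^sup>2)))) \<longlongrightarrow> exp (0 * ln (1 + 0) + 0 * ln (1 - 0) + \<delta> * - b\<^sup>2)) at_top"
    by (intro tendsto_intros g h y0) auto
  then have lim1: "((\<lambda>s. exp ((g s - \<delta> * s\<^sup>2) * ln (1 + y s) + (h s - \<delta> * s\<^sup>2) * ln (1 - y s)
      + \<delta> * (s\<^sup>2 * ln (1 - (y s)\<^sup>2)))) \<longlongrightarrow> exp (- \<delta> * b\<^sup>2)) at_top" by simp
  have lim2: "((\<lambda>s. Gamma (z s - \<eta> s + \<eta> s) / Gamma (z s - \<eta> s) / (z s - \<eta> s) powr \<eta> s) \<longlongrightarrow> 1) at_top"
    by (rule Gamma_ratio_tendsto[OF lo_top eta0]) (simp add: \<eta>_def)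
  have lim3: "((\<lambda>s. Gamma (z s + \<eta> s) / Gamma (z s) / z s powr \<eta> s) \<longlongrightarrow> 1) at_top"
    by (rule Gamma_ratio_tendsto[OF z_top eta0]) (simp add: \<eta>_def)
  have lim4: "((\<lambda>s. Gamma (z s + 1/2) / Gamma (z s) / z s powr (1/2)) \<longlongrightarrow> 1) at_top"
    by (rule Gamma_ratio_tendsto[OF z_top tendsto_const]) simp
  have "((\<lambda>s. (1 - \<eta> s * inverse (z s)) powr \<eta> s) \<longlongrightarrow> (1 - 0 * 0) powr 0) at_top"
    by (intro tendsto_intros eta0 tendsto_inverse_0_at_top[OF z_top]) auto
  then have lim5: "((\<lambda>s. (1 - \<eta> s * inverse (z s)) powr \<eta> s) \<longlongrightarrow> 1) at_top" by simp
  have lim6: "((\<lambda>s. sqrt (z s / s\<^sup>2 / pi)) \<longlongrightarrow> sqrt (\<delta> / pi)) at_top"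
    by (intro tendsto_intros zs) auto
  \<comment> \<open>The density as a product of factors with known limits. The power of
    \<open>1 - \<eta> s * inverse (z s)\<close> corrects the bases, because the two Gamma ratios
    with increment \<open>\<eta>\<close> are normalised by powers of \<open>z - \<eta>\<close> and
    of \<open>z\<close>.\<close>
  define R where "R s = sqrt (z s / s\<^sup>2 / pi)
      * exp ((g s - \<delta> * s\<^sup>2) * ln (1 + y s) + (h s - \<delta> * s\<^sup>2) * ln (1 - y s) + \<delta> * (s\<^sup>2 * ln (1 - (y s)\<^sup>2)))
      * ((Gamma (z s - \<eta> s + \<eta> s) / Gamma (z s - \<eta> s) / (z s - \<eta> s) powr \<eta> s)
         / (Gamma (z s + \<eta> s) / Gamma (z s) / z s powr \<eta> s) * (1 - \<eta> s * inverse (z s)) powr \<eta> s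
         * (Gamma (z s + 1/2) / Gamma (z s) / z s powr (1/2)))" for s
  have "(R \<longlongrightarrow> sqrt (\<delta> / pi) * exp (- \<delta> * b\<^sup>2) * (1 / 1 * 1 * 1)) at_top"
    unfolding R_def by (intro tendsto_mult tendsto_divide lim1 lim2 lim3 lim4 lim5 lim6) auto
  then have R: "(R \<longlongrightarrow> sqrt (\<delta> / pi) * exp (- \<delta> * b\<^sup>2)) at_top" by simp
  have "eventually (\<lambda>s. R s = x s powr g s * (1 - x s) powr h s / Beta (g s + D + 1) (h s + D + 1)
      / (2 powr (2 * D + 1) * s)) at_top"
    using evs x(1) filterlim_at_top_dense[THEN iffD1, OF lo_top, rule_format, of 0]
  proof eventually_elim
    case (elim s)
    have eta_nn: "\<eta> s \<ge> 0" by (simp add: \<eta>_def)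
    then have z: "z s > 0" using elim by linarith
    define lo hi where "lo = z s - \<eta> s" and "hi = z s + \<eta> s"
    have lohi: "lo > 0" "hi > 0" using elim eta_nn by (simp_all add: lo_def hi_def)
    have XY: "Gamma (X s) * Gamma (Y s) = Gamma lo * Gamma hi"
      by (cases "X s \<le> Y s") (simp_all add: lo_def hi_def z_def \<eta>_def field_simps)
    have nz: "Gamma lo \<noteq> 0" "Gamma hi \<noteq> 0" "Gamma (z s) \<noteq> 0" "lo powr \<eta> s \<noteq> 0" "z s powr \<eta> s \<noteq> 0"
      using lohi z by (auto simp: Gamma_eq_zero_iff elim: nonpos_Ints_cases')
    have "1 - \<eta> s * inverse (z s) = lo / z s" using z by (simp add: lo_def field_simps)
    then have p1: "(1 - \<eta> s * inverse (z s)) powr \<eta> s = lo powr \<eta> s / z s powr \<eta> s"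
      using lohi z by (simp add: powr_divide)
    have "exp ((g s - \<delta> * s\<^sup>2) * ln (1 + y s) + (h s - \<delta> * s\<^sup>2) * ln (1 - y s) + \<delta> * (s\<^sup>2 * ln (1 - (y s)\<^sup>2)))
        = exp (g s * ln (1 + y s) + h s * ln (1 - y s))"
    proof -
      have "1 - (y s)\<^sup>2 = (1 + y s) * (1 - y s)" by (simp add: power2_eq_square algebra_simps)
      moreover have "1 + y s > 0" "1 - y s > 0" using elim by (auto simp: y_def)
      ultimately have "ln (1 - (y s)\<^sup>2) = ln (1 + y s) + ln (1 - y s)" by (simp add: ln_mult)
      then show ?thesis by (simp add: algebra_simps)
    qed
    also have "\<dots> = (2 * x s) powr g s * (2 * (1 - x s)) powr h s"
      using elim by (simp add: powr_def exp_add y_def)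
    also have "\<dots> = 2 powr (g s + h s) * x s powr g s * (1 - x s) powr h s"
      using elim powr_mult[of 2 "x s" "g s"] powr_mult[of 2 "1 - x s" "h s"]
      by (simp only: powr_add) simp
    finally have p2: "exp ((g s - \<delta> * s\<^sup>2) * ln (1 + y s) + (h s - \<delta> * s\<^sup>2) * ln (1 - y s) + \<delta> * (s\<^sup>2 * ln (1 - (y s)\<^sup>2)))
        = 2 powr (g s + h s) * x s powr g s * (1 - x s) powr h s" .
    have "X s + Y s = 2 * z s" by (simp add: z_def)
    then have "Beta (g s + D + 1) (h s + D + 1) = Gamma lo * Gamma hi / Gamma (2 * z s)"
      using XY by (simp add: Beta_def X_def Y_def)
    also have "\<dots> = Gamma lo * Gamma hi * sqrt pi / (Gamma (z s) * Gamma (z s + 1/2) * 2 powr (2 * z s - 1))"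
      unfolding Gamma_duplication_real[OF z] by simp
    finally have p3: "Beta (g s + D + 1) (h s + D + 1)
        = Gamma lo * Gamma hi * sqrt pi / (Gamma (z s) * Gamma (z s + 1/2) * 2 powr (2 * z s - 1))" .
    have "2 * z s - 1 = g s + h s + (2 * D + 1)" by (simp add: z_def X_def Y_def)
    then have p4: "2 powr (2 * z s - 1) = 2 powr (g s + h s) * 2 powr (2 * D + 1)"
      by (simp only: powr_add)
    have p5: "sqrt (z s / s\<^sup>2 / pi) = z s powr (1/2) / s / sqrt pi"
      using elim z by (simp add: real_sqrt_divide real_sqrt_mult powr_half_sqrt)
    show ?case
      unfolding R_def p1 p2 p3 p4 p5 lo_def[symmetric] hi_def[symmetric]
      using nz elim z by (simp add: lo_def field_simps)
  qed
  then show ?thesis using R by (rule Lim_transform_eventually[rotated])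
qed

section \<open>Canonical moments and the normalizing constant\<close>

text \<open>On vectors extensional on \<open>{1..N}\<close> a component outside the index set is the
  constant \<open>undefined\<close>; so quantities of every index are measurable for every
  \<open>N\<close>.\<close>

lemma coord_measurable_lebesgue_space [measurable]:
  "(\<lambda>m. m k :: real) \<in> borel_measurable (lebesgue_space N)"
proof (cases "k \<in> {1..N}")
  case True
  then show ?thesis using measurable_component_singleton[of k "{1..N}" "\<lambda>_. lborel"] by simp
next
  case False
  have "(\<lambda>m. m k) \<in> borel_measurable (lebesgue_space N) \<longleftrightarrow>
      (\<lambda>m. undefined :: real) \<in> borel_measurable (lebesgue_space N)"
    by (rule measurable_cong) (use False in \<open>auto simp: space_PiM PiE_def extensional_def\<close>)
  then show ?thesis by simp
qed

lemma riesz_measurable: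
  assumes "\<And>i. (\<lambda>m. coeff (p m) i) \<in> borel_measurable (lebesgue_space N)" "\<And>m. degree (p m) \<le> d"
  shows "(\<lambda>m. riesz m (p m)) \<in> borel_measurable (lebesgue_space N)"
proof -
  note [measurable] = assms(1)
  show ?thesis unfolding riesz_altdef[OF assms(2)] by measurable
qed

lemma coeff_mult_measurable:
  fixes p q :: "'a \<Rightarrow> real poly"
  assumes [measurable]: "\<And>i. (\<lambda>m. coeff (p m) i) \<in> borel_measurable M"
    "\<And>i. (\<lambda>m. coeff (q m) i) \<in> borel_measurable M"
  shows "(\<lambda>m. coeff (p m * q m) i) \<in> borel_measurable M"
  unfolding coeff_mult by measurable

lemma degree_mult_orth_le: "degree (u * orth m v i * orth m v j) \<le> degree u + i + j"
  by (intro order.trans[OF degree_mult_le] add_mono) auto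

lemma degree_mult_monom_orth_le: "degree (u * monom 1 i * orth m v j) \<le> degree u + i + j"
  by (intro order.trans[OF degree_mult_le] add_mono) (auto intro: degree_monom_le)

lemma coeff_orth_measurable:
  "(\<lambda>m. coeff (orth m v e) i) \<in> borel_measurable (lebesgue_space N)"
proof (induction e arbitrary: i rule: less_induct)
  case (less e)
  have [measurable]: "(\<lambda>m. coeff (orth m v j) i) \<in> borel_measurable (lebesgue_space N)" if "j < e" for j i
    by (rule less[OF that])
  have [measurable]: "(\<lambda>m. rinner m v (monom 1 e) (orth m v j)) \<in> borel_measurable (lebesgue_space N)"
    if "j < e" for j
    unfolding rinner_def
    by (rule riesz_measurable[OF _ degree_mult_monom_orth_le])
      (intro coeff_mult_measurable less that, simp_all)
  have [measurable]: "(\<lambda>m. rinner m v (orth m v j) (orth m v j)) \<in> borel_measurable (lebesgue_space N)"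
    if "j < e" for j
    unfolding rinner_def
    by (rule riesz_measurable[OF _ degree_mult_orth_le])
      (intro coeff_mult_measurable less that, simp_all)
  show ?case
    unfolding orth.simps[of _ v e] coeff_diff coeff_sum coeff_smult by measurable
qed

lemma rinner_orth_measurable [measurable]:
  "(\<lambda>m. rinner m u (orth m v e) (orth m v e)) \<in> borel_measurable (lebesgue_space N)"
  unfolding rinner_def
  by (rule riesz_measurable[OF _ degree_mult_orth_le])
    (intro coeff_mult_measurable coeff_orth_measurable, simp)

lemma orth_norm_measurable [measurable]: "(\<lambda>m. orth_norm m v e) \<in> borel_measurable (lebesgue_space N)"
  unfolding orth_norm_def by measurable

lemma gap_measurable [measurable]:
  "lgap s k \<in> borel_measurable (lebesgue_space N)" "ugap s k \<in> borel_measurable (lebesgue_space N)"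
  unfolding lgap_def[abs_def] ugap_def[abs_def] by measurable

text \<open>The weight \<open>u\<close> of the integral and the weight \<open>v\<close> of the
  orthogonal polynomial are kept apart, since \<open>b\<close> integrates \<open>x P^2\<close> with
  \<open>P\<close> orthogonal for weight 1. The bound \<open>2 * e + degree v \<le> k\<close> keeps
  the polynomial itself independent of \<open>m k\<close>.\<close>

lemma rinner_orth_change_top:
  assumes "k \<ge> 1" "\<And>i. i \<in> {1..<k} \<Longrightarrow> m' i = m i" "2 * e + degree v \<le> k" "degree u + 2 * e = k" "u \<noteq> 0"
  shows "rinner m' u (orth m' v e) (orth m' v e)
    = rinner m u (orth m v e) (orth m v e) + lead_coeff u * (m' k - m k)"
proof -
  let ?f = "u * orth m v e * orth m v e"
  have T: "orth m' v e = orth m v e"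
    by (rule orth_cong) (use assms(2,3) in auto)
  have deg: "degree ?f = k" using assms(4,5) by (simp add: degree_mult_eq)
  have "lead_coeff ?f = lead_coeff u" by (simp add: lead_coeff_mult)
  then have "coeff ?f k = lead_coeff u" by (simp only: deg)
  moreover have "riesz m' ?f = riesz m ?f + coeff ?f k * (m' k - m k)"
    by (rule riesz_change_top) (use assms deg in auto)
  ultimately show ?thesis by (simp add: T rinner_def)
qed

lemma lgap_change_top:
  assumes "k \<ge> 1" "\<And>i. i \<in> {1..<k} \<Longrightarrow> m' i = m i"
  shows "lgap s k m' = lgap s k m + (m' k - m k)"
  using rinner_orth_change_top[OF assms, where e = "k div 2" and u = "lower_weight s k" and v = "lower_weight s k"]
    lower_weight_props[where s = s and k = k] weights_nonzero assms(1)
  by (simp add: lgap_def orth_norm_def)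

lemma ugap_change_top:
  assumes "k \<ge> 1" "\<And>i. i \<in> {1..<k} \<Longrightarrow> m' i = m i"
  shows "ugap s k m' = ugap s k m - (m' k - m k)"
  using rinner_orth_change_top[OF assms, where e = "(k - 1) div 2" and u = "upper_weight s k" and v = "upper_weight s k"]
    upper_weight_props[where s = s and k = k] weights_nonzero assms(1)
  by (simp add: ugap_def orth_norm_def)

definition range_width :: "real \<Rightarrow> nat \<Rightarrow> (nat \<Rightarrow> real) \<Rightarrow> real" where
  "range_width s k m = lgap s k m + ugap s k m"

definition canonical_moment :: "real \<Rightarrow> nat \<Rightarrow> (nat \<Rightarrow> real) \<Rightarrow> real" where
  "canonical_moment s k m = lgap s k m / range_width s k m"

lemma range_width_1: "range_width s 1 m = 2 * s"
  using gap_sum_1 by (simp add: range_width_def)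

lemma range_width_Suc:
  assumes "wpos m s k" "k \<ge> 1"
  shows "range_width s (Suc k) m =
    2 * s * canonical_moment s k m * (1 - canonical_moment s k m) * range_width s k m"
proof -
  have "lgap s k m > 0" "ugap s k m > 0" using wpos_step[OF assms(2)] assms(1) by auto
  then have "range_width s k m \<noteq> 0" by (simp add: range_width_def)
  moreover have "1 - canonical_moment s k m = ugap s k m / range_width s k m"
    using calculation by (simp add: canonical_moment_def range_width_def field_simps)
  ultimately show ?thesis
    unfolding range_width_def[of s "Suc k"] gap_recursion[OF assms]
    by (simp add: canonical_moment_def flip: range_width_def)
qed

lemma range_width_pos:
  assumes "s > 0" "wpos m s k"
  shows "range_width s (Suc k) m > 0"
  using assms(2)
proof (induction k)
  case 0
  then show ?case using range_width_1[of s m] assms(1) by simp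
next
  case (Suc k)
  have gaps: "lgap s (Suc k) m > 0" "ugap s (Suc k) m > 0"
    using wpos_step[of "Suc k"] Suc.prems by auto
  then have "range_width s (Suc (Suc k)) m
      = 2 * s * lgap s (Suc k) m * ugap s (Suc k) m / (lgap s (Suc k) m + ugap s (Suc k) m)"
    using gap_recursion[OF Suc.prems] by (simp add: range_width_def)
  also have "\<dots> > 0" using gaps assms(1) by simp
  finally show ?case .
qed

lemma canonical_moment_in_iff:
  assumes "s > 0" "wpos m s (k - 1)" "k \<ge> 1"
  shows "canonical_moment s k m \<in> {0<..<1} \<longleftrightarrow> lgap s k m > 0 \<and> ugap s k m > 0"
proof -
  have "range_width s k m > 0" using range_width_pos[OF assms(1,2)] assms(3) by simp
  then show ?thesis
    by (auto simp: canonical_moment_def field_simps range_width_def zero_less_divide_iff)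
qed

lemma wpos_iff_canonical_moments:
  assumes "s > 0"
  shows "wpos m s K \<longleftrightarrow> (\<forall>k\<in>{1..K}. canonical_moment s k m \<in> {0<..<1})"
proof (induction K)
  case (Suc K)
  have "{1..Suc K} = insert (Suc K) {1..K}" by auto
  then show ?case
    using Suc wpos_step[of "Suc K" m s] canonical_moment_in_iff[OF assms, of m "Suc K"] by auto
qed (simp add: wpos_0)

lemma triangular_canonical:
  assumes s: "s > 0"
  shows "triangular (\<lambda>k m. m k - lgap s k m) (range_width s) (2 * s)
    (\<lambda>_ t. 2 * s * t * (1 - t)) (\<lambda>_. {0<..<1})"
proof
  fix k :: nat and m m' :: "nat \<Rightarrow> real"
  assume k: "k \<ge> 1" and eq: "\<And>i. i \<in> {1..<k} \<Longrightarrow> m i = m' i"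
  show "m k - lgap s k m = m' k - lgap s k m'"
    using lgap_change_top[OF k eq, where s = s] by simp
  show "range_width s k m = range_width s k m'"
    using lgap_change_top[OF k eq, where s = s] ugap_change_top[OF k eq, where s = s] by (simp add: range_width_def)
next
  fix k N
  show "(\<lambda>m. m k - lgap s k m) \<in> borel_measurable (lebesgue_space N)" by measurable
  show "range_width s k \<in> borel_measurable (lebesgue_space N)"
    unfolding range_width_def[abs_def] by measurable
next
  fix k :: nat and m :: "nat \<Rightarrow> real"
  assume k: "k \<ge> 1" and S: "\<And>j. j \<in> {1..k} \<Longrightarrow> (m j - (m j - lgap s j m)) / range_width s j m \<in> {0<..<1}"
  have "wpos m s k"
    unfolding wpos_iff_canonical_moments[OF s] using S by (simp add: canonical_moment_def)
  then show "range_width s (Suc k) m = 2 * s * ((m k - (m k - lgap s k m)) / range_width s k m) *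
      (1 - (m k - (m k - lgap s k m)) / range_width s k m) * range_width s k m"
    using range_width_Suc[OF _ k] by (simp add: canonical_moment_def)
qed (use s range_width_1 in auto)

lemma nn_integral_canonical:
  assumes "s > 0" "\<And>k. \<phi> k \<in> borel_measurable borel" "\<And>k t. k \<ge> 1 \<Longrightarrow> t \<notin> {0<..<1} \<Longrightarrow> \<phi> k t = (0 :: ennreal)"
  shows "(\<integral>\<^sup>+m. (\<Prod>k\<in>{1..N}. \<phi> k (canonical_moment s k m)) \<partial>lebesgue_space N)
    = (\<Prod>k\<in>{1..N}. ennreal (2 * s) * (\<integral>\<^sup>+t. \<phi> k t * ennreal (2 * s * t * (1 - t)) ^ (N - k) \<partial>lborel))"
proof -
  interpret triangular "\<lambda>k m. m k - lgap s k m" "range_width s" "2 * s"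
    "\<lambda>_ t. 2 * s * t * (1 - t)" "\<lambda>_. {0<..<1}"
    by (rule triangular_canonical[OF assms(1)])
  have "coord k m = canonical_moment s k m" for k m
    by (simp add: coord_def canonical_moment_def)
  then show ?thesis using nn_integral_prod[OF assms(2,3), where N = N] by simp
qed

lemma canonical_moment_measurable [measurable]:
  "canonical_moment s k \<in> borel_measurable (lebesgue_space N)"
  unfolding canonical_moment_def[abs_def] range_width_def[abs_def] by measurable

definition beta_factor :: "real \<Rightarrow> real \<Rightarrow> real \<Rightarrow> real" where
  "beta_factor a b t = t powr a * (1 - t) powr b * indicator {0<..<1} t"

lemma beta_factor_measurable [measurable]: "beta_factor a b \<in> borel_measurable borel"
  unfolding beta_factor_def[abs_def] by measurable

lemma beta_factor_nonneg: "beta_factor a b t \<ge> 0"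
  by (simp add: beta_factor_def)

lemma nn_integral_beta_factor:
  assumes "a > -1" "b > -1" "c > 0"
  shows "(\<integral>\<^sup>+t. ennreal (beta_factor a b t) * ennreal (c * t * (1 - t)) ^ j \<partial>lborel)
    = ennreal (c ^ j * Beta (a + real j + 1) (b + real j + 1))"
proof -
  let ?f = "\<lambda>t. t powr (a + real j + 1 - 1) * (1 - t) powr (b + real j + 1 - 1)"
  have "(?f has_integral Beta (a + real j + 1) (b + real j + 1)) {0<..<1}"
    using has_integral_Beta_real[of "a + real j + 1" "b + real j + 1"] assms
    by (simp only: has_integral_Icc_iff_Ioo)
  then have "((\<lambda>t. c ^ j * ?f t) has_integral (c ^ j * Beta (a + real j + 1) (b + real j + 1))) {0<..<1}"
    by (rule has_integral_mult_right)
  then have "(\<integral>\<^sup>+t. ennreal (indicator {0<..<1} t * (c ^ j * ?f t)) \<partial>lborel)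
      = ennreal (c ^ j * Beta (a + real j + 1) (b + real j + 1))"
    by (rule nn_integral_has_integral_lebesgue[rotated]) (use assms(3) in auto)
  moreover have "ennreal (beta_factor a b t) * ennreal (c * t * (1 - t)) ^ j
      = ennreal (indicator {0<..<1} t * (c ^ j * ?f t))" for t
  proof (cases "t \<in> {0<..<1}")
    case True
    then have "ennreal (c * t * (1 - t)) ^ j = ennreal ((c * t * (1 - t)) ^ j)"
      using assms(3) by (intro ennreal_power) auto
    moreover have "(c * t * (1 - t)) ^ j = c ^ j * t powr real j * (1 - t) powr real j"
      using True by (simp add: powr_realpow power_mult_distrib)
    ultimately show ?thesis
      using True assms(3) by (simp add: beta_factor_def powr_add mult_ac flip: ennreal_mult'')
  qed (simp add: beta_factor_def)
  ultimately show ?thesis by simp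
qed

text \<open>At the first index whose canonical moment leaves \<open>(0,1)\<close> the earlier
  moments are still interior, so \<open>mom_lower\<close> and \<open>mom_upper\<close> have their
  meaning there, and both products contain a zero factor at this index.\<close>

lemma unnorm_dens_eq:
  assumes s: "s > 0"
  shows "unnorm_dens N s \<gamma> \<delta> m = (\<Prod>k=1..N. beta_factor (\<gamma> k) (\<delta> k) (canonical_moment s k m))"
proof -
  let ?u = "\<lambda>k. ((m k - mom_lower s k m) / (mom_upper s k m - mom_lower s k m)) powr \<gamma> k
      * ((mom_upper s k m - m k) / (mom_upper s k m - mom_lower s k m)) powr \<delta> k
      * indicator {mom_lower s k m <..< mom_upper s k m} (m k)"
  have factor: "?u k = beta_factor (\<gamma> k) (\<delta> k) (canonical_moment s k m)"
    if k: "k \<ge> 1" and wp: "wpos m s (k - 1)" for k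
  proof -
    have W: "range_width s k m > 0" using range_width_pos[OF s wp] k by simp
    have 1: "mom_upper s k m - mom_lower s k m = range_width s k m"
      "m k - mom_lower s k m = lgap s k m" "mom_upper s k m - m k = ugap s k m"
      by (simp_all add: mom_lower_eq[OF s k wp] mom_upper_eq[OF s k wp] range_width_def)
    have 2: "1 - canonical_moment s k m = ugap s k m / range_width s k m"
      using W by (simp add: canonical_moment_def range_width_def field_simps)
    have 3: "m k \<in> {mom_lower s k m <..< mom_upper s k m} \<longleftrightarrow> canonical_moment s k m \<in> {0<..<1}"
      using canonical_moment_in_iff[OF s wp k] 1 by auto
    show ?thesis
      using 3 unfolding beta_factor_def 1 2 by (simp add: canonical_moment_def indicator_def)
  qed
  show ?thesis
  proof (cases "wpos m s N")
    case True
    show ?thesis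
      unfolding unnorm_dens_def
      by (rule prod.cong) (use True wpos_mono[OF True] in \<open>auto intro!: factor\<close>)
  next
    case False
    then have "\<exists>k. k \<in> {1..N} \<and> canonical_moment s k m \<notin> {0<..<1}"
      unfolding wpos_iff_canonical_moments[OF s] by blast
    from exists_least_iff[THEN iffD1, OF this] obtain k where
      k: "k \<in> {1..N}" "canonical_moment s k m \<notin> {0<..<1}"
      "\<And>j. j < k \<Longrightarrow> j \<in> {1..N} \<Longrightarrow> canonical_moment s j m \<in> {0<..<1}" by blast
    have "wpos m s (k - 1)"
      unfolding wpos_iff_canonical_moments[OF s] using k(1,3) by auto
    then have "?u k = beta_factor (\<gamma> k) (\<delta> k) (canonical_moment s k m)"
      using k(1) by (intro factor) auto
    moreover have "beta_factor (\<gamma> k) (\<delta> k) (canonical_moment s k m) = 0"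
      using k(2) by (simp add: beta_factor_def)
    ultimately have "?u k = 0" by simp
    then have "(\<Prod>k\<in>{1..N}. ?u k) = 0"
      using k(1) by (intro prod_zero) auto
    moreover have "(\<Prod>k\<in>{1..N}. beta_factor (\<gamma> k) (\<delta> k) (canonical_moment s k m)) = 0"
      using k(1) \<open>beta_factor (\<gamma> k) (\<delta> k) (canonical_moment s k m) = 0\<close> by (intro prod_zero) auto
    ultimately show ?thesis unfolding unnorm_dens_def by (simp only:)
  qed
qed

text \<open>The power of \<open>2 * s\<close> at index \<open>k\<close> has one factor from the
  initial width and \<open>N - k\<close> from the Jacobian factors \<open>2 s t (1 - t)\<close> of
  the later variables, which also raise both Beta parameters by \<open>N - k\<close>.\<close>

lemma integral_unnorm_dens:
  assumes s: "s > 0" and pos: "\<And>k. k \<in> {1..N} \<Longrightarrow> \<gamma> k > -1 \<and> \<delta> k > -1"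
  shows "(\<integral>m. unnorm_dens N s \<gamma> \<delta> m \<partial>lebesgue_space N)
    = (\<Prod>k=1..N. (2 * s) ^ (N - k + 1) * Beta (\<gamma> k + real (N - k) + 1) (\<delta> k + real (N - k) + 1))"
    (is "_ = ?R")
proof -
  let ?u = "\<lambda>m. \<Prod>k=1..N. beta_factor (\<gamma> k) (\<delta> k) (canonical_moment s k m)"
  have Beta_nn: "Beta (\<gamma> k + real (N - k) + 1) (\<delta> k + real (N - k) + 1) \<ge> 0" if "k \<in> {1..N}" for k
    using pos[OF that] by (auto simp: Beta_def intro!: divide_nonneg_nonneg mult_nonneg_nonneg less_imp_le[OF Gamma_real_pos])
  have "(\<integral>\<^sup>+m. ennreal (?u m) \<partial>lebesgue_space N)
      = (\<integral>\<^sup>+m. (\<Prod>k\<in>{1..N}. ennreal (beta_factor (\<gamma> k) (\<delta> k) (canonical_moment s k m))) \<partial>lebesgue_space N)"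
    by (simp add: prod_ennreal beta_factor_nonneg)
  also have "\<dots> = (\<Prod>k\<in>{1..N}. ennreal (2 * s) *
      (\<integral>\<^sup>+t. ennreal (beta_factor (\<gamma> k) (\<delta> k) t) * ennreal (2 * s * t * (1 - t)) ^ (N - k) \<partial>lborel))"
    by (rule nn_integral_canonical[OF s]) (auto simp: beta_factor_def)
  also have "\<dots> = (\<Prod>k\<in>{1..N}. ennreal ((2 * s) ^ (N - k + 1) *
      Beta (\<gamma> k + real (N - k) + 1) (\<delta> k + real (N - k) + 1)))"
  proof (rule prod.cong)
    fix k assume k: "k \<in> {1..N}"
    show "ennreal (2 * s) *
        (\<integral>\<^sup>+t. ennreal (beta_factor (\<gamma> k) (\<delta> k) t) * ennreal (2 * s * t * (1 - t)) ^ (N - k) \<partial>lborel)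
      = ennreal ((2 * s) ^ (N - k + 1) * Beta (\<gamma> k + real (N - k) + 1) (\<delta> k + real (N - k) + 1))"
      using pos[OF k] s by (subst nn_integral_beta_factor) (auto simp: mult.assoc simp flip: ennreal_mult')
  qed simp
  also have "\<dots> = ennreal ?R"
    by (rule prod_ennreal) (use Beta_nn s in auto)
  finally have nn: "(\<integral>\<^sup>+m. ennreal (?u m) \<partial>lebesgue_space N) = ennreal ?R" .
  have "(\<integral>m. ?u m \<partial>lebesgue_space N) = enn2real (\<integral>\<^sup>+m. ennreal (?u m) \<partial>lebesgue_space N)"
  proof (rule integral_eq_nn_integral)
    show "?u \<in> borel_measurable (lebesgue_space N)"
      by (intro borel_measurable_prod measurable_compose[OF canonical_moment_measurable beta_factor_measurable])
  qed (auto intro!: prod_nonneg beta_factor_nonneg)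
  also have "\<dots> = ?R"
    unfolding nn by (rule enn2real_ennreal) (use Beta_nn s in \<open>auto intro!: prod_nonneg\<close>)
  finally show ?thesis unfolding unnorm_dens_eq[OF s] .
qed

section \<open>The moment space of the real line\<close>

lemma continuous_on_riesz:
  assumes "\<And>i. continuous_on X (\<lambda>m. coeff (p m) i)" "\<And>m. degree (p m) \<le> d"
  shows "continuous_on X (\<lambda>m. riesz m (p m))"
proof -
  have "continuous_on X (\<lambda>m :: nat \<Rightarrow> real. m i)" for i
    by (rule continuous_on_subset[OF continuous_on_product_coordinates]) simp
  then have "continuous_on X (\<lambda>m. if i = 0 then 1 else m i :: real)" for i
    by (cases "i = 0") auto
  then show ?thesis
    unfolding riesz_altdef[OF assms(2)] by (intro continuous_intros assms(1))
qed

lemma continuous_on_coeff_mult: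
  fixes p q :: "'a :: topological_space \<Rightarrow> real poly"
  assumes "\<And>i. continuous_on X (\<lambda>m. coeff (p m) i)" "\<And>i. continuous_on X (\<lambda>m. coeff (q m) i)"
  shows "continuous_on X (\<lambda>m. coeff (p m * q m) i)"
  unfolding coeff_mult by (intro continuous_intros assms)

lemma continuous_on_coeff_orth:
  assumes "\<And>m i. m \<in> X \<Longrightarrow> i < e \<Longrightarrow> orth_norm m v i \<noteq> 0"
  shows "continuous_on X (\<lambda>m. coeff (orth m v e) i)"
  using assms
proof (induction e arbitrary: i rule: less_induct)
  case (less e)
  have IH: "continuous_on X (\<lambda>m. coeff (orth m v j) i)" if "j < e" for j i
    by (rule less.IH[OF that]) (use less.prems that in auto)
  have 1: "continuous_on X (\<lambda>m. rinner m v (monom 1 e) (orth m v j))" if "j < e" for j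
    unfolding rinner_def
    by (rule continuous_on_riesz[OF _ degree_mult_monom_orth_le])
      (intro continuous_on_coeff_mult IH that continuous_on_const)
  have 2: "continuous_on X (\<lambda>m. rinner m v (orth m v j) (orth m v j))" if "j < e" for j
    unfolding rinner_def
    by (rule continuous_on_riesz[OF _ degree_mult_orth_le])
      (intro continuous_on_coeff_mult IH that continuous_on_const)
  have 3: "continuous_on X (\<lambda>m. rinner m v (monom 1 e) (orth m v j) / rinner m v (orth m v j) (orth m v j)
      * coeff (orth m v j) i)" if "j < e" for j
    by (intro continuous_on_mult continuous_on_divide 1 2 IH that ballI)
      (use less.prems[OF _ that] in \<open>simp add: orth_norm_def\<close>)
  show ?case
    unfolding orth.simps[of _ v e] coeff_diff coeff_sum coeff_smult
    by (intro continuous_on_diff continuous_on_const continuous_on_sum 3) simp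
qed

text \<open>Earlier norms occur as denominators, so continuity of the norm of index \<open>n\<close>
  is available only where they do not vanish; hence the induction over open sets.\<close>

lemma open_orth_norm_pos: "open {m. \<forall>i<n. orth_norm m v i > 0}"
proof (induction n)
  case (Suc n)
  let ?X = "{m. \<forall>i<n. orth_norm m v i > 0}"
  have "continuous_on ?X (\<lambda>m. coeff (orth m v n) i)" for i
  proof (rule continuous_on_coeff_orth)
    fix m j assume "m \<in> ?X" "j < n"
    then have "orth_norm m v j > 0" by blast
    then show "orth_norm m v j \<noteq> 0" by simp
  qed
  then have "continuous_on ?X (\<lambda>m. orth_norm m v n)"
    unfolding orth_norm_def rinner_def
    by (intro continuous_on_riesz[OF _ degree_mult_orth_le] continuous_on_coeff_mult continuous_on_const)
  then have "open ((\<lambda>m. orth_norm m v n) -` {0<..} \<inter> ?X)"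
    by (rule continuous_on_open_vimage[OF Suc, THEN iffD1, rule_format, OF _ open_greaterThan])
  also have "(\<lambda>m. orth_norm m v n) -` {0<..} \<inter> ?X = {m. \<forall>i<Suc n. orth_norm m v i > 0}"
    by (auto simp: less_Suc_eq)
  finally show ?case .
qed simp

lemma riesz_moment_space:
  assumes "m \<in> moment_space N T" "degree p \<le> N"
  obtains \<mu> where "\<mu> \<in> moment_measures T" "riesz m p = (\<integral>x. poly p x \<partial>\<mu>)"
proof -
  obtain \<mu> where \<mu>: "\<mu> \<in> moment_measures T" "m = (\<lambda>k\<in>{1..N}. mom k \<mu>)"
    using assms(1) by (auto simp: moment_space_def)
  have "riesz m p = riesz (\<lambda>i. mom i \<mu>) p"
    by (rule riesz_cong) (use \<mu>(2) assms(2) in auto)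
  then show ?thesis using that[OF \<mu>(1)] integral_poly_moment_measure[OF \<mu>(1)] by simp
qed

lemma gauss_moment_measure:
  assumes n: "n \<ge> 1" and pos: "\<And>i. i < n \<Longrightarrow> orth_norm m 1 i > 0"
  obtains \<mu> where "\<mu> \<in> moment_measures UNIV" "\<And>p. degree p \<le> 2 * n - 1 \<Longrightarrow> (\<integral>x. poly p x \<partial>\<mu>) = riesz m p"
    "\<And>i. i \<in> {1..2 * n - 1} \<Longrightarrow> mom i \<mu> = m i"
proof -
  obtain X lam where X: "finite X" "card X = n" "\<And>x. x \<in> X \<Longrightarrow> lam x > (0 :: real)" "(\<Sum>x\<in>X. lam x) = 1"
    "\<And>p. degree p \<le> 2 * n - 1 \<Longrightarrow> riesz m p = (\<Sum>x\<in>X. lam x * poly p x)"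
    using gauss_quadrature[OF n pos] by metis
  obtain \<mu> where \<mu>: "\<mu> \<in> moment_measures UNIV"
    "\<And>p. (\<integral>x. poly p x \<partial>\<mu>) = (\<Sum>x\<in>X. lam x * poly p x)"
    using discrete_moment_measure[OF X(1) subset_UNIV X(3,4)] by metis
  have int: "(\<integral>x. poly p x \<partial>\<mu>) = riesz m p" if "degree p \<le> 2 * n - 1" for p
    using \<mu>(2) X(5)[OF that] by simp
  have "mom i \<mu> = m i" if "i \<in> {1..2 * n - 1}" for i
  proof -
    have "mom i \<mu> = riesz m (monom 1 i)"
      unfolding mom_eq_riesz[OF \<mu>(1)] by (rule int) (use that in \<open>auto simp: degree_monom_eq\<close>)
    also have "\<dots> = m i" by (rule riesz_monom) (use that in auto)
    finally show ?thesis .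
  qed
  with that \<mu>(1) int show ?thesis by blast
qed

text \<open>Positive norms define an open set whose points are moment vectors of Gauss measures.
  Conversely, for \<open>i \<ge> 1\<close> an interior point stays in the moment space when
  \<open>m (2 i)\<close> is lowered slightly; the integral of the square of
  \<open>orth m 1 i\<close>, with the original \<open>m\<close>, falls by the same amount and stays
  nonnegative, so it was positive.\<close>

lemma moment_space_interior_real:
  assumes n: "n \<ge> 1" and m: "m \<in> extensional {1..2 * n - 1}"
  shows "m \<in> moment_space_interior (2 * n - 1) UNIV \<longleftrightarrow> (\<forall>i<n. orth_norm m 1 i > 0)"
proof
  let ?N = "2 * n - 1"
  let ?X = "product_topology (\<lambda>_. euclideanreal) {1..?N}"
  have topX: "topspace ?X = extensional {1..?N}" by (simp add: PiE_def)
  show "m \<in> moment_space_interior ?N UNIV" if pos: "\<forall>i<n. orth_norm m 1 i > 0"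
  proof -
    define G where "G = {m. \<forall>i<n. orth_norm m 1 i > 0}"
    \<comment> \<open>Openness of the norm conditions is known on all functions on
      \<open>nat\<close>. It is pulled back along the inclusion of the extensional vectors,
      continuous because components outside the index set are constant.\<close>
    have "continuous_map ?X (product_topology (\<lambda>_. euclideanreal) UNIV) (\<lambda>x. x)"
      unfolding continuous_map_componentwise_UNIV
    proof
      fix k
      show "continuous_map ?X euclideanreal (\<lambda>x. x k)"
      proof (cases "k \<in> {1..?N}")
        case True
        then show ?thesis by (rule continuous_map_product_projection)
      next
        case False
        show ?thesis
        proof (rule continuous_map_eq)
          show "continuous_map ?X euclideanreal (\<lambda>_. undefined)" by simp
          show "undefined = x k" if "x \<in> topspace ?X" for x
            using that False unfolding topX extensional_def by simp
        qed
      qed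
    qed
    moreover have "openin (product_topology (\<lambda>_. euclideanreal) UNIV) G"
      using open_orth_norm_pos[of n 1] unfolding euclidean_product_topology G_def by simp
    ultimately have "openin ?X {x \<in> topspace ?X. x \<in> G}"
      by (rule openin_continuous_map_preimage)
    moreover have "{x \<in> topspace ?X. x \<in> G} \<subseteq> moment_space ?N UNIV"
    proof
      fix x assume "x \<in> {x \<in> topspace ?X. x \<in> G}"
      then have x: "x \<in> extensional {1..?N}" "\<And>i. i < n \<Longrightarrow> orth_norm x 1 i > 0"
        unfolding topX G_def by auto
      obtain \<mu> where "\<mu> \<in> moment_measures UNIV" "\<And>i. i \<in> {1..?N} \<Longrightarrow> mom i \<mu> = x i"
        using gauss_moment_measure[OF n x(2)] by metis
      moreover have "x = (\<lambda>k\<in>{1..?N}. mom k \<mu>)"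
        by (rule extensionalityI[OF x(1)]) (use calculation in auto)
      ultimately show "x \<in> moment_space ?N UNIV" unfolding moment_space_def by blast
    qed
    ultimately have "{x \<in> topspace ?X. x \<in> G} \<subseteq> ?X interior_of moment_space ?N UNIV"
      by (intro interior_of_maximal)
    moreover have "m \<in> {x \<in> topspace ?X. x \<in> G}" using m pos unfolding topX G_def by auto
    ultimately show ?thesis unfolding moment_space_interior_def by blast
  qed
  assume "m \<in> moment_space_interior ?N UNIV"
  then obtain T where T: "openin ?X T" "m \<in> T" "T \<subseteq> moment_space ?N UNIV"
    unfolding moment_space_interior_def interior_of_def by blast
  show "\<forall>i<n. orth_norm m 1 i > 0"
  proof (intro allI impI)
    fix i assume i: "i < n"
    show "orth_norm m 1 i > 0"
    proof (cases "i = 0")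
      case True
      then show ?thesis by (simp add: orth_norm_def rinner_def)
    next
      case False
      define k where "k = 2 * i"
      have k: "k \<in> {1..?N}" using False i by (auto simp: k_def)
      let ?q = "orth m 1 i"
      let ?f = "?q * ?q"
      have "continuous_map euclideanreal ?X (\<lambda>t. m(k := t))"
        unfolding continuous_map_componentwise
      proof (intro conjI ballI)
        show "(\<lambda>t. m(k := t)) ` topspace euclideanreal \<subseteq> extensional {1..?N}"
          using m k by (intro image_subsetI) (simp add: extensional_def)
        show "continuous_map euclideanreal euclideanreal (\<lambda>t. (m(k := t)) j)" for j
          by (cases "j = k") simp_all
      qed
      from openin_continuous_map_preimage[OF this T(1)]
      have "open {t. m(k := t) \<in> T}" by simp
      moreover have "m k \<in> {t. m(k := t) \<in> T}" using T(2) by simp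
      ultimately obtain e where e: "e > 0" "ball (m k) e \<subseteq> {t. m(k := t) \<in> T}"
        unfolding open_contains_ball by blast
      define m' where "m' = m(k := m k - e / 2)"
      have "m k - e / 2 \<in> ball (m k) e" using e(1) by (simp add: dist_real_def)
      then have "m' \<in> moment_space ?N UNIV" using e(2) T(3) unfolding m'_def by blast
      moreover have deg: "degree ?f = k" by (simp add: degree_mult_eq k_def)
      ultimately obtain \<mu> where "\<mu> \<in> moment_measures UNIV" "riesz m' ?f = (\<integral>x. poly ?f x \<partial>\<mu>)"
        using riesz_moment_space[of m' ?N UNIV ?f] k by auto
      then have "riesz m' ?f \<ge> 0" by (auto intro!: Bochner_Integration.integral_nonneg)
      moreover have "riesz m' ?f = riesz m ?f + coeff ?f k * (m' k - m k)"
        by (rule riesz_change_top) (use deg k in \<open>auto simp: m'_def\<close>)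
      moreover have "coeff ?f k = 1"
        using lead_coeff_mult[of ?q ?q] deg by simp
      ultimately have "riesz m ?f \<ge> e / 2" by (simp add: m'_def)
      then show ?thesis using e(1) by (simp add: orth_norm_def rinner_def)
    qed
  qed
qed

text \<open>The definition quantifies over all measures with the given moments, so uniqueness
  requires one to exist; the Gauss measure is taken. For \<open>k \<le> n\<close> the products
  involved have degree at most \<open>2 * n - 1\<close>, so their integrals depend on the given
  moments only.\<close>

lemma monic_orth_poly_eq:
  assumes n: "n \<ge> 1" and pos: "\<And>i. i < n \<Longrightarrow> orth_norm m 1 i > 0" and k: "k \<le> n"
  shows "monic_orth_poly (2 * n - 1) m k = orth m 1 k"
  unfolding monic_orth_poly_def
proof (rule the_equality)
  have nz: "orth_norm m 1 i \<noteq> 0" if "i < k" for i using pos[of i] that k by simp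
  show "is_monic_orth_poly (2 * n - 1) m k (orth m 1 k)"
    unfolding is_monic_orth_poly_def
  proof (intro conjI ballI impI allI)
    fix \<mu> and q :: "real poly"
    assume \<mu>: "\<mu> \<in> moment_measures UNIV" "\<forall>i\<in>{1..2 * n - 1}. mom i \<mu> = m i" and q: "degree q < k"
    have "(\<integral>x. poly (orth m 1 k) x * poly q x \<partial>\<mu>) = riesz (\<lambda>i. mom i \<mu>) (orth m 1 k * q)"
      using integral_poly_moment_measure[OF \<mu>(1), of "orth m 1 k * q"] by simp
    also have "\<dots> = riesz m (orth m 1 k * q)"
    proof (rule riesz_cong)
      fix i assume "1 \<le> i" "i \<le> degree (orth m 1 k * q)"
      then have "i \<le> k + degree q" using degree_mult_le[of "orth m 1 k" q] by simp
      then show "mom i \<mu> = m i" using \<mu>(2) \<open>1 \<le> i\<close> q k by auto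
    qed
    also have "\<dots> = rinner m 1 (orth m 1 k) q" by (simp add: rinner_def)
    also have "\<dots> = 0" by (rule orth_perp[OF nz]) (use q in \<open>auto intro: coeff_eq_0\<close>)
    finally show "(\<integral>x. poly (orth m 1 k) x * poly q x \<partial>\<mu>) = 0" .
  qed auto
  fix p assume p: "is_monic_orth_poly (2 * n - 1) m k p"
  then have deg: "degree p = k" "coeff p k = 1" by (auto simp: is_monic_orth_poly_def)
  obtain \<mu> where \<mu>: "\<mu> \<in> moment_measures UNIV"
    "\<And>p. degree p \<le> 2 * n - 1 \<Longrightarrow> (\<integral>x. poly p x \<partial>\<mu>) = riesz m p"
    "\<And>i. i \<in> {1..2 * n - 1} \<Longrightarrow> mom i \<mu> = m i"
    using gauss_moment_measure[OF n pos] by metis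
  show "p = orth m 1 k"
  proof (rule orth_unique)
    show "orth_norm m 1 i > 0" if "i < k" for i using pos[of i] that k by simp
    show "coeff p k = 1" "\<And>i. i > k \<Longrightarrow> coeff p i = 0" using deg by (auto intro: coeff_eq_0)
    fix q :: "real poly" assume q: "\<And>i. i \<ge> k \<Longrightarrow> coeff q i = 0"
    show "rinner m 1 p q = 0"
    proof (cases "q = 0")
      case False
      then have "degree q < k" using q[of "degree q"] by (meson leading_coeff_0_iff not_le)
      then have "(\<integral>x. poly p x * poly q x \<partial>\<mu>) = 0"
        using p \<mu>(1,3) by (auto simp: is_monic_orth_poly_def)
      moreover have "degree (p * q) \<le> 2 * n - 1"
        using degree_mult_le[of p q] deg \<open>degree q < k\<close> k by linarith
      ultimately show ?thesis using \<mu>(2)[of "p * q"] by (simp add: rinner_def)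
    qed simp
  qed
qed

section \<open>Three-term recurrence and uniqueness of its coefficients\<close>

lemma three_term_recurrence:
  assumes pos: "\<And>i. i \<le> Suc k \<Longrightarrow> orth_norm m 1 i > 0"
  shows "[:0, 1:] * orth m 1 (Suc k) = orth m 1 (Suc (Suc k))
    + smult (jacobi_b m (Suc (Suc k))) (orth m 1 (Suc k)) + smult (jacobi_a m (Suc k)) (orth m 1 k)"
proof -
  let ?P = "orth m 1" and ?b = "jacobi_b m (Suc (Suc k))" and ?a = "jacobi_a m (Suc k)"
  have nz: "orth_norm m 1 i \<noteq> 0" if "i < Suc (Suc k)" for i using pos[of i] that by simp
  let ?p = "[:0, 1:] * ?P (Suc k) - smult ?b (?P (Suc k)) - smult ?a (?P k)"
  have "?p = ?P (Suc (Suc k))"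
  proof (rule orth_unique)
    show "orth_norm m 1 i > 0" if "i < Suc (Suc k)" for i using pos[of i] that by simp
    show "coeff ?p (Suc (Suc k)) = 1" by (simp add: coeff_orth_ge)
    show "coeff ?p i = 0" if "i > Suc (Suc k)" for i
      using that by (cases i) (simp_all add: coeff_orth_ge)
    fix q :: "real poly" assume q: "\<And>i. i \<ge> Suc (Suc k) \<Longrightarrow> coeff q i = 0"
    show "rinner m 1 ?p q = 0"
    proof (rule rinner_zero_if_perp_orth[OF _ q])
      fix i assume i: "i < Suc (Suc k)"
      have orth: "rinner m 1 (?P a) (?P b) = 0" if "a \<noteq> b" "a < Suc (Suc k)" "b < Suc (Suc k)" for a b
        using orth_perp_orth[of b m 1 a] orth_perp_orth[of a m 1 b] that nz
        by (cases "a < b") (auto simp: rinner_commute[of m 1 "?P a" "?P b"])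
      show "rinner m 1 ?p (?P i) = 0"
      proof (cases "i = Suc k")
        case True
        have "rinner m 1 ([:0, 1:] * ?P (Suc k)) (?P (Suc k)) = ?b * orth_norm m 1 (Suc k)"
          using nz[of "Suc k"] by (simp add: jacobi_b_def rinner_def)
        then show ?thesis
          unfolding True using orth[of k "Suc k"] by (simp add: orth_norm_def)
      next
        case False
        then have "i \<le> k" using i by simp
        \<comment> \<open>Multiplication by \<open>x\<close> is symmetric and moves to
          \<open>P_i\<close>; as \<open>x P_i\<close> has degree at most \<open>Suc k\<close>, only
          \<open>i = k\<close> survives.\<close>
        have "rinner m 1 ([:0, 1:] * ?P (Suc k)) (?P i) = rinner m 1 (?P (Suc k)) ([:0, 1:] * ?P i)"
          unfolding rinner_def by (rule arg_cong[of _ _ "riesz m"]) (simp only: mult_ac)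
        also have "\<dots> = coeff ([:0, 1:] * ?P i) (Suc k) * orth_norm m 1 (Suc k)"
        proof (rule rinner_orth)
          show "orth_norm m 1 j \<noteq> 0" if "j < Suc k" for j using nz[of j] that by simp
          show "coeff ([:0, 1:] * ?P i) j = 0" if "j > Suc k" for j
            using that \<open>i \<le> k\<close> by (cases j) (auto simp: coeff_orth_ge)
        qed
        also have "\<dots> = (if i = k then orth_norm m 1 (Suc k) else 0)"
          using \<open>i \<le> k\<close> by (auto simp: coeff_orth_ge)
        finally have 1: "rinner m 1 ([:0, 1:] * ?P (Suc k)) (?P i) = (if i = k then orth_norm m 1 (Suc k) else 0)" .
        have "?a * orth_norm m 1 k = orth_norm m 1 (Suc k)" using nz[of k] by (simp add: jacobi_a_def)
        then have 2: "?a * rinner m 1 (?P k) (?P i) = (if i = k then orth_norm m 1 (Suc k) else 0)"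
          using orth[of k i] \<open>i \<le> k\<close> by (auto simp: orth_norm_def)
        have 3: "rinner m 1 (?P (Suc k)) (?P i) = 0" using orth[of "Suc k" i] False i by simp
        show ?thesis unfolding rinner_linear 1 2 3 by simp
      qed
    qed
  qed
  then show ?thesis by (simp add: algebra_simps)
qed

lemma orth_1: "orth m 1 1 = [:- jacobi_b m 1, 1:]"
proof -
  have "[:- jacobi_b m 1, 1:] = orth m 1 1"
  proof (rule orth_unique)
    show "orth_norm m 1 i > 0" if "i < 1" for i using that by (simp add: orth_norm_def rinner_def)
    show "coeff [:- jacobi_b m 1, 1:] 1 = 1" by simp
    show "coeff [:- jacobi_b m 1, 1:] i = 0" if "i > 1" for i by (rule coeff_eq_0) (use that in simp)
    fix q :: "real poly" assume q: "\<And>i. i \<ge> 1 \<Longrightarrow> coeff q i = 0"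
    have "[:- jacobi_b m 1, 1:] = [:0, 1:] - smult (jacobi_b m 1) 1" by (rule poly_ext) simp
    then have "riesz m [:- jacobi_b m 1, 1:] = 0"
      by (simp only: riesz_diff riesz_smult riesz_1) (simp add: jacobi_b_def orth_norm_def rinner_def)
    moreover have "degree q = 0" using q by (metis One_nat_def degree_le le_zero_eq less_eq_Suc_le)
    then have "q = smult (coeff q 0) 1" by (metis degree_0_id smult_one)
    then have "rinner m 1 [:- jacobi_b m 1, 1:] q = coeff q 0 * rinner m 1 [:- jacobi_b m 1, 1:] 1"
      by (metis rinner_linear(7))
    ultimately show "rinner m 1 [:- jacobi_b m 1, 1:] q = 0" by (simp add: rinner_def)
  qed
  then show ?thesis by simp
qed

lemma three_term_coeffs_unique:
  fixes b b' a a' :: real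
  assumes "smult b (orth m v (Suc k)) + smult a (orth m v k) = smult b' (orth m v (Suc k)) + smult a' (orth m v k)"
  shows "b = b'" "a = a'"
proof -
  show "b = b'" using arg_cong[OF assms, of "\<lambda>p. coeff p (Suc k)"] by (simp add: coeff_orth_ge)
  then show "a = a'" using arg_cong[OF assms, of "\<lambda>p. coeff p k"] by simp
qed

context
  fixes n :: nat and m :: "nat \<Rightarrow> real"
  assumes n: "n \<ge> 1" and pos: "\<And>i. i < n \<Longrightarrow> orth_norm m 1 i > 0"
begin

lemma rec_a_eq:
  assumes "1 \<le> k" "k < n"
  shows "rec_a (2 * n - 1) m k = jacobi_a m k"
proof -
  obtain j where j: "k = Suc j" using assms(1) by (cases k) auto
  have P: "monic_orth_poly (2 * n - 1) m k = orth m 1 (Suc j)"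
    "monic_orth_poly (2 * n - 1) m (k + 1) = orth m 1 (Suc (Suc j))"
    "monic_orth_poly (2 * n - 1) m (k - 1) = orth m 1 j"
    using monic_orth_poly_eq[OF n pos] assms j by simp_all
  have rec: "[:0, 1:] * orth m 1 (Suc j) = orth m 1 (Suc (Suc j))
    + smult (jacobi_b m (Suc (Suc j))) (orth m 1 (Suc j)) + smult (jacobi_a m (Suc j)) (orth m 1 j)"
    by (rule three_term_recurrence) (use pos assms j in auto)
  show ?thesis
    unfolding rec_a_def P rec
  proof (rule the_equality)
    fix a
    assume "\<exists>b. orth m 1 (Suc (Suc j)) + smult (jacobi_b m (Suc (Suc j))) (orth m 1 (Suc j))
        + smult (jacobi_a m (Suc j)) (orth m 1 j)
      = orth m 1 (Suc (Suc j)) + smult b (orth m 1 (Suc j)) + smult a (orth m 1 j)"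
    then obtain b where "smult (jacobi_b m (Suc (Suc j))) (orth m 1 (Suc j)) + smult (jacobi_a m (Suc j)) (orth m 1 j)
      = smult b (orth m 1 (Suc j)) + smult a (orth m 1 j)" by (auto simp: add.assoc)
    from three_term_coeffs_unique(2)[OF this] show "a = jacobi_a m k" using j by simp
  qed (use j in blast)
qed

lemma rec_b_eq:
  assumes "1 \<le> k" "k \<le> n"
  shows "rec_b (2 * n - 1) m k = jacobi_b m k"
proof (cases "k = 1")
  case True
  have "monic_orth_poly (2 * n - 1) m 1 = [:- jacobi_b m 1, 1:]"
    using monic_orth_poly_eq[OF n pos] orth_1 n by simp
  then show ?thesis using True by (simp add: rec_b_def)
next
  case False
  then obtain j where j: "k = Suc (Suc j)" using assms(1) by (metis One_nat_def not_one_le_zero old.nat.exhaust)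
  have P: "monic_orth_poly (2 * n - 1) m k = orth m 1 (Suc (Suc j))"
    "monic_orth_poly (2 * n - 1) m (k - 1) = orth m 1 (Suc j)"
    "monic_orth_poly (2 * n - 1) m (k - 2) = orth m 1 j"
    using monic_orth_poly_eq[OF n pos] assms j by simp_all
  have rec: "[:0, 1:] * orth m 1 (Suc j) = orth m 1 (Suc (Suc j))
    + smult (jacobi_b m (Suc (Suc j))) (orth m 1 (Suc j)) + smult (jacobi_a m (Suc j)) (orth m 1 j)"
    by (rule three_term_recurrence) (use pos assms j in auto)
  have "(THE b. \<exists>a. orth m 1 (Suc (Suc j)) + smult (jacobi_b m (Suc (Suc j))) (orth m 1 (Suc j))
        + smult (jacobi_a m (Suc j)) (orth m 1 j)
      = orth m 1 (Suc (Suc j)) + smult b (orth m 1 (Suc j)) + smult a (orth m 1 j)) = jacobi_b m k"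
  proof (rule the_equality)
    fix b
    assume "\<exists>a. orth m 1 (Suc (Suc j)) + smult (jacobi_b m (Suc (Suc j))) (orth m 1 (Suc j))
        + smult (jacobi_a m (Suc j)) (orth m 1 j)
      = orth m 1 (Suc (Suc j)) + smult b (orth m 1 (Suc j)) + smult a (orth m 1 j)"
    then obtain a where "smult (jacobi_b m (Suc (Suc j))) (orth m 1 (Suc j)) + smult (jacobi_a m (Suc j)) (orth m 1 j)
      = smult b (orth m 1 (Suc j)) + smult a (orth m 1 j)" by (auto simp: add.assoc)
    from three_term_coeffs_unique(1)[OF this] show "b = jacobi_b m k" using j by simp
  qed (use j in blast)
  then show ?thesis using False unfolding rec_b_def P rec by simp
qed

end

text \<open>Counterpart of \<open>lgap\<close> on the real line: divided by
  \<open>real_width\<close> it gives \<open>a_j\<close> at index \<open>2 j\<close> and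
  \<open>b_j\<close> at index \<open>2 j - 1\<close>. The integrated polynomial is monic in both
  parities, hence slope one in \<open>m k\<close>.\<close>

definition real_gap :: "nat \<Rightarrow> (nat \<Rightarrow> real) \<Rightarrow> real" where
  "real_gap k m = (if even k then orth_norm m 1 (k div 2)
     else rinner m [:0, 1:] (orth m 1 (k div 2)) (orth m 1 (k div 2)))"

definition real_width :: "nat \<Rightarrow> (nat \<Rightarrow> real) \<Rightarrow> real" where
  "real_width k m = orth_norm m 1 ((k - 1) div 2)"

definition real_support :: "nat \<Rightarrow> real set" where
  "real_support k = (if even k then {0<..} else UNIV)"

definition jacobi_coord :: "nat \<Rightarrow> (nat \<Rightarrow> real) \<Rightarrow> real" where
  "jacobi_coord k m = real_gap k m / real_width k m"

lemma jacobi_coord_eq: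
  "k \<ge> 1 \<Longrightarrow> jacobi_coord (2 * k - 1) m = jacobi_b m k" "k \<ge> 1 \<Longrightarrow> jacobi_coord (2 * k) m = jacobi_a m k"
proof -
  assume k: "k \<ge> 1"
  have "(2 * k - 1) div 2 = k - 1" "(2 * k - 1 - 1) div 2 = k - 1" "odd (2 * k - 1)" using k by auto
  then show "jacobi_coord (2 * k - 1) m = jacobi_b m k" "jacobi_coord (2 * k) m = jacobi_a m k"
    by (simp_all add: jacobi_coord_def real_gap_def real_width_def jacobi_a_def jacobi_b_def)
qed

lemma real_gap_change_top:
  assumes "k \<ge> 1" "\<And>i. i \<in> {1..<k} \<Longrightarrow> m' i = m i"
  shows "real_gap k m' = real_gap k m + (m' k - m k)"
proof (cases "even k")
  case True
  then show ?thesis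
    using rinner_orth_change_top[OF assms, where e = "k div 2" and u = 1 and v = 1]
    by (simp add: real_gap_def orth_norm_def)
next
  case False
  then have "1 + 2 * (k div 2) = k" by (elim oddE) simp
  then show ?thesis
    using rinner_orth_change_top[OF assms, where e = "k div 2" and u = "[:0, 1:]" and v = 1] False
    by (simp add: real_gap_def)
qed

lemma real_width_cong:
  assumes "k \<ge> 1" "\<And>i. i \<in> {1..<k} \<Longrightarrow> m i = m' i"
  shows "real_width k m = real_width k m'"
proof -
  let ?e = "(k - 1) div 2"
  have "orth m 1 ?e = orth m' 1 ?e"
    by (rule orth_cong) (use assms in auto)
  moreover have "riesz m (1 * orth m' 1 ?e * orth m' 1 ?e) = riesz m' (1 * orth m' 1 ?e * orth m' 1 ?e)"
  proof (rule riesz_cong)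
    fix i assume "1 \<le> i" "i \<le> degree (1 * orth m' 1 ?e * orth m' 1 ?e)"
    then have "i \<le> ?e + ?e" using degree_mult_orth_le[of 1 m' 1 ?e ?e] by simp
    then have "i \<in> {1..<k}" using \<open>1 \<le> i\<close> assms(1) by simp
    then show "m i = m' i" by (rule assms(2))
  qed
  ultimately show ?thesis by (simp add: real_width_def orth_norm_def rinner_def)
qed

text \<open>The width is multiplied by \<open>a\<close> after an even index, because
  \<open>a\<close> is the quotient of consecutive norms, and is unchanged after an odd one.\<close>

lemma triangular_real:
  "triangular (\<lambda>k m. m k - real_gap k m) real_width 1 (\<lambda>k t. if even k then t else 1) real_support"
proof
  fix k :: nat and m m' :: "nat \<Rightarrow> real"
  assume k: "k \<ge> 1" and eq: "\<And>i. i \<in> {1..<k} \<Longrightarrow> m i = m' i"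
  show "m k - real_gap k m = m' k - real_gap k m'"
    using real_gap_change_top[OF k eq] by simp
  show "real_width k m = real_width k m'" by (rule real_width_cong[OF k eq])
next
  fix k N
  have "real_gap k \<in> borel_measurable (lebesgue_space N)"
    unfolding real_gap_def[abs_def] by measurable
  then show "(\<lambda>m. m k - real_gap k m) \<in> borel_measurable (lebesgue_space N)" by measurable
  show "real_width k \<in> borel_measurable (lebesgue_space N)"
    unfolding real_width_def[abs_def] by measurable
next
  fix k :: nat and m :: "nat \<Rightarrow> real"
  assume k: "k \<ge> 1"
    and S: "\<And>j. j \<in> {1..k} \<Longrightarrow> (m j - (m j - real_gap j m)) / real_width j m \<in> real_support j"
  show "real_width (Suc k) m = (if even k then (m k - (m k - real_gap k m)) / real_width k m else 1) * real_width k m"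
  proof (cases "even k")
    case True
    then have "real_gap k m / real_width k m > 0" using S[of k] k by (simp add: real_support_def)
    \<comment> \<open>A positive quotient excludes a zero denominator, since division by zero gives
      0.\<close>
    then have "real_width k m \<noteq> 0" by auto
    then show ?thesis using True by (simp add: real_width_def real_gap_def)
  next
    case False
    then have "k div 2 = (k - 1) div 2" by (elim oddE) simp
    then show ?thesis using False by (simp add: real_width_def)
  qed
next
  fix k and t :: real assume "t \<in> real_support k"
  then show "(if even k then t else 1) > 0" by (auto simp: real_support_def split: if_splits)
qed (auto simp: real_width_def orth_norm_def rinner_def)

lemma nn_integral_jacobi:
  assumes "\<And>k. \<phi> k \<in> borel_measurable borel" "\<And>k t. k \<ge> 1 \<Longrightarrow> t \<notin> real_support k \<Longrightarrow> \<phi> k t = (0 :: ennreal)"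
  shows "(\<integral>\<^sup>+m. (\<Prod>k\<in>{1..N}. \<phi> k (jacobi_coord k m)) \<partial>lebesgue_space N)
    = (\<Prod>k\<in>{1..N}. \<integral>\<^sup>+t. \<phi> k t * ennreal (if even k then t else 1) ^ (N - k) \<partial>lborel)"
proof -
  interpret triangular "\<lambda>k m. m k - real_gap k m" real_width 1 "\<lambda>k t. if even k then t else 1" real_support
    by (rule triangular_real)
  have "coord k m = jacobi_coord k m" for k m
    by (simp add: coord_def jacobi_coord_def)
  then show ?thesis using nn_integral_prod[OF assms, where N = N] by simp
qed

lemma jacobi_coord_measurable [measurable]: "jacobi_coord k \<in> borel_measurable (lebesgue_space N)"
  unfolding jacobi_coord_def[abs_def] real_gap_def[abs_def] real_width_def[abs_def] by measurable

lemma orth_norm_pos_iff_jacobi_coord: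
  "n \<ge> 1 \<Longrightarrow> (\<forall>i<n. orth_norm m 1 i > 0) \<longleftrightarrow> (\<forall>k\<in>{1..2 * n - 1}. jacobi_coord k m \<in> real_support k)"
proof (induction n)
  case (Suc n)
  show ?case
  proof (cases "n = 0")
    case True
    then show ?thesis by (simp add: real_support_def orth_norm_def rinner_def)
  next
    case False
    let ?A = "\<forall>i<n. orth_norm m 1 i > 0"
    let ?R = "\<lambda>n. \<forall>k\<in>{1..2 * n - 1}. jacobi_coord k m \<in> real_support k"
    have set: "{1..2 * Suc n - 1} = {1..2 * n - 1} \<union> {2 * n, 2 * n + 1}" using False by auto
    have even: "jacobi_coord (2 * n) m \<in> real_support (2 * n) \<longleftrightarrow> orth_norm m 1 n / orth_norm m 1 (n - 1) > 0"
      using jacobi_coord_eq(2)[of n m] False by (simp add: real_support_def jacobi_a_def)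
    have "jacobi_coord (2 * n + 1) m \<in> real_support (2 * n + 1)" by (simp add: real_support_def)
    with even have R: "?R (Suc n) \<longleftrightarrow> ?R n \<and> orth_norm m 1 n / orth_norm m 1 (n - 1) > 0"
      unfolding set ball_Un by blast
    have A: "(\<forall>i<Suc n. orth_norm m 1 i > 0) \<longleftrightarrow> ?A \<and> orth_norm m 1 n > 0"
      by (auto simp: less_Suc_eq)
    have IH: "?A \<longleftrightarrow> ?R n" using Suc.IH False by simp
    show ?thesis
    proof (cases ?A)
      case True
      then have "orth_norm m 1 (n - 1) > 0" using False by simp
      then have "orth_norm m 1 n / orth_norm m 1 (n - 1) > 0 \<longleftrightarrow> orth_norm m 1 n > 0"
        by (simp add: zero_less_divide_iff)
      then show ?thesis unfolding A R IH by blast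
    next
      case False
      then show ?thesis unfolding A R using IH by blast
    qed
  qed
qed simp

section \<open>The limit\<close>

lemma tendsto_eventually_eq:
  assumes "(f \<longlongrightarrow> l) F" "eventually (\<lambda>x. f x = g x) F" "l = l'"
  shows "(g \<longlongrightarrow> l') F"
  using Lim_transform_eventually[OF assms(1,2)] assms(3) by simp

lemma prod_odd_even:
  fixes f :: "nat \<Rightarrow> 'a :: comm_monoid_mult"
  assumes "n \<ge> 1"
  shows "(\<Prod>k=1..2*n-1. f k) = (\<Prod>j=1..n. f (2 * j - 1)) * (\<Prod>j=1..n-1. f (2 * j))"
  using assms
proof (induction n rule: dec_induct)
  case (step n)
  have "{1..2 * Suc n - 1} = insert (2 * n + 1) (insert (2 * n) {1..2 * n - 1})"
    "{1..Suc n} = insert (Suc n) {1..n}" "{1..Suc n - 1} = insert n {1..n - 1}"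
    using step by auto
  then show ?case using step by (simp add: mult_ac)
qed simp

definition limit_factor :: "nat \<Rightarrow> (nat \<Rightarrow> real) \<Rightarrow> (nat \<Rightarrow> real) \<Rightarrow> nat \<Rightarrow> real \<Rightarrow> real" where
  "limit_factor n \<gamma> \<delta> k t = (if odd k then sqrt (\<delta> k / pi) * exp (- \<delta> k * t\<^sup>2)
     else \<delta> k powr (\<gamma> (k div 2) + 2 * real n - real k) / Gamma (\<gamma> (k div 2) + 2 * real n - real k)
       * t powr \<gamma> (k div 2) * exp (- \<delta> k * t) * indicator {0<..} t)"

lemma limit_factor_measurable [measurable]: "limit_factor n \<gamma> \<delta> k \<in> borel_measurable borel"
  unfolding limit_factor_def[abs_def] by measurable

text \<open>Inside the interior \<open>rec_a\<close> and \<open>rec_b\<close> are the Jacobi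
  coefficients. Outside, some even coordinate is not positive, and the factor at its index vanishes
  together with the leading indicator.\<close>

lemma limit_dens_eq:
  assumes n: "n \<ge> 1" and m: "m \<in> extensional {1..2 * n - 1}"
  shows "limit_dens n \<gamma> \<delta> m = (\<Prod>k=1..2*n-1. limit_factor n \<gamma> \<delta> k (jacobi_coord k m))"
proof (cases "\<forall>i<n. orth_norm m 1 i > 0")
  case True
  then have pos: "\<And>i. i < n \<Longrightarrow> orth_norm m 1 i > 0" by blast
  have int: "m \<in> moment_space_interior (2 * n - 1) UNIV"
    using moment_space_interior_real[OF n m] True by blast
  have "sqrt (\<delta> (2 * j - 1) / pi) * exp (- \<delta> (2 * j - 1) * (rec_b (2 * n - 1) m j)\<^sup>2)
      = limit_factor n \<gamma> \<delta> (2 * j - 1) (jacobi_coord (2 * j - 1) m)" if "j \<in> {1..n}" for j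
  proof -
    have "odd (2 * j - 1)" "rec_b (2 * n - 1) m j = jacobi_b m j" "jacobi_coord (2 * j - 1) m = jacobi_b m j"
      using that rec_b_eq[OF n pos] jacobi_coord_eq by auto
    then show ?thesis by (simp only: limit_factor_def if_True not_False_eq_True)
  qed
  moreover have "\<delta> (2 * j) powr (\<gamma> j + 2 * real n - 2 * real j) / Gamma (\<gamma> j + 2 * real n - 2 * real j)
      * rec_a (2 * n - 1) m j powr \<gamma> j * exp (- \<delta> (2 * j) * rec_a (2 * n - 1) m j)
      * indicator {0<..} (rec_a (2 * n - 1) m j)
      = limit_factor n \<gamma> \<delta> (2 * j) (jacobi_coord (2 * j) m)" if "j \<in> {1..n - 1}" for j
  proof -
    have "1 \<le> j" "j < n" using that by auto
    then have "rec_a (2 * n - 1) m j = jacobi_a m j" "jacobi_coord (2 * j) m = jacobi_a m j"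
      using rec_a_eq[OF n pos] jacobi_coord_eq by auto
    then show ?thesis by (simp add: limit_factor_def)
  qed
  ultimately show ?thesis
    using int unfolding limit_dens_def prod_odd_even[OF n]
    by (simp only: indicator_simps mult_1_left cong: prod.cong)
next
  case False
  then have "m \<notin> moment_space_interior (2 * n - 1) UNIV"
    using moment_space_interior_real[OF n m] by blast
  then have 0: "limit_dens n \<gamma> \<delta> m = 0" by (simp add: limit_dens_def)
  obtain k where k: "k \<in> {1..2 * n - 1}" "jacobi_coord k m \<notin> real_support k"
    using False orth_norm_pos_iff_jacobi_coord[OF n, of m] by blast
  then have "limit_factor n \<gamma> \<delta> k (jacobi_coord k m) = 0"
    by (auto simp: limit_factor_def real_support_def split: if_splits)
  then have "(\<Prod>k\<in>{1..2*n-1}. limit_factor n \<gamma> \<delta> k (jacobi_coord k m)) = 0"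
    using k(1) by (intro prod_zero) auto
  then show ?thesis using 0 by simp
qed

section \<open>Total mass of the limit function\<close>

lemma nn_integral_gaussian:
  assumes "d > (0 :: real)"
  shows "(\<integral>\<^sup>+t. ennreal (sqrt (d / pi) * exp (- d * t\<^sup>2)) \<partial>lborel) = 1"
proof -
  define \<sigma> where "\<sigma> = 1 / sqrt (2 * d)"
  have \<sigma>: "\<sigma> > 0" "\<sigma>\<^sup>2 = 1 / (2 * d)" using assms by (simp_all add: \<sigma>_def power_divide)
  have "normal_density 0 \<sigma> t = sqrt (d / pi) * exp (- d * t\<^sup>2)" for t
    using assms by (simp add: normal_density_def \<sigma>(2) real_sqrt_divide field_simps)
  then have "(\<integral>\<^sup>+t. ennreal (sqrt (d / pi) * exp (- d * t\<^sup>2)) \<partial>lborel)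
      = (\<integral>\<^sup>+t. ennreal (normal_density 0 \<sigma> t) \<partial>lborel)" by simp
  also have "\<dots> = ennreal (\<integral>t. normal_density 0 \<sigma> t \<partial>lborel)"
    by (rule nn_integral_eq_integral) (use \<sigma> in auto)
  finally show ?thesis using \<sigma>(1) by simp
qed

lemma nn_integral_gamma_density:
  assumes d: "d > (0 :: real)" and q: "q > 0"
  shows "(\<integral>\<^sup>+t. ennreal (d powr q / Gamma q * t powr (q - 1) * exp (- d * t) * indicator {0<..} t) \<partial>lborel) = 1"
proof -
  define f where "f u = ennreal (indicator {0..} u * u powr (q - 1) / exp u)" for u :: real
  have [measurable]: "f \<in> borel_measurable borel" unfolding f_def by measurable
  have G: "Gamma q > 0" by (rule Gamma_real_pos[OF q])
  have "ennreal (Gamma q) = (\<integral>\<^sup>+u. f u \<partial>lborel)"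
    unfolding f_def by (rule Gamma_conv_nn_integral_real[OF q])
  also have "\<dots> = ennreal d * (\<integral>\<^sup>+t. f (0 + d * t) \<partial>lborel)"
    using nn_integral_real_affine[of f d 0] d by simp
  finally have G': "ennreal (Gamma q) = ennreal d * (\<integral>\<^sup>+t. f (d * t) \<partial>lborel)" by simp
  have "ennreal (d powr q / Gamma q * t powr (q - 1) * exp (- d * t) * indicator {0<..} t)
      = ennreal (d / Gamma q) * f (d * t)" for t
  proof (cases "t > 0")
    case True
    then have "d powr q / Gamma q * t powr (q - 1) * exp (- d * t) * indicator {0<..} t
        = d / Gamma q * (indicator {0..} (d * t) * (d * t) powr (q - 1) / exp (d * t))"
      using d by (simp add: powr_mult powr_diff exp_minus field_simps)
    then show ?thesis unfolding f_def using d G by (simp only: ennreal_mult' divide_nonneg_pos less_imp_le)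
  next
    case False
    then have "indicator {0..} (d * t) * (d * t) powr (q - 1) / exp (d * t) = 0"
      using d by (auto simp: indicator_def zero_le_mult_iff)
    then show ?thesis using False by (simp add: f_def)
  qed
  then have "(\<integral>\<^sup>+t. ennreal (d powr q / Gamma q * t powr (q - 1) * exp (- d * t) * indicator {0<..} t) \<partial>lborel)
      = (\<integral>\<^sup>+t. ennreal (d / Gamma q) * f (d * t) \<partial>lborel)" by simp
  also have "\<dots> = ennreal (d / Gamma q) * (\<integral>\<^sup>+t. f (d * t) \<partial>lborel)"
    by (rule nn_integral_cmult) (rule measurable_compose[of "\<lambda>t. d * t" lborel borel f], simp_all)
  also have "\<dots> = ennreal (1 / Gamma q) * (ennreal d * (\<integral>\<^sup>+t. f (d * t) \<partial>lborel))"
    using d G by (simp add: mult.assoc[symmetric] flip: ennreal_mult')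
  also have "\<dots> = 1"
    unfolding G'[symmetric] using G by (simp flip: ennreal_mult')
  finally show ?thesis .
qed

text \<open>Each of the \<open>2 n - 1 - 2 j\<close> moments after index \<open>2 j\<close>
  contributes a Jacobian factor \<open>a_j\<close>. This raises the exponent
  \<open>\<gamma> j\<close> to one less than \<open>\<gamma> j + 2 n - 2 j\<close>, the exponent of
  a Gamma density with that parameter; odd coordinates are Gaussian with trivial Jacobian.\<close>

lemma prob_density_limit_dens:
  assumes n: "n \<ge> 1" and \<gamma>: "\<forall>k\<in>{1..n-1}. \<gamma> k > -1" and \<delta>: "\<forall>k\<in>{1..2*n-1}. \<delta> k > 0"
  shows "prob_density_on (2 * n - 1) UNIV (limit_dens n \<gamma> \<delta>)"
proof -
  let ?N = "2 * n - 1"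
  let ?f = "limit_factor n \<gamma> \<delta>"
  have ext: "m \<in> extensional {1..?N}" if "m \<in> space (lebesgue_space ?N)" for m
    using that by (auto simp: space_PiM PiE_def)
  note eq = limit_dens_eq[OF n ext]
  have q: "\<gamma> (k div 2) + 2 * real n - real k > 0" if k: "k \<in> {1..?N}" "even k" for k
  proof -
    obtain b where b: "k = 2 * b" using k(2) by (elim evenE)
    have "1 \<le> b \<and> b + 1 \<le> n"
      using k(1) n unfolding b atLeastAtMost_iff by presburger
    then have "k div 2 \<in> {1..n-1}" "k + 2 \<le> 2 * n" unfolding b by auto
    then have "\<gamma> (k div 2) > -1" "real k + 2 \<le> 2 * real n" using \<gamma> by (blast, linarith)
    then show ?thesis by linarith
  qed
  have nonneg: "?f k t \<ge> 0" if "k \<in> {1..?N}" for k t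
  proof -
    have "\<delta> k > 0" using \<delta> that by blast
    then show ?thesis
      using q[OF that] by (auto simp: limit_factor_def intro!: mult_nonneg_nonneg less_imp_le[OF Gamma_real_pos])
  qed
  have factor: "(\<integral>\<^sup>+t. ennreal (?f k t) * ennreal (if even k then t else 1) ^ (?N - k) \<partial>lborel) = 1"
    if k: "k \<in> {1..?N}" for k
  proof (cases "even k")
    case True
    let ?q = "\<gamma> (k div 2) + 2 * real n - real k"
    have "ennreal (?f k t) * ennreal t ^ (?N - k)
        = ennreal (\<delta> k powr ?q / Gamma ?q * t powr (?q - 1) * exp (- \<delta> k * t) * indicator {0<..} t)" for t
    proof (cases "t > 0")
      case t: True
      have "?N - k + k + 1 = 2 * n" using k n by auto
      then have "real (?N - k + k + 1) = real (2 * n)" by (simp only:)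
      then have "real (?N - k) = 2 * real n - 1 - real k" by simp
      then have "t powr (?q - 1) = t powr \<gamma> (k div 2) * t ^ (?N - k)"
        using t by (simp add: powr_realpow[symmetric] flip: powr_add) (simp add: algebra_simps)
      then show ?thesis
        using True t nonneg[OF k, of t]
        by (simp add: limit_factor_def ennreal_power mult_ac flip: ennreal_mult)
    qed (use True in \<open>simp add: limit_factor_def\<close>)
    then show ?thesis
      using True nn_integral_gamma_density[of "\<delta> k" ?q] q[OF k True] \<delta> k by simp
  next
    case False
    then show ?thesis using nn_integral_gaussian[of "\<delta> k"] \<delta> k by (simp add: limit_factor_def)
  qed
  define \<phi> where "\<phi> k t = ennreal (?f k t)" for k t
  have "(\<integral>\<^sup>+m. ennreal (limit_dens n \<gamma> \<delta> m) \<partial>lebesgue_space ?N)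
      = (\<integral>\<^sup>+m. (\<Prod>k\<in>{1..?N}. \<phi> k (jacobi_coord k m)) \<partial>lebesgue_space ?N)"
  proof (rule nn_integral_cong)
    fix m assume "m \<in> space (lebesgue_space ?N)"
    then show "ennreal (limit_dens n \<gamma> \<delta> m) = (\<Prod>k\<in>{1..?N}. \<phi> k (jacobi_coord k m))"
      unfolding \<phi>_def by (subst prod_ennreal) (simp_all only: eq nonneg)
  qed
  also have "\<dots> = (\<Prod>k\<in>{1..?N}. \<integral>\<^sup>+t. \<phi> k t * ennreal (if even k then t else 1) ^ (?N - k) \<partial>lborel)"
  proof (rule nn_integral_jacobi)
    show "\<phi> k \<in> borel_measurable borel" for k unfolding \<phi>_def by measurable
    show "\<phi> k t = 0" if "t \<notin> real_support k" for k t
      using that by (auto simp: \<phi>_def limit_factor_def real_support_def split: if_splits)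
  qed
  also have "\<dots> = 1" unfolding \<phi>_def by (rule prod.neutral) (use factor in blast)
  finally have total: "(\<integral>\<^sup>+m. ennreal (limit_dens n \<gamma> \<delta> m) \<partial>lebesgue_space ?N) = 1" .
  have "(\<lambda>m. \<Prod>k=1..?N. ?f k (jacobi_coord k m)) \<in> borel_measurable (lebesgue_space ?N)"
    by (intro borel_measurable_prod measurable_compose[OF jacobi_coord_measurable limit_factor_measurable])
  then have "limit_dens n \<gamma> \<delta> \<in> borel_measurable (lebesgue_space ?N)"
    by (subst measurable_cong[OF eq])
  moreover have "0 \<le> limit_dens n \<gamma> \<delta> m" if "m \<in> space (lebesgue_space ?N)" for m
    unfolding eq[OF that] by (rule prod_nonneg) (use nonneg in auto)
  moreover have "limit_dens n \<gamma> \<delta> m = 0" if "m \<notin> moment_space_interior ?N UNIV" for m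
    using that by (simp add: limit_dens_def)
  ultimately show ?thesis using total unfolding prob_density_on_def by blast
qed

text \<open>Once \<open>s\<close> exceeds the absolute values of the \<open>n\<close> Gauss nodes,
  all weights are positive there. A nonzero \<open>q\<close> with
  \<open>2 * degree q \<le> 2 * n - 1\<close> has fewer than \<open>n\<close> zeros, so it cannot
  vanish at all nodes.\<close>

lemma eventually_wpos:
  assumes n: "n \<ge> 1" and pos: "\<And>i. i < n \<Longrightarrow> orth_norm m 1 i > 0"
  shows "eventually (\<lambda>s. wpos m s (2 * n - 1)) at_top"
proof -
  obtain X lam where X: "finite X" "card X = n" "\<And>x. x \<in> X \<Longrightarrow> lam x > (0 :: real)"
    "\<And>p. degree p \<le> 2 * n - 1 \<Longrightarrow> riesz m p = (\<Sum>x\<in>X. lam x * poly p x)"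
    using gauss_quadrature[OF n pos] by metis
  have "wpos m s (2 * n - 1)" if s: "\<forall>x\<in>X. \<bar>x\<bar> < s" for s
    unfolding wpos_def
  proof (intro ballI allI impI)
    fix v and q :: "real poly"
    assume v: "v \<in> weights s" and q: "q \<noteq> 0" "2 * degree q + degree v \<le> 2 * n - 1"
    have "degree (v * q * q) \<le> 2 * n - 1"
      using q weights_nonzero[OF v] by (simp add: degree_mult_eq)
    then have eq: "rinner m v q q = (\<Sum>x\<in>X. lam x * poly (v * q * q) x)"
      unfolding rinner_def by (rule X(4))
    have vpos: "poly v x > 0" if "x \<in> X" for x using weights_pos[OF v] s that by blast
    have nn: "lam x * poly (v * q * q) x \<ge> 0" if "x \<in> X" for x
      using X(3)[OF that] vpos[OF that] by (simp add: mult.assoc)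
    have "\<exists>x\<in>X. poly q x \<noteq> 0"
    proof (rule ccontr)
      assume "\<not> ?thesis"
      then have "card X \<le> card {x. poly q x = 0}"
        by (intro card_mono poly_roots_finite q) auto
      then show False using card_poly_roots_bound[OF q(1)] X(2) q(2) n by linarith
    qed
    then obtain x where x: "x \<in> X" "poly q x \<noteq> 0" by blast
    have pos_x: "lam x * poly (v * q * q) x > 0"
      using X(3)[OF x(1)] vpos[OF x(1)] x(2) by (simp add: mult.assoc flip: power2_eq_square)
    show "rinner m v q q > 0"
      unfolding eq
    proof (rule sum_pos2[OF X(1) x(1)])
      show "lam x * poly (v * q * q) x > 0" by (rule pos_x)
    qed (rule nn)
  qed
  moreover have "eventually (\<lambda>s. \<forall>x\<in>X. \<bar>x\<bar> < s) at_top"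
    using X(1) by (intro eventually_ball_finite) (auto intro: eventually_gt_at_top)
  ultimately show ?thesis by (auto elim: eventually_mono)
qed

text \<open>The value \<open>0\<close> at index zero makes the formulas below hold from \<open>e = 0\<close> on.\<close>

definition even_canonical_moment :: "real \<Rightarrow> nat \<Rightarrow> (nat \<Rightarrow> real) \<Rightarrow> real" where
  "even_canonical_moment s e m = (if e = 0 then 0 else canonical_moment s (2 * e) m)"

text \<open>Canonical moment times width is the lower gap, which at index \<open>2 * e\<close> is
  the norm of \<open>orth m 1 e\<close>; so that width is replaced by a quantity free of
  \<open>s\<close>.\<close>

lemma range_width_odd:
  assumes s: "s > 0" and wp: "wpos m s (2 * e)"
  shows "range_width s (2 * e + 1) m = 2 * s * (1 - even_canonical_moment s e m) * orth_norm m 1 e"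
proof (cases "e = 0")
  case True
  then show ?thesis using range_width_1[of s m] by (simp add: even_canonical_moment_def orth_norm_def rinner_def)
next
  case False
  have W: "range_width s (2 * e) m > 0"
    using range_width_pos[OF s wpos_mono[OF wp, of "2 * e - 1"]] False by simp
  have "range_width s (Suc (2 * e)) m =
      2 * s * (1 - canonical_moment s (2 * e) m) * (canonical_moment s (2 * e) m * range_width s (2 * e) m)"
    using range_width_Suc[OF wp] False by simp
  also have "canonical_moment s (2 * e) m * range_width s (2 * e) m = lgap s (2 * e) m"
    using W by (simp add: canonical_moment_def)
  also have "\<dots> = orth_norm m 1 e" by (simp add: lgap_def lower_weight_def)
  finally show ?thesis using False by (simp add: even_canonical_moment_def)
qed

text \<open>This is the classical \<open>a_(e+1) = 4 s^2 \<zeta>_(2e+1) \<zeta>_(2e+2)\<close> with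
  \<open>\<zeta>_k = (1 - p_(k-1)) p_k\<close>, solved for \<open>p_(2e+2)\<close>.\<close>

lemma even_canonical_moment_Suc:
  assumes s: "s > 0" and wp: "wpos m s (2 * e + 1)"
  defines "p \<equiv> canonical_moment s (2 * e + 1) m"
  shows "s\<^sup>2 * even_canonical_moment s (Suc e) m
    = jacobi_a m (Suc e) / (4 * p * (1 - p) * (1 - even_canonical_moment s e m))"
proof -
  have "range_width s (2 * Suc e) m = 2 * s * p * (1 - p) * range_width s (2 * e + 1) m"
    using range_width_Suc[OF wp] by (simp add: p_def)
  also have "range_width s (2 * e + 1) m = 2 * s * (1 - even_canonical_moment s e m) * orth_norm m 1 e"
    by (rule range_width_odd[OF s]) (rule wpos_mono[OF wp], simp)
  finally have W: "range_width s (2 * Suc e) m = s\<^sup>2 * (4 * p * (1 - p) * (1 - even_canonical_moment s e m) * orth_norm m 1 e)"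
    by (simp add: power2_eq_square)
  have "even_canonical_moment s (Suc e) m = orth_norm m 1 (Suc e) / range_width s (2 * Suc e) m"
    by (simp add: even_canonical_moment_def canonical_moment_def lgap_def lower_weight_def)
  then show ?thesis unfolding W jacobi_a_def using s by simp
qed

text \<open>With \<open>\<zeta>\<^sub>k = (1 - p\<^sub>k\<^sub>-\<^sub>1) p\<^sub>k\<close> this is the classical relation \<open>b\<^sub>k\<^sub>+\<^sub>1 = - s + 2 s (\<zeta>\<^sub>2\<^sub>k + \<zeta>\<^sub>2\<^sub>k\<^sub>+\<^sub>1)\<close>.\<close>

lemma jacobi_b_canonical:
  assumes s: "s > 0" and wp: "wpos m s (2 * e + 1)"
  shows "jacobi_b m (Suc e) + s = 2 * s * canonical_moment s (2 * e + 1) m * (1 - even_canonical_moment s e m)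
    + (if e = 0 then 0 else jacobi_a m e /
        (2 * s * canonical_moment s (2 * e - 1) m * (1 - even_canonical_moment s (e - 1) m)))"
proof -
  have lg: "lgap s (2 * d + 1) m
      = 2 * s * canonical_moment s (2 * d + 1) m * (1 - even_canonical_moment s d m) * orth_norm m 1 d"
    if "d \<le> e" for d
  proof -
    have wp': "wpos m s (2 * d)" by (rule wpos_mono[OF wp]) (use that in simp)
    then have "range_width s (2 * d + 1) m > 0" using range_width_pos[OF s] by simp
    then have "lgap s (2 * d + 1) m = canonical_moment s (2 * d + 1) m * range_width s (2 * d + 1) m"
      by (simp add: canonical_moment_def)
    then show ?thesis unfolding range_width_odd[OF s wp'] by simp
  qed
  show ?thesis
  proof (cases e)
    case 0
    then show ?thesis
      using jacobi_b_1[of m s] lg[of 0] by (simp add: orth_norm_def rinner_def)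
  next
    case (Suc d)
    have "wpos m s (2 * Suc d)" by (rule wpos_mono[OF wp]) (use Suc in simp)
    note b = jacobi_b_gaps[OF this]
    have pos: "orth_norm m 1 (Suc d) > 0"
      by (rule wpos_orth_norm[OF wp]) (use Suc in \<open>auto simp: weights_def\<close>)
    have "lgap s (2 * Suc d) m = orth_norm m 1 (Suc d)" by (simp add: lgap_def lower_weight_def)
    then have "jacobi_b m (Suc (Suc d)) + s
      = (lgap s (2 * Suc d + 1) m + (orth_norm m 1 (Suc d))\<^sup>2 / lgap s (2 * d + 1) m) / orth_norm m 1 (Suc d)"
      using b pos by (simp add: field_simps)
    also have "\<dots> = lgap s (2 * Suc d + 1) m / orth_norm m 1 (Suc d) + orth_norm m 1 (Suc d) / lgap s (2 * d + 1) m"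
      using pos by (simp add: add_divide_distrib power2_eq_square)
    finally show ?thesis
      using lg[of "Suc d"] lg[of d] pos Suc by (simp add: jacobi_a_def)
  qed
qed

text \<open>The two limits feed each other. If \<open>s^2 p_(2e)\<close> converges, then
  \<open>s p_(2e)\<close> tends to 0 and the formula for \<open>b_(e+1)\<close> yields the
  first-order behaviour of \<open>p_(2e+1)\<close> around 1/2; then \<open>4 p (1 - p)\<close> tends
  to 1 for \<open>p = p_(2e+1)\<close>, and \<open>s^2 p_(2e+2)\<close> tends to
  \<open>a_(e+1)\<close>.\<close>

lemma canonical_moment_limits:
  assumes n: "n \<ge> 1" and pos: "\<And>i. i < n \<Longrightarrow> orth_norm m 1 i > 0" and e: "e < n"
  shows "((\<lambda>s. s\<^sup>2 * even_canonical_moment s e m) \<longlongrightarrow> (if e = 0 then 0 else jacobi_a m e)) at_top \<and>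
    ((\<lambda>s. s * (2 * canonical_moment s (2 * e + 1) m - 1)) \<longlongrightarrow> jacobi_b m (Suc e)) at_top"
proof -
  have inv: "((\<lambda>s::real. inverse s) \<longlongrightarrow> 0) at_top" by (rule tendsto_inverse_0_at_top[OF filterlim_ident])
  have evs: "eventually (\<lambda>s::real. s > 0) at_top" by (rule eventually_gt_at_top)
  have wp: "eventually (\<lambda>s. wpos m s (2 * n - 1)) at_top" by (rule eventually_wpos[OF n pos])
  have vanish: "((\<lambda>s. s * f s) \<longlongrightarrow> 0) at_top" "(f \<longlongrightarrow> 0) at_top"
    if "((\<lambda>s. s\<^sup>2 * f s) \<longlongrightarrow> l) at_top" for f :: "real \<Rightarrow> real" and l
  proof -
    have "((\<lambda>s. s\<^sup>2 * f s * inverse s) \<longlongrightarrow> l * 0) at_top" by (intro tendsto_mult that inv)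
    moreover have "eventually (\<lambda>s. s\<^sup>2 * f s * inverse s = s * f s) at_top"
      using evs by eventually_elim (simp add: power2_eq_square)
    ultimately show 1: "((\<lambda>s. s * f s) \<longlongrightarrow> 0) at_top" by (rule tendsto_eventually_eq) simp
    have "((\<lambda>s. s * f s * inverse s) \<longlongrightarrow> 0 * 0) at_top" by (intro tendsto_mult 1 inv)
    moreover have "eventually (\<lambda>s. s * f s * inverse s = f s) at_top"
      using evs by eventually_elim simp
    ultimately show "(f \<longlongrightarrow> 0) at_top" by (rule tendsto_eventually_eq) simp
  qed
  have odd_step: "((\<lambda>s. s * (2 * canonical_moment s (2 * e + 1) m - 1)) \<longlongrightarrow> jacobi_b m (Suc e)) at_top"
    if e: "e < n" and Q: "((\<lambda>s. s\<^sup>2 * even_canonical_moment s e m) \<longlongrightarrow> l) at_top"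
      and R: "((\<lambda>s. (if e = 0 then 0 else jacobi_a m e /
        (2 * s * canonical_moment s (2 * e - 1) m * (1 - even_canonical_moment s (e - 1) m)))) \<longlongrightarrow> 0) at_top"
      (is "(?R \<longlongrightarrow> 0) at_top") for e l
  proof -
    let ?Q = "\<lambda>s. even_canonical_moment s e m"
    \<comment> \<open>The formula for \<open>b\<close> solved for \<open>s (2 p - 1)\<close>: of the
      terms of order \<open>s\<close> only \<open>s ?Q\<close> remains, which tends to 0.\<close>
    have "((\<lambda>s. (jacobi_b m (Suc e) - ?R s + s * ?Q s) / (1 - ?Q s)) \<longlongrightarrow> (jacobi_b m (Suc e) - 0 + 0) / (1 - 0)) at_top"
      by (intro tendsto_intros R vanish[OF Q]) auto
    moreover have "eventually (\<lambda>s. (jacobi_b m (Suc e) - ?R s + s * ?Q s) / (1 - ?Q s)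
        = s * (2 * canonical_moment s (2 * e + 1) m - 1)) at_top"
      using evs wp order_tendstoD(2)[OF vanish(2)[OF Q], of 1, simplified]
    proof eventually_elim
      case (elim s)
      have "jacobi_b m (Suc e) + s = 2 * s * canonical_moment s (2 * e + 1) m * (1 - ?Q s) + ?R s"
        by (rule jacobi_b_canonical[OF elim(1)]) (rule wpos_mono[OF elim(2)], use e in simp)
      then have "jacobi_b m (Suc e) - ?R s + s * ?Q s = s * (2 * canonical_moment s (2 * e + 1) m - 1) * (1 - ?Q s)"
        by (simp add: algebra_simps)
      then show ?case using elim(3) by simp
    qed
    ultimately show ?thesis by (rule tendsto_eventually_eq) simp
  qed
  show ?thesis
    using e
  proof (induction e)
    case 0
    have "((\<lambda>s. s\<^sup>2 * even_canonical_moment s 0 m) \<longlongrightarrow> 0) at_top" by (simp add: even_canonical_moment_def)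
    then show ?case using odd_step[OF 0] by simp
  next
    case (Suc e)
    let ?p = "\<lambda>s. canonical_moment s (2 * e + 1) m" and ?Q = "\<lambda>s. even_canonical_moment s e m"
    have IH: "((\<lambda>s. s\<^sup>2 * ?Q s) \<longlongrightarrow> (if e = 0 then 0 else jacobi_a m e)) at_top"
      "((\<lambda>s. s * (2 * ?p s - 1)) \<longlongrightarrow> jacobi_b m (Suc e)) at_top"
      using Suc by auto
    note Q = vanish(2)[OF IH(1)]
    have "((\<lambda>s. (s * (2 * ?p s - 1) * inverse s + 1) / 2) \<longlongrightarrow> (jacobi_b m (Suc e) * 0 + 1) / 2) at_top"
      by (intro tendsto_intros IH inv) auto
    moreover have "eventually (\<lambda>s. (s * (2 * ?p s - 1) * inverse s + 1) / 2 = ?p s) at_top"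
      using evs by eventually_elim (simp add: field_simps)
    ultimately have p: "(?p \<longlongrightarrow> 1 / 2) at_top" by (rule tendsto_eventually_eq) simp
    have "((\<lambda>s. jacobi_a m (Suc e) / (4 * ?p s * (1 - ?p s) * (1 - ?Q s)))
        \<longlongrightarrow> jacobi_a m (Suc e) / (4 * (1/2) * (1 - 1/2) * (1 - 0))) at_top"
      by (intro tendsto_intros p Q) auto
    moreover have "eventually (\<lambda>s. jacobi_a m (Suc e) / (4 * ?p s * (1 - ?p s) * (1 - ?Q s))
        = s\<^sup>2 * even_canonical_moment s (Suc e) m) at_top"
      using evs wp
    proof eventually_elim
      case (elim s)
      have "wpos m s (2 * e + 1)" by (rule wpos_mono[OF elim(2)]) (use Suc.prems in simp)
      from even_canonical_moment_Suc[OF elim(1) this] show ?case by simp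
    qed
    ultimately have Q': "((\<lambda>s. s\<^sup>2 * even_canonical_moment s (Suc e) m) \<longlongrightarrow> jacobi_a m (Suc e)) at_top"
      by (rule tendsto_eventually_eq) simp
    have "((\<lambda>s. jacobi_a m (Suc e) * inverse s / (2 * ?p s * (1 - ?Q s)))
        \<longlongrightarrow> jacobi_a m (Suc e) * 0 / (2 * (1/2) * (1 - 0))) at_top"
      by (intro tendsto_intros p Q inv) auto
    moreover have "jacobi_a m (Suc e) * inverse s / (2 * ?p s * (1 - ?Q s))
        = jacobi_a m (Suc e) / (2 * s * ?p s * (1 - ?Q s))" for s
      unfolding divide_inverse inverse_mult_distrib by (simp only: mult_ac)
    ultimately have "((\<lambda>s. jacobi_a m (Suc e) / (2 * s * ?p s * (1 - ?Q s))) \<longlongrightarrow> 0) at_top" by simp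
    then have "((\<lambda>s. s * (2 * canonical_moment s (2 * Suc e + 1) m - 1)) \<longlongrightarrow> jacobi_b m (Suc (Suc e))) at_top"
      by (intro odd_step[OF Suc.prems Q']) simp
    then show ?case using Q' by simp
  qed
qed

text \<open>Indices \<open>2 j - 1\<close> and \<open>2 j\<close> together carry \<open>2 s\<close>
  to the power \<open>2 i + 1\<close>, where \<open>i = 2 n - 2 j\<close>. This is regrouped as
  \<open>2 ^ (2 i + 1) * s\<close> for the odd index and \<open>s ^ (2 i)\<close> for the even one,
  the scalings under which the two Beta densities converge. The unpaired index
  \<open>2 n - 1\<close> has \<open>i = 0\<close>.\<close>

lemma prod_powers_2s:
  fixes s :: real
  assumes n: "n \<ge> 1" and s: "s > 0"
  shows "(\<Prod>k=1..2*n-1. (2 * s) ^ (2 * n - 1 - k + 1))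
    = (\<Prod>j=1..n. 2 powr (2 * real (2 * n - 2 * j) + 1) * s) * (\<Prod>j=1..n-1. (s\<^sup>2) powr real (2 * n - 2 * j))"
proof -
  have ins: "{1..n} = insert n {1..n - 1}" "n \<notin> {1..n - 1}" using n by auto
  have pw: "2 powr (2 * real i + 1) = 2 ^ (2 * i + 1)" for i :: nat
    using powr_realpow[of 2 "2 * i + 1"] by (simp add: add.commute)
  have step: "(2 * s) ^ (2 * n - 1 - (2 * j - 1) + 1) * (2 * s) ^ (2 * n - 1 - 2 * j + 1)
      = (2 powr (2 * real (2 * n - 2 * j) + 1) * s) * (s\<^sup>2) powr real (2 * n - 2 * j)" if "j \<in> {1..n - 1}" for j
  proof -
    define i where "i = 2 * n - 2 * j"
    have e: "2 * n - 1 - (2 * j - 1) + 1 = i + 1" "2 * n - 1 - 2 * j + 1 = i"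
      using that by (auto simp: i_def)
    have "(2 * s) ^ (i + 1) * (2 * s) ^ i = 2 ^ (2 * i + 1) * s * (s\<^sup>2) ^ i"
      by (simp add: power_mult_distrib power_add power_mult power2_eq_square mult_ac)
    then show ?thesis
      unfolding e i_def[symmetric] pw using s by (simp add: powr_realpow)
  qed
  have "(\<Prod>k=1..2*n-1. (2 * s) ^ (2 * n - 1 - k + 1))
      = 2 * s * (\<Prod>j=1..n-1. (2 * s) ^ (2 * n - 1 - (2 * j - 1) + 1) * (2 * s) ^ (2 * n - 1 - 2 * j + 1))"
    unfolding prod_odd_even[OF n] prod.distrib using ins n by (simp add: mult.assoc)
  also have "(\<Prod>j=1..n-1. (2 * s) ^ (2 * n - 1 - (2 * j - 1) + 1) * (2 * s) ^ (2 * n - 1 - 2 * j + 1))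
      = (\<Prod>j=1..n-1. (2 powr (2 * real (2 * n - 2 * j) + 1) * s) * (s\<^sup>2) powr real (2 * n - 2 * j))"
    by (rule prod.cong) (use step in auto)
  finally show ?thesis
    unfolding prod.distrib using ins by (simp add: prod.distrib mult_ac)
qed

theorem theorem2p4:
  fixes n :: nat
    and \<gamma> \<delta> :: "nat \<Rightarrow> real"
    and \<gamma>s \<delta>s :: "real \<Rightarrow> nat \<Rightarrow> real"
  assumes "n \<ge> 1"
    and "\<forall>k\<in>{1..n-1}. \<gamma> k > -1"
    and "\<forall>k\<in>{1..2*n-1}. \<delta> k > 0"
    and "\<forall>s>0. \<forall>k\<in>{1..2*n-1}. \<gamma>s s k > -1 \<and> \<delta>s s k > -1"
    and "\<forall>k\<in>{1..n}. (\<lambda>s. \<gamma>s s (2*k-1) - \<delta> (2*k-1) * s\<^sup>2) \<in> o[at_top](\<lambda>_. 1)"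
    and "\<forall>k\<in>{1..n}. (\<lambda>s. \<delta>s s (2*k-1) - \<delta> (2*k-1) * s\<^sup>2) \<in> o[at_top](\<lambda>_. 1)"
    and "\<forall>k\<in>{1..n-1}. (\<lambda>s. \<gamma>s s (2*k) - \<gamma> k) \<in> o[at_top](\<lambda>_. 1)"
    and "\<forall>k\<in>{1..n-1}. (\<lambda>s. \<delta>s s (2*k) - \<delta> (2*k) * s\<^sup>2) \<in> o[at_top](\<lambda>s. s\<^sup>2)"
  shows "(\<forall>m\<in>space (lebesgue_space (2*n-1)).
            ((\<lambda>s. moment_dens (2*n-1) s (\<gamma>s s) (\<delta>s s) m) \<longlongrightarrow> limit_dens n \<gamma> \<delta> m) at_top)
         \<and> prob_density_on (2*n-1) UNIV (limit_dens n \<gamma> \<delta>)"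
proof (intro conjI ballI)
  note n = assms(1) and \<gamma> = assms(2) and \<delta> = assms(3)
  let ?N = "2 * n - 1"
  show "prob_density_on ?N UNIV (limit_dens n \<gamma> \<delta>)"
    by (rule prob_density_limit_dens[OF n \<gamma> \<delta>])
  fix m assume "m \<in> space (lebesgue_space ?N)"
  then have m: "m \<in> extensional {1..?N}" by (auto simp: space_PiM PiE_def)
  have evs: "eventually (\<lambda>s::real. s > 0) at_top" by (rule eventually_gt_at_top)
  show "((\<lambda>s. moment_dens ?N s (\<gamma>s s) (\<delta>s s) m) \<longlongrightarrow> limit_dens n \<gamma> \<delta> m) at_top"
  proof (cases "\<forall>i<n. orth_norm m 1 i > 0")
    case False
    have "eventually (\<lambda>s. moment_dens ?N s (\<gamma>s s) (\<delta>s s) m = 0) at_top"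
      using evs
    proof eventually_elim
      case (elim s)
      \<comment> \<open>As 1 is among the weights, \<open>wpos\<close> for a single \<open>s\<close>
        would make all norms \<open>orth_norm m 1 i\<close> positive. Hence the density at
        \<open>m\<close> is 0 for every \<open>s > 0\<close>, as is the limit.\<close>
      have "\<not> wpos m s ?N"
      proof
        assume "wpos m s ?N"
        then have "orth_norm m 1 i > 0" if "i < n" for i
          by (rule wpos_orth_norm) (use that in \<open>auto simp: weights_def\<close>)
        then show False using False by blast
      qed
      then obtain k where k: "k \<in> {1..?N}" "canonical_moment s k m \<notin> {0<..<1}"
        unfolding wpos_iff_canonical_moments[OF elim] by blast
      then have "unnorm_dens ?N s (\<gamma>s s) (\<delta>s s) m = 0"
        unfolding unnorm_dens_eq[OF elim]
        by (intro prod_zero bexI[of _ k]) (auto simp: beta_factor_def)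
      then show ?case by (simp add: moment_dens_def)
    qed
    moreover have "limit_dens n \<gamma> \<delta> m = 0"
      using False moment_space_interior_real[OF n m] by (simp add: limit_dens_def)
    ultimately show ?thesis by (simp add: tendsto_eventually)
  next
    case True
    then have pos: "\<And>i. i < n \<Longrightarrow> orth_norm m 1 i > 0" by blast
    \<comment> \<open>The contribution of index \<open>k\<close> without its power of
      \<open>2 s\<close>; these powers are attached only after the regrouping in
      \<open>prod_powers_2s\<close>.\<close>
    define G where "G k s = canonical_moment s k m powr \<gamma>s s k * (1 - canonical_moment s k m) powr \<delta>s s k
        / Beta (\<gamma>s s k + real (?N - k) + 1) (\<delta>s s k + real (?N - k) + 1)" for k s
    have in01: "eventually (\<lambda>s. \<forall>k\<in>{1..?N}. canonical_moment s k m \<in> {0<..<1}) at_top"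
    proof -
      have "eventually (\<lambda>s. wpos m s ?N) at_top" by (rule eventually_wpos[OF n pos])
      then show ?thesis using evs by eventually_elim (simp add: wpos_iff_canonical_moments)
    qed
    have ev: "eventually (\<lambda>s. 0 < canonical_moment s k m \<and> canonical_moment s k m < 1) at_top"
      if "k \<in> {1..?N}" for k
      using in01 by eventually_elim (use that in auto)
    have odd: "((\<lambda>s. G (2 * j - 1) s / (2 powr (2 * real (2 * n - 2 * j) + 1) * s))
        \<longlongrightarrow> sqrt (\<delta> (2 * j - 1) / pi) * exp (- \<delta> (2 * j - 1) * (jacobi_b m j)\<^sup>2)) at_top" if j: "j \<in> {1..n}" for j
    proof -
      obtain e where e: "j = Suc e" "e < n" using j by (cases j) auto
      have D: "real (?N - (2 * j - 1)) = real (2 * n - 2 * j)"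
        by (rule arg_cong[of _ _ real]) (use j in auto)
      show ?thesis
        unfolding G_def D
      proof (rule Beta_density_odd_tendsto)
        show "eventually (\<lambda>s. 0 < canonical_moment s (2 * j - 1) m \<and> canonical_moment s (2 * j - 1) m < 1) at_top"
          by (rule ev) (use j in auto)
        show "((\<lambda>s. s * (2 * canonical_moment s (2 * j - 1) m - 1)) \<longlongrightarrow> jacobi_b m j) at_top"
          using canonical_moment_limits[OF n pos e(2)] e(1) by simp
        show "((\<lambda>s. \<gamma>s s (2 * j - 1) - \<delta> (2 * j - 1) * s\<^sup>2) \<longlongrightarrow> 0) at_top"
          using smalloD_tendsto[OF assms(5)[rule_format, OF j]] by simp
        show "((\<lambda>s. \<delta>s s (2 * j - 1) - \<delta> (2 * j - 1) * s\<^sup>2) \<longlongrightarrow> 0) at_top"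
          using smalloD_tendsto[OF assms(6)[rule_format, OF j]] by simp
        have "2 * j - 1 \<in> {1..?N}" using j by auto
        then show "\<delta> (2 * j - 1) > 0" using \<delta> by blast
      qed
    qed
    have even: "((\<lambda>s. G (2 * j) s / (s\<^sup>2) powr real (2 * n - 2 * j))
        \<longlongrightarrow> \<delta> (2 * j) powr (\<gamma> j + real (2 * n - 2 * j)) / Gamma (\<gamma> j + real (2 * n - 2 * j))
          * jacobi_a m j powr \<gamma> j * exp (- \<delta> (2 * j) * jacobi_a m j)) at_top" if j: "j \<in> {1..n-1}" for j
    proof -
      \<comment> \<open>At index \<open>2 j\<close> only \<open>2 n - 2 j - 1\<close> moments
        follow; with the extra 1 of the Beta parameter this is \<open>D = 2 n - 2 j\<close>, whereas
        at \<open>2 j - 1\<close> the count itself is \<open>D\<close> and the 1 stays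
        separate.\<close>
      have "?N - 2 * j + 1 = 2 * n - 2 * j" using j by auto
      then have "real (?N - 2 * j) + 1 = real (2 * n - 2 * j)" by (metis of_nat_1 of_nat_add)
      then have D: "x + real (?N - 2 * j) + 1 = x + real (2 * n - 2 * j)" for x by simp
      have jn: "j < n" "j \<noteq> 0" "2 * j \<in> {1..?N}" using j by auto
      show ?thesis
        unfolding G_def D
      proof (rule Beta_density_even_tendsto)
        show "eventually (\<lambda>s. 0 < canonical_moment s (2 * j) m \<and> canonical_moment s (2 * j) m < 1) at_top"
          by (rule ev[OF jn(3)])
        show "((\<lambda>s. s\<^sup>2 * canonical_moment s (2 * j) m) \<longlongrightarrow> jacobi_a m j) at_top"
          using canonical_moment_limits[OF n pos jn(1)] jn(2) by (simp add: even_canonical_moment_def)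
        show "((\<lambda>s. \<gamma>s s (2 * j)) \<longlongrightarrow> \<gamma> j) at_top"
          using smalloD_tendsto[OF assms(7)[rule_format, OF j]] by (simp add: LIM_zero_iff)
        have "((\<lambda>s. (\<delta>s s (2 * j) - \<delta> (2 * j) * s\<^sup>2) / s\<^sup>2 + \<delta> (2 * j)) \<longlongrightarrow> 0 + \<delta> (2 * j)) at_top"
          by (intro tendsto_add tendsto_const smalloD_tendsto[OF assms(8)[rule_format, OF j]])
        moreover have "eventually (\<lambda>s. (\<delta>s s (2 * j) - \<delta> (2 * j) * s\<^sup>2) / s\<^sup>2 + \<delta> (2 * j) = \<delta>s s (2 * j) / s\<^sup>2) at_top"
          using evs by eventually_elim (simp add: field_simps)
        ultimately show "((\<lambda>s. \<delta>s s (2 * j) / s\<^sup>2) \<longlongrightarrow> \<delta> (2 * j)) at_top"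
          by (rule tendsto_eventually_eq) simp
        show "jacobi_a m j > 0" using pos[of j] pos[of "j - 1"] jn by (simp add: jacobi_a_def)
        show "\<delta> (2 * j) > 0" using \<delta> jn(3) by blast
        have "real (2 * n - 2 * j) \<ge> 2" using jn by linarith
        then show "\<gamma> j + real (2 * n - 2 * j) > 0" using \<gamma> j by force
      qed
    qed
    have lim: "((\<lambda>s. (\<Prod>j=1..n. G (2 * j - 1) s / (2 powr (2 * real (2 * n - 2 * j) + 1) * s))
        * (\<Prod>j=1..n-1. G (2 * j) s / (s\<^sup>2) powr real (2 * n - 2 * j)))
      \<longlongrightarrow> (\<Prod>j=1..n. sqrt (\<delta> (2 * j - 1) / pi) * exp (- \<delta> (2 * j - 1) * (jacobi_b m j)\<^sup>2))
        * (\<Prod>j=1..n-1. \<delta> (2 * j) powr (\<gamma> j + real (2 * n - 2 * j)) / Gamma (\<gamma> j + real (2 * n - 2 * j))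
          * jacobi_a m j powr \<gamma> j * exp (- \<delta> (2 * j) * jacobi_a m j))) at_top"
      by (intro tendsto_mult tendsto_prod odd even)
    have eq: "(\<Prod>j=1..n. sqrt (\<delta> (2 * j - 1) / pi) * exp (- \<delta> (2 * j - 1) * (jacobi_b m j)\<^sup>2))
        * (\<Prod>j=1..n-1. \<delta> (2 * j) powr (\<gamma> j + real (2 * n - 2 * j)) / Gamma (\<gamma> j + real (2 * n - 2 * j))
          * jacobi_a m j powr \<gamma> j * exp (- \<delta> (2 * j) * jacobi_a m j)) = limit_dens n \<gamma> \<delta> m"
    proof -
      have "limit_factor n \<gamma> \<delta> (2 * j - 1) (jacobi_coord (2 * j - 1) m)
          = sqrt (\<delta> (2 * j - 1) / pi) * exp (- \<delta> (2 * j - 1) * (jacobi_b m j)\<^sup>2)" if "j \<in> {1..n}" for j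
      proof -
        have "odd (2 * j - 1)" "jacobi_coord (2 * j - 1) m = jacobi_b m j"
          using that jacobi_coord_eq by auto
        then show ?thesis by (simp only: limit_factor_def if_True not_False_eq_True)
      qed
      moreover have "limit_factor n \<gamma> \<delta> (2 * j) (jacobi_coord (2 * j) m)
          = \<delta> (2 * j) powr (\<gamma> j + real (2 * n - 2 * j)) / Gamma (\<gamma> j + real (2 * n - 2 * j))
            * jacobi_a m j powr \<gamma> j * exp (- \<delta> (2 * j) * jacobi_a m j)" if "j \<in> {1..n-1}" for j
      proof -
        have j: "1 \<le> j" "j < n" using that by auto
        then have "jacobi_a m j > 0" using pos[of j] pos[of "j - 1"] by (simp add: jacobi_a_def)
        moreover have "real (2 * n - 2 * j) = 2 * real n - 2 * real j" using j by (simp add: of_nat_diff)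
        ultimately show ?thesis
          using jacobi_coord_eq(2)[OF j(1)] by (simp add: limit_factor_def add_diff_eq)
      qed
      ultimately show ?thesis
        unfolding limit_dens_eq[OF n m] prod_odd_even[OF n] by (simp only: cong: prod.cong)
    qed
    have dens: "eventually (\<lambda>s. (\<Prod>j=1..n. G (2 * j - 1) s / (2 powr (2 * real (2 * n - 2 * j) + 1) * s))
        * (\<Prod>j=1..n-1. G (2 * j) s / (s\<^sup>2) powr real (2 * n - 2 * j))
        = moment_dens ?N s (\<gamma>s s) (\<delta>s s) m) at_top"
      using evs in01
    proof eventually_elim
      case (elim s)
      have "moment_dens ?N s (\<gamma>s s) (\<delta>s s) m
          = (\<Prod>k=1..?N. beta_factor (\<gamma>s s k) (\<delta>s s k) (canonical_moment s k m))
            / (\<Prod>k=1..?N. (2 * s) ^ (?N - k + 1) * Beta (\<gamma>s s k + real (?N - k) + 1) (\<delta>s s k + real (?N - k) + 1))"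
        unfolding moment_dens_def unnorm_dens_eq[OF elim(1)]
        by (subst integral_unnorm_dens[OF elim(1), unfolded unnorm_dens_eq[OF elim(1)]])
          (use assms(4) elim(1) in auto)
      also have "\<dots> = (\<Prod>k=1..?N. G k s) / (\<Prod>k=1..?N. (2 * s) ^ (?N - k + 1))"
        unfolding prod_dividef[symmetric]
        by (rule prod.cong) (use elim(2) in \<open>auto simp: G_def beta_factor_def\<close>)
      also have "\<dots> = (\<Prod>j=1..n. G (2 * j - 1) s / (2 powr (2 * real (2 * n - 2 * j) + 1) * s))
          * (\<Prod>j=1..n-1. G (2 * j) s / (s\<^sup>2) powr real (2 * n - 2 * j))"
        unfolding prod_powers_2s[OF n elim(1)] prod_odd_even[OF n] prod_dividef by simp
      finally show ?case by simp
    qed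
    show ?thesis by (rule tendsto_eventually_eq[OF lim dens eq])
  qed
qed

end
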